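(* The real algebra $A=\mathbb{R}\big[x,y,\frac{1}{x^2+y^2}\big]$ satisfies $\mathrm{psd}=\mathrm{sos}$: every element of $A$ that is non-negative on $\mathbb{R}^2\setminus\{(0,0)\}$ is a finite sum of squares of elements of $A$.
   Context: $A$ is the subring of the rational function field $\mathbb{R}(x,y)$ generated by $\mathbb{R}[x,y]$ and $\frac{1}{x^2+y^2}$; its elements are regarded as functions on $\mathbb{R}^2\setminus\{(0,0)\}$. The characters (unital algebra homomorphisms $A\to\mathbb{R}$) of $A$ are exactly the point evaluations at points of $\mathbb{R}^2\setminus\{(0,0)\}$. A finitely generated real unital commutative algebra satisfies $\mathrm{psd}=\mathrm{sos}$ if every element that is non-negative under all characters is a finite sum of squares of elements of the algebra. *)

theory Defs
  imports "HOL-Computational_Algebra.Computational_Algebra"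
begin


text \<open>
  A real unital commutative algebra is represented by a subring \<open>A\<close> of an ambient commutative
  ring, together with a map \<open>emb\<close> giving the embedding of the scalars \<open>\<real>\<close> into \<open>A\<close>.
\<close>

definition is_subring :: "'a::comm_ring_1 set \<Rightarrow> bool" where
  "is_subring S \<longleftrightarrow> 1 \<in> S \<and> (\<forall>f\<in>S. \<forall>g\<in>S. f + g \<in> S) \<and> (\<forall>f\<in>S. - f \<in> S)
     \<and> (\<forall>f\<in>S. \<forall>g\<in>S. f * g \<in> S)"

text \<open>Only the values of \<open>\<phi>\<close> on \<open>A\<close> matter.\<close>

definition is_character :: "(real \<Rightarrow> 'a::comm_ring_1) \<Rightarrow> 'a set \<Rightarrow> ('a \<Rightarrow> real) \<Rightarrow> bool" where
  "is_character emb A \<phi> \<longleftrightarrow>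
     \<phi> 1 = 1
     \<and> (\<forall>f\<in>A. \<forall>g\<in>A. \<phi> (f + g) = \<phi> f + \<phi> g)
     \<and> (\<forall>f\<in>A. \<forall>g\<in>A. \<phi> (f * g) = \<phi> f * \<phi> g)
     \<and> (\<forall>c. \<forall>f\<in>A. \<phi> (emb c * f) = c * \<phi> f)"

definition sos :: "'a::comm_ring_1 set \<Rightarrow> 'a set" where
  "sos A = {f. \<exists>gs. set gs \<subseteq> A \<and> f = (\<Sum>g\<leftarrow>gs. g\<^sup>2)}"

definition psd_eq_sos :: "(real \<Rightarrow> 'a::comm_ring_1) \<Rightarrow> 'a set \<Rightarrow> bool" where
  "psd_eq_sos emb A \<longleftrightarrow>
     (\<forall>f\<in>A. (\<forall>\<phi>. is_character emb A \<phi> \<longrightarrow> 0 \<le> \<phi> f) \<longrightarrow> f \<in> sos A)"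



text \<open>
  \<open>\<real>[x,y]\<close> is \<^typ>\<open>real poly poly\<close>, read as \<open>\<real>[x][y]\<close>: the outer variable is \<open>y\<close> and the
  inner one is \<open>x\<close>. Accordingly \<open>\<real>(x,y)\<close> is \<^typ>\<open>real poly poly fract\<close>.
\<close>

definition varX :: "real poly poly" where "varX = [:[:0, 1:]:]"
definition varY :: "real poly poly" where "varY = [:0, 1:]"

definition poly2 :: "real poly poly \<Rightarrow> real \<Rightarrow> real \<Rightarrow> real" where
  "poly2 p a b = poly (poly p [:b:]) a"

definition const :: "real \<Rightarrow> real poly poly fract" where
  "const c = to_fract [:[:c:]:]"

text \<open>
  The value of a rational function at \<open>(a, b)\<close>; unspecified if no representing fraction has a
  denominator that is nonzero there. This does not occur for elements of \<open>algA\<close> below and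
  \<open>(a, b) \<noteq> (0, 0)\<close>, see \<open>algA_regular\<close>.
\<close>

definition ev :: "real poly poly fract \<Rightarrow> real \<times> real \<Rightarrow> real" where
  "ev f = (\<lambda>(a, b). THE v. \<exists>p q. poly2 q a b \<noteq> 0 \<and> f = Fract p q \<and> v = poly2 p a b / poly2 q a b)"

definition algA :: "real poly poly fract set" where
  "algA = is_subring hull (range to_fract \<union> {inverse (to_fract (varX\<^sup>2 + varY\<^sup>2))})"

lemma poly2_simps [simp]:
  "poly2 0 a b = 0" "poly2 1 a b = 1"
  "poly2 (p + q) a b = poly2 p a b + poly2 q a b"
  "poly2 (p * q) a b = poly2 p a b * poly2 q a b"
  "poly2 (- p) a b = - poly2 p a b"
  "poly2 (p ^ n) a b = poly2 p a b ^ n"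
  "poly2 varX a b = a" "poly2 varY a b = b" "poly2 [:[:c:]:] a b = c"
  by (simp_all add: poly2_def varX_def varY_def)

lemma ev_Fract:
  assumes "poly2 q a b \<noteq> 0"
  shows "ev (Fract p q) (a, b) = poly2 p a b / poly2 q a b"
proof -
  have "v = poly2 p a b / poly2 q a b"
    if "poly2 q' a b \<noteq> 0" "Fract p q = Fract p' q'" "v = poly2 p' a b / poly2 q' a b" for p' q' v
  proof -
    have "q \<noteq> 0" "q' \<noteq> 0" using assms that(1) by auto
    with that(2) have "p * q' = p' * q" by (simp add: eq_fract)
    then have "poly2 (p * q') a b = poly2 (p' * q) a b" by simp
    with assms that show ?thesis by (simp add: frac_eq_eq)
  qed
  with assms show ?thesis unfolding ev_def prod.case by (intro the_equality) blast+
qed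

lemma is_subring_algA: "is_subring algA"
  unfolding algA_def by (rule hull_in) (auto simp: is_subring_def)

lemma algA_regular:
  assumes "f \<in> algA" "(a, b) \<noteq> (0, 0)"
  shows "\<exists>p q. poly2 q a b \<noteq> 0 \<and> f = Fract p q"
proof -
  define S where "S = {f. \<exists>p q. poly2 q a b \<noteq> 0 \<and> f = Fract p q}"
  have SI: "Fract p q \<in> S" if "poly2 q a b \<noteq> 0" for p q using that by (auto simp: S_def)
  have SE: "\<exists>p q. poly2 q a b \<noteq> 0 \<and> q \<noteq> 0 \<and> f = Fract p q" if "f \<in> S" for f
    using that by (auto simp: S_def) (metis poly2_simps(1))
  have add: "f + g \<in> S" and mult: "f * g \<in> S" if fg: "f \<in> S" "g \<in> S" for f g
  proof -
    from SE[OF fg(1)] SE[OF fg(2)] obtain p q p' q' where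
      *: "poly2 q a b \<noteq> 0" "q \<noteq> 0" "f = Fract p q" "poly2 q' a b \<noteq> 0" "q' \<noteq> 0" "g = Fract p' q'"
      by blast
    show "f + g \<in> S" "f * g \<in> S" using * by (auto intro!: SI)
  qed
  have neg: "- f \<in> S" if "f \<in> S" for f
    using SE[OF that] by (auto intro!: SI)
  have poly: "to_fract p \<in> S" for p unfolding to_fract_def by (rule SI) simp
  have "is_subring S" unfolding is_subring_def
    using add mult neg poly[of 1] by simp
  moreover have "inverse (to_fract (varX\<^sup>2 + varY\<^sup>2)) \<in> S"
    using assms(2) by (auto simp: to_fract_def sum_power2_eq_zero_iff intro!: SI)
  ultimately have "algA \<subseteq> S" unfolding algA_def by (intro hull_minimal) (auto simp: poly)
  then show ?thesis using assms(1) by (auto simp: S_def)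
qed

end

theory Submission
  imports Defs "HOL-Computational_Algebra.Field_as_Ring"
begin

text \<open>
  Writing \<open>x = t y\<close>, the claim follows from: if \<open>f \<in> \<real>[t, r]\<close> is nonnegative on \<open>\<real>\<^sup>2\<close>, then
  \<open>(1 + t\<^sup>2)\<^sup>N f\<close> is a sum of squares for some \<open>N\<close>; powers of \<open>y\<close> introduced by clearing
  denominators cancel, because a sum of squares that vanishes on a real line has only summands
  that vanish there.

  Dividing by square factors and applying linear fractional changes of \<open>r\<close> and \<open>t\<close>, one may
  assume that \<open>f(t, \<sqdot>)\<close> is strictly positive, also at \<open>r = \<infinity>\<close>, for all \<open>t \<in> \<real> \<union> {\<infinity>}\<close> outside a
  finite set \<open>Z\<close> of reals; a Bezout identity \<open>u f + v \<partial>\<^sub>r f = D(t)\<close> bounds \<open>f\<close> below by a power of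
  the distance to \<open>Z\<close>. At a point of \<open>Z\<close>, Puiseux's theorem shows that \<open>f\<close> is a sum of two
  squares over formal power series in \<open>t\<close>: a factor over \<open>\<complex>[[t]]\<close> that is its own conjugate has a
  real branch and therefore occurs with even multiplicity. Truncating these power series and
  damping the result away from \<open>Z\<close> removes the zeros and leaves a strictly positive polynomial.
  For those, Reznick's argument applies: up to a factor \<open>(1 + t\<^sup>2)\<^sup>N\<close> an averaging operator with the
  kernels \<open>(1 + t t\<^sub>j)\<^sup>2\<^sup>N\<close> is invertible and close to the identity, and it turns positive
  polynomials into sums of squares.
\<close>

text \<open>In the chart \<open>x = t y\<close> one has \<open>x^2 + y^2 = y^2 (1 + t^2)\<close>, so
  powers of \<open>1 + t^2\<close> are what the algebra can invert. Some denominator is unavoidable,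
  since a nonnegative polynomial in two variables need not be a sum of squares, and one with real
  zeros off the origin would not be a unit. The two variables therefore play different roles.
  \<open>t\<close> runs over a compact circle, where averaging costs only powers of
  \<open>1 + t^2\<close>. \<open>r\<close> runs over a line and admits no denominators: bounds are
  relative to \<open>(1 + r^2)^e\<close> with \<open>2 e\<close> the degree in \<open>r\<close>,
  interpolation and damping use multipliers in \<open>t\<close> alone, and what remains in
  \<open>r\<close> is settled by the univariate theorem. Averaging perturbs all values slightly, so
  it needs a uniform positive lower bound and cannot tolerate a real zero. The Bezout identity
  confines the zeros to finitely many lines \<open>t = z\<close>. There the squares must match
  \<open>f\<close> to an order in \<open>t - z\<close> beyond that of its lower bound; values on the
  line alone do not give this, a factorisation over \<open>C[[t]]\<close> does.\<close>

section \<open>Ring homomorphisms and their coefficientwise extension to polynomials\<close>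

locale rhom =
  fixes h :: "'a::comm_ring_1 \<Rightarrow> 'b::comm_ring_1"
  assumes one: "h 1 = 1" and add: "h (x + y) = h x + h y" and mult: "h (x * y) = h x * h y"
begin

lemma zero: "h 0 = 0"
  using add[of 0 0] by simp

lemma minus: "h (- x) = - h x"
proof -
  have "h x + h (- x) = 0" using add[of x "- x"] zero by simp
  then show ?thesis by (metis add_eq_0_iff)
qed

lemma diff: "h (x - y) = h x - h y"
  using add[of x "- y"] minus[of y] by simp

lemma power: "h (x ^ n) = h x ^ n"
  by (induction n) (simp_all add: one mult)

lemma sum: "h (sum f A) = (\<Sum>x\<in>A. h (f x))"
  by (induction A rule: infinite_finite_induct) (simp_all add: zero add)

lemma coeff_map: "coeff (map_poly h p) n = h (coeff p n)"
  by (simp add: coeff_map_poly zero)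

lemma map_add: "map_poly h (p + q) = map_poly h p + map_poly h q"
  by (rule poly_eqI) (simp add: coeff_map add)

lemma map_diff: "map_poly h (p - q) = map_poly h p - map_poly h q"
  by (rule poly_eqI) (simp add: coeff_map diff)

lemma map_mult: "map_poly h (p * q) = map_poly h p * map_poly h q"
  by (rule poly_eqI) (simp add: coeff_map coeff_mult sum mult)

lemma map_one: "map_poly h 1 = 1"
  by (simp add: one)

lemma map_smult: "map_poly h (smult a p) = smult (h a) (map_poly h p)"
  by (rule poly_eqI) (simp add: coeff_map mult)

lemma map_power: "map_poly h (p ^ n) = map_poly h p ^ n"
  by (induction n) (simp_all add: one map_mult)

lemma map_prod: "map_poly h (prod f A) = (\<Prod>x\<in>A. map_poly h (f x))"
  by (induction A rule: infinite_finite_induct) (simp_all add: one map_mult)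

lemma map_pC: "map_poly h (pCons a p) = pCons (h a) (map_poly h p)"
  by (simp add: map_poly_pCons zero)

lemma poly_map: "poly (map_poly h p) (h x) = h (poly p x)"
  by (induction p) (simp_all add: map_pC zero add mult)

text \<open>A homomorphism lowers the degree only by killing the leading coefficient, and 1 is sent
  to 1.\<close>

lemma monic_map:
  assumes "lead_coeff p = 1" "(1::'b) \<noteq> 0"
  shows "degree (map_poly h p) = degree p" "lead_coeff (map_poly h p) = 1"
proof -
  have "coeff (map_poly h p) (degree p) = 1" using assms by (simp add: coeff_map one)
  then show "degree (map_poly h p) = degree p" using assms(2)
    by (metis map_poly_degree_leq le_antisym le_degree)
  then show "lead_coeff (map_poly h p) = 1" using assms by (simp add: coeff_map one)
qed

lemma map_poly_rhom: "rhom (map_poly h)"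
  by unfold_locales (simp_all add: map_one map_add map_mult)

end

lemma rhom_compose: "rhom f \<Longrightarrow> rhom g \<Longrightarrow> rhom (\<lambda>x. f (g x))"
  by (simp add: rhom_def)

section \<open>Factoring polynomials over formal power series\<close>

text \<open>The linear equation met at each order of Hensel lifting. Multiply a Bezout identity by
  \<open>c\<close> and reduce the cofactor of \<open>g\<close> modulo \<open>f\<close>; the bound on
  \<open>degree v\<close> is then forced by comparing degrees in
  \<open>f * v = c - u * g\<close>.\<close>

lemma coprime_poly_split:
  fixes f g c :: "complex poly"
  assumes cop: "coprime f g" and df: "0 < degree f" and dg: "0 < degree g"
    and dc: "degree c < degree f + degree g"
  shows "\<exists>u v. u * g + f * v = c \<and> degree u < degree f \<and> degree v < degree g"
proof -
  obtain a b where ab: "a * f + b * g = 1"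
    using bezout_coefficients_fst_snd[of f g] cop by (metis coprime_imp_gcd_eq_1)
  define u where "u = (c * b) mod f"
  have f0: "f \<noteq> 0" using df by auto
  have du: "degree u < degree f" unfolding u_def using degree_mod_less'[of f "c * b"] f0 df
    by (metis degree_0 )
  have "f dvd c * b - u" unfolding u_def by simp
  moreover have "c - u * g = (c * b - u) * g + c * a * f"
    using arg_cong[OF ab, of "\<lambda>x. c * x"] by (simp add: algebra_simps)
  ultimately have "f dvd c - u * g" by simp
  then obtain v where v: "c - u * g = f * v" by (elim dvdE)
  have "degree (c - u * g) < degree f + degree g"
  proof (rule degree_diff_less[OF dc])
    show "degree (u * g) < degree f + degree g"
      using degree_mult_le[of u g] du by linarith
  qed
  then have "degree v < degree g"
  proof (cases "v = 0")
    case False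
    then show ?thesis using \<open>degree (c - u * g) < _\<close> f0 by (simp add: v degree_mult_eq)
  qed (use dg in simp)
  then show ?thesis using v du by (intro exI[of _ u] exI[of _ v]) (simp add: algebra_simps)
qed

text \<open>\<open>P k\<close> stands for the coefficient of \<open>t^k\<close>. Comparing
  coefficients in a product of two series gives an equation that is linear in the pair
  \<open>(F k, G k)\<close>, all other terms being known. The corrections stay below the degrees of
  \<open>f\<close> and \<open>g\<close>, so the lifted factors can be monic.\<close>

lemma hensel_seq:
  fixes f g :: "complex poly" and P :: "nat \<Rightarrow> complex poly"
  assumes cop: "coprime f g" and df: "0 < degree f" and dg: "0 < degree g"
    and P0: "P 0 = f * g" and dP: "\<And>k. 0 < k \<Longrightarrow> degree (P k) < degree f + degree g"
  shows "\<exists>F G. F 0 = f \<and> G 0 = g \<and> (\<forall>k>0. degree (F k) < degree f \<and> degree (G k) < degree g)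
           \<and> (\<forall>k. (\<Sum>i\<le>k. F i * G (k - i)) = P k)"
proof -
  define R where "R = (\<lambda>(H::nat \<Rightarrow> complex poly \<times> complex poly) k r.
     (k = 0 \<longrightarrow> r = (f, g)) \<and> (0 < k \<longrightarrow> degree (fst r) < degree f \<and> degree (snd r) < degree g \<and>
       fst r * g + f * snd r + (\<Sum>i\<in>{1..<k}. fst (H i) * snd (H (k - i))) = P k))"
  \<comment> \<open>Each pair depends on all earlier ones, hence choice along the order
    \<open><\<close>.\<close>
  have "\<exists>H. \<forall>k. R H k (H k)"
  proof (rule dependent_wf_choice[of less_than])
    show "wf less_than" by simp
  next
    fix H H' :: "nat \<Rightarrow> complex poly \<times> complex poly" and k r
    assume "\<And>z. (z, k) \<in> less_than \<Longrightarrow> H z = H' z"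
    then have "(\<Sum>i\<in>{1..<k}. fst (H i) * snd (H (k - i))) = (\<Sum>i\<in>{1..<k}. fst (H' i) * snd (H' (k - i)))"
      by (intro sum.cong) auto
    then show "R H k r = R H' k r" by (simp add: R_def)
  next
    fix k and H :: "nat \<Rightarrow> complex poly \<times> complex poly"
    assume IH: "\<And>y. (y, k) \<in> less_than \<Longrightarrow> R H y (H y)"
    show "\<exists>r. R H k r"
    proof (cases "k = 0")
      case True
      then show ?thesis by (auto simp: R_def)
    next
      case False
      define c where "c = P k - (\<Sum>i\<in>{1..<k}. fst (H i) * snd (H (k - i)))"
      have "degree (\<Sum>i\<in>{1..<k}. fst (H i) * snd (H (k - i))) < degree f + degree g"
      proof (rule degree_sum_less)
        fix i assume i: "i \<in> {1..<k}"
        then have "degree (fst (H i)) < degree f" "degree (snd (H (k - i))) < degree g"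
          using IH[of i] IH[of "k - i"] by (auto simp: R_def)
        then show "degree (fst (H i) * snd (H (k - i))) < degree f + degree g"
          using degree_mult_le[of "fst (H i)" "snd (H (k - i))"] by linarith
      qed (use df in simp)
      then have "degree c < degree f + degree g"
        unfolding c_def using dP[of k] False by (intro degree_diff_less) auto
      from coprime_poly_split[OF cop df dg this] obtain u v where
        "u * g + f * v = c" "degree u < degree f" "degree v < degree g" by blast
      then show ?thesis using False by (intro exI[of _ "(u, v)"]) (simp add: R_def c_def)
    qed
  qed
  then obtain H where H: "\<And>k. R H k (H k)" by blast
  define F where "F = fst \<circ> H"
  define G where "G = snd \<circ> H"
  have H0: "H 0 = (f, g)" using H[of 0] by (simp add: R_def)
  have "(\<Sum>i\<le>k. F i * G (k - i)) = P k" for k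
  proof (cases "k = 0")
    case True
    then show ?thesis by (simp add: F_def G_def H0 P0)
  next
    case False
    then have s: "{..k} = insert 0 (insert k {1..<k})" by auto
    show ?thesis unfolding s using False H[of k] 
      by (simp add: R_def F_def G_def H0 algebra_simps)
  qed
  moreover have "degree (F k) < degree f \<and> degree (G k) < degree g" if "0 < k" for k
    using H[of k] that by (simp add: R_def F_def G_def)
  ultimately show ?thesis by (intro exI[of _ F] exI[of _ G]) (simp add: F_def G_def H0)
qed

text \<open>Passes from a series with polynomial coefficients to a polynomial with series
  coefficients; the uniform degree bound makes this possible.\<close>

lemma fps_poly_of_seq:
  fixes F :: "nat \<Rightarrow> complex poly"
  assumes "lead_coeff (F 0) = 1" "\<And>k. 0 < k \<Longrightarrow> degree (F k) < degree (F 0)"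
  shows "\<exists>f::complex fps poly. lead_coeff f = 1 \<and> degree f = degree (F 0) \<and>
           (\<forall>j k. coeff f j $ k = coeff (F k) j)"
proof -
  define f where "f = Abs_poly (\<lambda>j. Abs_fps (\<lambda>k. coeff (F k) j))"
  have dF: "degree (F k) \<le> degree (F 0)" for k
    using assms(2)[of k] by (cases "k = 0") auto
  have c: "coeff f j = Abs_fps (\<lambda>k. coeff (F k) j)" for j
    unfolding f_def
  proof (rule fun_cong[OF coeff_Abs_poly[where n = "degree (F 0)"]])
    fix i assume i: "degree (F 0) < i"
    have "coeff (F k) i = 0" for k using dF[of k] i by (intro coeff_eq_0) linarith
    then show "Abs_fps (\<lambda>k. coeff (F k) i) = 0" by (intro fps_ext) simp
  qed
  have top: "coeff f (degree (F 0)) = 1"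
  proof (rule fps_ext)
    fix k show "coeff f (degree (F 0)) $ k = 1 $ k"
      using assms by (cases "k = 0") (simp_all add: c coeff_eq_0)
  qed
  have "degree f \<le> degree (F 0)"
  proof (rule degree_le, intro allI impI)
    fix i assume i: "degree (F 0) < i"
    have "coeff (F k) i = 0" for k using dF[of k] i by (intro coeff_eq_0) linarith
    then show "coeff f i = 0" by (simp add: c fps_eq_iff)
  qed
  moreover have "degree (F 0) \<le> degree f" by (rule le_degree) (simp add: top)
  ultimately have "degree f = degree (F 0)" by simp
  then show ?thesis using top c by (intro exI[of _ f]) simp
qed

lemma hensel:
  fixes P :: "complex fps poly" and f g :: "complex poly"
  assumes P: "lead_coeff P = 1" "map_poly (\<lambda>a. a $ 0) P = f * g" and cop: "coprime f g"
    and f: "lead_coeff f = 1" "0 < degree f" and g: "lead_coeff g = 1" "0 < degree g"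
  shows "\<exists>A B. P = A * B \<and> lead_coeff A = 1 \<and> lead_coeff B = 1 \<and> degree A = degree f \<and> degree B = degree g"
proof -
  define p where "p = (\<lambda>k. map_poly (\<lambda>a. a $ k) P)"
  have cp: "coeff (p k) j = coeff P j $ k" for k j by (simp add: p_def coeff_map_poly)
  have fg: "lead_coeff (f * g) = 1" "degree (f * g) = degree f + degree g"
    using f g by (simp add: lead_coeff_mult, intro degree_mult_eq) auto
  have p0: "p 0 = f * g" using P by (simp add: p_def)
  have dP: "degree P = degree f + degree g"
  proof (rule antisym)
    have "coeff (p 0) (degree P) \<noteq> 0" using P(1) by (simp add: cp)
    then show "degree P \<le> degree f + degree g" using p0 fg(2) le_degree by metis
    have "coeff P (degree f + degree g) \<noteq> 0"
      using fg cp[of 0 "degree f + degree g"] by (auto simp: p0)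
    then show "degree f + degree g \<le> degree P" by (rule le_degree)
  qed
  \<comment> \<open>Since \<open>P\<close> is monic, its top coefficient lives entirely in order
    0.\<close>
  have dp: "degree (p k) < degree f + degree g" if "0 < k" for k
  proof -
    have "degree (p k) \<le> degree P" unfolding p_def by (rule map_poly_degree_leq)
    moreover have "degree (p k) \<noteq> degree P"
    proof
      assume d: "degree (p k) = degree P"
      then have "lead_coeff (p k) = 0" using P(1) that by (simp add: cp d)
      then have "p k = 0" by (simp only: leading_coeff_0_iff)
      then show False using d dP f(2) by simp
    qed
    ultimately show ?thesis using dP by linarith
  qed
  obtain F G where FG: "F 0 = f" "G 0 = g"
    "\<And>k. 0 < k \<Longrightarrow> degree (F k) < degree f" "\<And>k. 0 < k \<Longrightarrow> degree (G k) < degree g"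
    "\<And>k. (\<Sum>i\<le>k. F i * G (k - i)) = p k"
    using hensel_seq[of f g p, OF cop f(2) g(2) p0 dp] by blast
  obtain A where A: "lead_coeff A = 1" "degree A = degree f" "\<And>j k. coeff A j $ k = coeff (F k) j"
    using fps_poly_of_seq[of F] FG f by auto
  obtain B where B: "lead_coeff B = 1" "degree B = degree g" "\<And>j k. coeff B j $ k = coeff (G k) j"
    using fps_poly_of_seq[of G] FG g by auto
  have "P = A * B"
  proof (rule poly_eqI, rule fps_ext)
    fix j k
    have "coeff P j $ k = coeff (\<Sum>i\<le>k. F i * G (k - i)) j" by (simp add: FG cp)
    also have "\<dots> = (\<Sum>i\<le>k. \<Sum>l\<le>j. coeff (F i) l * coeff (G (k - i)) (j - l))"
      by (simp add: coeff_sum coeff_mult)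
    also have "\<dots> = (\<Sum>l\<le>j. \<Sum>i\<le>k. coeff (F i) l * coeff (G (k - i)) (j - l))"
      by (rule sum.swap)
    also have "\<dots> = coeff (A * B) j $ k"
      by (simp add: coeff_mult fps_sum_nth fps_mult_nth A B atMost_atLeast0)
    finally show "coeff P j $ k = coeff (A * B) j $ k" .
  qed
  then show ?thesis using A B by blast
qed

text \<open>The substitution \<open>t \<mapsto> c s\<^sup>m\<close>, only meaningful for \<open>m > 0\<close>.\<close>
definition monsub :: "complex \<Rightarrow> nat \<Rightarrow> complex fps \<Rightarrow> complex fps" where
  "monsub c m a = a oo (fps_const c * fps_X ^ m)"

lemma monsub_nth:
  assumes "0 < m"
  shows "monsub c m a $ n = (if m dvd n then c ^ (n div m) * a $ (n div m) else 0)"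
proof -
  have p: "((fps_const c * fps_X ^ m) ^ i) $ n = (if n = m * i then c ^ i else 0)" for i
    by (simp add: power_mult_distrib fps_const_power flip: power_mult)
  have "monsub c m a $ n = (\<Sum>i=0..n. if n = m * i then c ^ i * a $ i else 0)"
    unfolding monsub_def fps_compose_nth p by (intro sum.cong) auto
  also have "\<dots> = (if m dvd n then c ^ (n div m) * a $ (n div m) else 0)"
  proof (cases "m dvd n")
    case True
    then obtain k where k: "n = m * k" by auto
    then have "k \<le> n" using assms by simp
    have "(\<Sum>i=0..n. if n = m * i then c ^ i * a $ i else 0) = (\<Sum>i=0..n. if i = k then c ^ i * a $ i else 0)"
      using k assms by (intro sum.cong) auto
    then show ?thesis using \<open>k \<le> n\<close> k assms by simp
  qed (auto intro!: sum.neutral)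
  finally show ?thesis .
qed

lemma monsub_rhom: "0 < m \<Longrightarrow> rhom (monsub c m)"
  by unfold_locales (simp_all add: monsub_def fps_compose_add_distrib fps_compose_mult_distrib)

lemma monsub_monsub:
  assumes "0 < m" "0 < m'"
  shows "monsub c' m' (monsub c m a) = monsub (c * c' ^ m) (m * m') a"
proof (rule fps_ext)
  fix n
  show "monsub c' m' (monsub c m a) $ n = monsub (c * c' ^ m) (m * m') a $ n"
  proof (cases "m * m' dvd n")
    case True
    then obtain k where k: "n = m' * (m * k)" by (metis dvdE mult.assoc mult.commute)
    then show ?thesis using assms
      by (simp add: monsub_nth power_mult_distrib mult_ac flip: power_mult)
  next
    case False
    then have "\<not> (m' dvd n \<and> m dvd n div m')"
      using assms by (metis dvd_div_iff_mult not_gr_zero)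
    then show ?thesis using assms False by (auto simp: monsub_nth)
  qed
qed

lemma monsub_eq_0:
  assumes "0 < m" "c \<noteq> 0" "monsub c m a = 0"
  shows "a = 0"
proof (rule fps_ext)
  fix n
  have "monsub c m a $ (m * n) = 0" using assms by simp
  then show "a $ n = 0 $ n" using assms(1,2) by (simp add: monsub_nth)
qed

definition fcnj :: "complex fps \<Rightarrow> complex fps" where
  "fcnj a = Abs_fps (\<lambda>n. cnj (a $ n))"

lemma fcnj_nth [simp]: "fcnj a $ n = cnj (a $ n)"
  by (simp add: fcnj_def)

lemma fcnj_fcnj [simp]: "fcnj (fcnj a) = a"
  by (simp add: fps_eq_iff)

lemma fcnj_rhom: "rhom fcnj"
  by unfold_locales (auto simp: fps_eq_iff fps_mult_nth)

lemma fcnj_monsub: "0 < m \<Longrightarrow> fcnj (monsub c m a) = monsub (cnj c) m (fcnj a)"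
  by (auto simp: fps_eq_iff monsub_nth)

section \<open>The Newton-Puiseux theorem\<close>

lemma pcompose_power: "pcompose (p ^ n) q = pcompose p q ^ n" for p q :: "'a::idom poly"
  by (induction n) (simp_all add: pcompose_1 pcompose_mult)

lemma coeff_pcompose_shift_top:
  fixes p :: "'a::idom poly"
  assumes "degree p \<le> n"
  shows "coeff (pcompose p [:c, 1:]) n = coeff p n"
proof (cases "degree p = n")
  case True
  then show ?thesis using lead_coeff_comp[of "[:c, 1:]" p] by (simp add: degree_pcompose)
next
  case False
  then show ?thesis using assms by (simp add: coeff_eq_0 degree_pcompose)
qed

text \<open>First-order Taylor expansion at the top. A suitable \<open>c\<close> removes the
  subleading coefficient, and applied to a pure power the formula reads off \<open>a\<close> from
  \<open>(X - a)^n\<close>.\<close>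

lemma coeff_pcompose_shift:
  fixes p :: "'a::idom poly"
  assumes "degree p \<le> Suc n"
  shows "coeff (pcompose p [:c, 1:]) n = coeff p n + of_nat (Suc n) * c * coeff p (Suc n)"
  using assms
proof (induction p arbitrary: n)
  case 0
  then show ?case by simp
next
  case (pCons a p)
  have dp: "degree p \<le> n"
    using pCons.prems by (cases "p = 0") auto
  show ?case
  proof (cases n)
    case 0
    then obtain b where "p = [:b:]" using dp by (metis degree_eq_zeroE le_zero_eq)
    then show ?thesis using 0 by (simp add: pcompose_pCons)
  next
    case (Suc k)
    have "coeff (pcompose (pCons a p) [:c, 1:]) n
        = c * coeff (pcompose p [:c, 1:]) n + coeff (pcompose p [:c, 1:]) k"
      using Suc by (simp add: pcompose_pCons)
    then show ?thesis using Suc pCons.IH[of k] coeff_pcompose_shift_top[OF dp] dp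
      by (simp add: algebra_simps)
  qed
qed

text \<open>A monic polynomial with a single root \<open>a\<close> is \<open>(X - a)^n\<close>. Its
  subleading coefficient \<open>- n a\<close> vanishes only for \<open>a = 0\<close>, and
  \<open>X^n\<close> has no further nonzero coefficient.\<close>

lemma poly_two_roots:
  fixes p :: "complex poly"
  assumes "lead_coeff p = 1" "degree p = n" "1 < n" "coeff p (n - 1) = 0" "j < n" "coeff p j \<noteq> 0"
  shows "\<exists>a b. a \<noteq> b \<and> poly p a = 0 \<and> poly p b = 0"
proof -
  have "\<not> constant (poly p)" using assms by (simp add: constant_degree)
  then obtain a where a: "poly p a = 0" using fundamental_theorem_of_algebra by blast
  have p0: "p \<noteq> 0" using assms by auto
  obtain k g where g: "p = [:- a, 1:] ^ k * g" "\<not> [:- a, 1:] dvd g"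
    using order_decomp[OF p0] by blast
  have ga: "poly g a \<noteq> 0" using g(2) by (simp add: poly_eq_0_iff_dvd)
  show ?thesis
  proof (cases "degree g = 0")
    case False
    then have "\<not> constant (poly g)" by (simp add: constant_degree)
    then obtain b where "poly g b = 0" using fundamental_theorem_of_algebra by blast
    then show ?thesis using a ga g(1) by (intro exI[of _ a] exI[of _ b]) auto
  next
    case True
    then obtain c where c: "g = [:c:]" by (metis degree_eq_zeroE)
    have "lead_coeff p = c" using g(1) by (simp add: c lead_coeff_power)
    then have c1: "c = 1" using assms by simp
    have pk: "p = [:- a, 1:] ^ k" using g(1) c c1 by simp
    then have "degree p = k" by (simp add: degree_linear_power)
    then have kn: "k = n" using assms by simp
    have pp: "p = pcompose (monom 1 n) [:- a, 1:]"
      unfolding pk kn by (simp add: monom_altdef pcompose_pCons pcompose_power)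
    have "coeff p (n - 1) = - of_nat n * a"
      using coeff_pcompose_shift[of "monom 1 n" "n - 1" "- a"] assms(3)
      by (simp add: pp[symmetric] degree_monom_eq)
    then have "a = 0" using assms(3,4) by simp
    then have "coeff p j = 0" using assms(5) pp by simp
    with assms show ?thesis by simp
  qed
qed

text \<open>The full power of \<open>X - a\<close> in the reduction at \<open>t = 0\<close> is
  coprime to its cofactor, which still vanishes at \<open>b\<close>; Hensel lifting then gives a
  proper factor.\<close>

lemma hensel_two_roots:
  fixes P :: "complex fps poly"
  assumes P: "lead_coeff P = 1" and ab: "a \<noteq> b"
    "poly (map_poly (\<lambda>a. a $ 0) P) a = 0" "poly (map_poly (\<lambda>a. a $ 0) P) b = 0"
  shows "\<exists>A B. P = A * B \<and> lead_coeff A = 1 \<and> 0 < degree A \<and> degree A < degree P"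
proof -
  define p where "p = map_poly (\<lambda>a. a $ 0) P"
  have cp: "coeff p j = coeff P j $ 0" for j by (simp add: p_def coeff_map_poly)
  have dp: "degree p = degree P"
    using P cp[of "degree P"] by (metis map_poly_degree_leq p_def fps_one_nth le_antisym le_degree zero_neq_one)
  have lp: "lead_coeff p = 1" using P dp cp by simp
  then have p0: "p \<noteq> 0" by auto
  define k where "k = order a p"
  obtain g where g: "p = [:- a, 1:] ^ k * g" "\<not> [:- a, 1:] dvd g"
    using order_decomp[OF p0] unfolding k_def by blast
  define f where "f = [:- a, 1:] ^ k"
  have ord: "0 < k" using ab p0 by (simp add: order_gt_0_iff k_def flip: p_def)
  have f: "lead_coeff f = 1" "0 < degree f"
    using ord by (simp_all add: f_def coeff_linear_power degree_linear_power)
  have fg: "p = f * g" using g f_def by simp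
  have lg: "lead_coeff g = 1" using lp f(1) by (simp add: fg lead_coeff_mult)
  have "poly f b \<noteq> 0" using ab by (simp add: f_def)
  then have "poly g b = 0" using ab(3) by (simp add: fg flip: p_def)
  then have dg: "0 < degree g" using lg
    by (metis degree_eq_zeroE gr0I lead_coeff_pCons(2) mult_zero_right one_neq_zero poly_0 poly_pCons add.right_neutral pCons_0_0 lead_coeff_pCons(1))
  have "coprime [:- a, 1:] g"
    using g(2) by (intro prime_elem_imp_coprime) (auto intro!: irreducible_imp_prime_elem irreducible_linear_poly)
  then have "coprime f g" by (simp add: f_def coprime_power_left_iff)
  from hensel[OF P _ this f lg dg] fg obtain A B where
    "P = A * B" "lead_coeff A = 1" "degree A = degree f" by (auto simp: p_def)
  moreover have "degree P = degree f + degree g"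
    using fg dp f lg by (metis degree_mult_eq leading_coeff_0_iff zero_neq_one)
  ultimately show ?thesis using f dg by (intro exI[of _ A] exI[of _ B]) simp
qed


text \<open>One step on the Newton polygon. With \<open>d / q\<close> the least slope, the
  substitution \<open>t = s^q\<close>, \<open>r = s^d r'\<close> turns \<open>P\<close> into
  \<open>s^(d n)\<close> times a monic \<open>R\<close> over the power series, and on the chosen
  edge a coefficient of \<open>R\<close> has nonzero constant term.\<close>

lemma newton_slope:
  fixes P :: "complex fps poly"
  assumes P: "lead_coeff P = 1" "degree P = n" "1 < n" "coeff P (n - 1) = 0"
    and ne: "\<exists>j<n. coeff P j \<noteq> 0"
  shows "\<exists>q>0. \<exists>d R. lead_coeff R = 1 \<and> degree R = n \<and>
           (\<forall>j\<le>n. monsub 1 q (coeff P j) = fps_X ^ (d * (n - j)) * coeff R j) \<and>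
           coeff R (n - 1) = 0 \<and> (\<exists>j<n. coeff R j $ 0 \<noteq> 0)"
proof -
  define S where "S = {j. j < n \<and> coeff P j \<noteq> 0}"
  \<comment> \<open>Slope of the segment that joins the vertex of the leading coefficient to the
    point of the \<open>j\<close>-th one.\<close>
  define w where "w = (\<lambda>j. real (subdegree (coeff P j)) / real (n - j))"
  have S: "finite S" "S \<noteq> {}" using ne by (auto simp: S_def)
  then have "Min (w ` S) \<in> w ` S" by (intro Min_in) auto
  then obtain j0 where j0: "j0 \<in> S" "w j0 = Min (w ` S)" by auto
  have le: "w j0 \<le> w j" if "j \<in> S" for j using that S by (auto simp: j0(2) intro!: Min_le)
  \<comment> \<open>With \<open>d\<close> below, \<open>d / q\<close> is the minimal slope
    \<open>w j0\<close>; ramifying by \<open>q\<close> makes the exponents integral.\<close>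
  define q where "q = n - j0"
  define d where "d = subdegree (coeff P j0)"
  have q: "0 < q" using j0 by (auto simp: q_def S_def)
  have dle: "d * (n - j) \<le> subdegree (coeff P j) * q" if "j \<in> S" for j
  proof -
    have "real d / real q \<le> real (subdegree (coeff P j)) / real (n - j)"
      using le[OF that] by (simp add: w_def d_def q_def)
    moreover have "0 < n - j" using that by (auto simp: S_def)
    ultimately have "real d * real (n - j) \<le> real (subdegree (coeff P j)) * real q"
      using q by (simp add: field_simps)
    then show ?thesis by (metis of_nat_le_iff of_nat_mult)
  qed
  define b where "b = (\<lambda>j. fps_shift (d * (n - j)) (monsub 1 q (coeff P j)))"
  have b: "monsub 1 q (coeff P j) = fps_X ^ (d * (n - j)) * b j" if "j \<le> n" for j
  proof (cases "j \<in> S")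
    case True
    have "monsub 1 q (coeff P j) $ i = 0" if i: "i < d * (n - j)" for i
    proof (cases "q dvd i")
      case True
      then obtain l where l: "i = q * l" by auto
      then have "q * l < q * subdegree (coeff P j)" using less_le_trans[OF i dle[OF \<open>j \<in> S\<close>]]
        by (simp only: mult.commute[of _ q] l)
      then have "l < subdegree (coeff P j)" by simp
      then have "coeff P j $ l = 0" by (rule nth_less_subdegree_zero)
      then show ?thesis using q l by (simp add: monsub_nth)
    qed (simp add: monsub_nth q)
    then show ?thesis by (auto simp: fps_eq_iff b_def fps_X_power_mult_nth)
  next
    case False
    then show ?thesis using that P rhom.one[OF monsub_rhom[OF q]] rhom.zero[OF monsub_rhom[OF q]]
      by (cases "j = n") (simp_all add: b_def S_def)
  qed
  define R where "R = (\<Sum>j\<le>n. monom (b j) j)"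
  have cR: "coeff R j = (if j \<le> n then b j else 0)" for j
    by (simp add: R_def coeff_sum)
  have bn: "b n = 1" using P rhom.one[OF monsub_rhom[OF q]] by (simp add: b_def)
  have dR: "degree R = n"
    by (intro antisym degree_le le_degree) (auto simp: cR bn)
  moreover have "lead_coeff R = 1" by (simp add: dR cR bn)
  moreover have "coeff R (n - 1) = 0"
    using P rhom.zero[OF monsub_rhom[OF q]] by (simp add: cR b_def)
  \<comment> \<open>At \<open>j0\<close> the shift \<open>d * (n - j0) = q * d\<close> is exactly
    the order of the substituted coefficient, so its lowest term becomes the constant term.\<close>
  moreover have "coeff R j0 $ 0 \<noteq> 0" "j0 < n"
    using j0(1) q by (auto simp: cR b_def S_def monsub_nth d_def simp flip: q_def)
  moreover have "\<forall>j\<le>n. monsub 1 q (coeff P j) = fps_X ^ (d * (n - j)) * coeff R j"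
    by (simp add: b cR)
  ultimately show ?thesis using q by blast
qed

text \<open>Induction on the degree. Shifting removes the subleading coefficient, and rescaling by
  the Newton slope gives a reduction with two distinct roots, so Hensel lifting splits off a factor
  of smaller degree. A root of that factor, in a further ramified variable, is pulled back through
  both substitutions.\<close>

lemma puiseux_root:
  fixes P :: "complex fps poly"
  assumes "lead_coeff P = 1" "0 < degree P"
  shows "\<exists>m>0. \<exists>\<rho>. poly (map_poly (monsub 1 m) P) \<rho> = 0"
  using assms
proof (induction "degree P" arbitrary: P rule: less_induct)
  case less
  define n where "n = degree P"
  define c where "c = - (fps_const (1 / of_nat n) * coeff P (n - 1))"
  define P1 where "P1 = pcompose P [:c, 1:]"
  have n: "0 < n" using less by (simp add: n_def)
  have split: "\<exists>m>0. \<exists>\<rho>. poly (map_poly (monsub 1 m) R) \<rho> = 0"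
    if R: "lead_coeff R = 1" "degree R = n" "1 < n" "coeff R (n - 1) = 0" "\<exists>j<n. coeff R j $ 0 \<noteq> 0"
    for R :: "complex fps poly"
  proof -
    define p where "p = map_poly (\<lambda>a. a $ 0) R"
    have cp: "coeff p j = coeff R j $ 0" for j by (simp add: p_def coeff_map_poly)
    have dp: "degree p = n"
    proof (rule antisym)
      show "degree p \<le> n" unfolding p_def R(2)[symmetric] by (rule map_poly_degree_leq)
      show "n \<le> degree p" by (rule le_degree) (use R in \<open>simp add: cp\<close>)
    qed
    obtain j where j: "j < n" "coeff R j $ 0 \<noteq> 0" using R(5) by auto
    have "\<exists>a b. a \<noteq> b \<and> poly p a = 0 \<and> poly p b = 0"
      by (rule poly_two_roots[of p n j]) (use R j dp in \<open>simp_all add: cp\<close>)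
    then obtain a b where "a \<noteq> b" "poly p a = 0" "poly p b = 0" by blast
    from hensel_two_roots[OF R(1) this[unfolded p_def]] obtain A B
      where AB: "R = A * B" "lead_coeff A = 1" "0 < degree A" "degree A < degree R" by blast
    obtain m \<rho> where m: "0 < m" "poly (map_poly (monsub 1 m) A) \<rho> = 0"
      using less.hyps[of A] AB R n_def by auto
    then have "poly (map_poly (monsub 1 m) R) \<rho> = 0"
      using rhom.map_mult[OF monsub_rhom[OF m(1)]] by (simp add: AB)
    with m(1) show ?thesis by blast
  qed
  have dP1: "degree P1 = n" by (simp add: P1_def degree_pcompose n_def)
  have lP1: "lead_coeff P1 = 1"
    using coeff_pcompose_shift_top[of P n c] less.prems by (simp add: dP1) (simp add: P1_def n_def)
  have cP1: "coeff P1 (n - 1) = 0"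
  proof -
    have "coeff P1 (n - 1) = coeff P (n - 1) + of_nat n * c"
      using coeff_pcompose_shift[of P "n - 1" c] n less.prems by (simp add: P1_def n_def)
    also have "of_nat n * c = - coeff P (n - 1)"
      using n by (simp add: c_def fps_of_nat[symmetric] flip: mult.assoc)
    finally show ?thesis by simp
  qed
  have "\<exists>m>0. \<exists>\<rho>. poly (map_poly (monsub 1 m) P1) \<rho> = 0"
  proof (cases "\<exists>j<n. coeff P1 j \<noteq> 0")
    case False
    then have "poly P1 0 = 0" using n by (simp add: poly_0_coeff_0)
    then have "poly (map_poly (monsub 1 1) P1) 0 = 0"
      using rhom.poly_map[OF monsub_rhom[of 1 1], of P1 0] by (simp add: monsub_def)
    then show ?thesis by (intro exI[of _ 1] conjI exI[of _ 0]) simp_all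
  next
    case True
    then have n1: "1 < n" using cP1 by (metis One_nat_def diff_Suc_1 less_antisym less_one linorder_neqE_nat n not_less_zero less_Suc0)
    obtain q d R where R: "0 < q" "lead_coeff R = 1" "degree R = n"
        "\<And>j. j \<le> n \<Longrightarrow> monsub 1 q (coeff P1 j) = fps_X ^ (d * (n - j)) * coeff R j"
        "coeff R (n - 1) = 0" "\<exists>j<n. coeff R j $ 0 \<noteq> 0"
      using newton_slope[OF lP1 dP1 n1 cP1 True] by blast
    obtain m \<sigma> where m: "0 < m" "poly (map_poly (monsub 1 m) R) \<sigma> = 0"
      using split[OF R(2,3) n1 R(5,6)] by blast
    interpret M: rhom "monsub 1 m" by (rule monsub_rhom[OF m(1)])
    interpret QM: rhom "monsub 1 (q * m)" using m R by (intro monsub_rhom) simp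
    have X: "monsub 1 m fps_X = fps_X ^ m"
      using m by (simp add: monsub_def)
    \<comment> \<open>Undoes \<open>r = s^d r'\<close> after the further ramification by
      \<open>m\<close>; each term of \<open>P1\<close> at \<open>\<rho>\<close> then carries the
      same factor \<open>X^(m d n)\<close>.\<close>
    define \<rho> where "\<rho> = fps_X ^ (m * d) * \<sigma>"
    have t: "monsub 1 (q * m) (coeff P1 j) * \<rho> ^ j = fps_X ^ (m * d * n) * (monsub 1 m (coeff R j) * \<sigma> ^ j)"
      if "j \<le> n" for j
    proof -
      have "monsub 1 (q * m) (coeff P1 j) = monsub 1 m (monsub 1 q (coeff P1 j))"
        using m R by (simp add: monsub_monsub)
      also have "\<dots> = fps_X ^ (m * d * (n - j)) * monsub 1 m (coeff R j)"
        using R(4)[OF that] by (simp add: M.mult M.power X mult.assoc flip: power_mult)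
      finally have "monsub 1 (q * m) (coeff P1 j) * \<rho> ^ j
          = (fps_X ^ (m * d * (n - j)) * fps_X ^ (m * d * j)) * (monsub 1 m (coeff R j) * \<sigma> ^ j)"
        by (simp add: \<rho>_def power_mult_distrib mult_ac flip: power_mult)
      also have "fps_X ^ (m * d * (n - j)) * fps_X ^ (m * d * j) = (fps_X :: complex fps) ^ (m * d * n)"
        using that by (simp flip: power_add distrib_left)
      finally show ?thesis .
    qed
    have "poly (map_poly (monsub 1 (q * m)) P1) \<rho> = (\<Sum>j\<le>n. monsub 1 (q * m) (coeff P1 j) * \<rho> ^ j)"
      using QM.monic_map(1)[OF lP1] by (simp add: poly_altdef dP1 QM.coeff_map)
    also have "\<dots> = fps_X ^ (m * d * n) * (\<Sum>j\<le>n. monsub 1 m (coeff R j) * \<sigma> ^ j)"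
      unfolding sum_distrib_left by (intro sum.cong refl t) simp
    also have "(\<Sum>j\<le>n. monsub 1 m (coeff R j) * \<sigma> ^ j) = poly (map_poly (monsub 1 m) R) \<sigma>"
      using M.monic_map(1)[OF R(2)] by (simp add: poly_altdef R(3) M.coeff_map)
    finally have "poly (map_poly (monsub 1 (q * m)) P1) \<rho> = 0" using m by simp
    then show ?thesis using m R by (intro exI[of _ "q * m"] conjI exI[of _ \<rho>]) simp_all
  qed
  then obtain m \<rho> where m: "0 < m" "poly (map_poly (monsub 1 m) P1) \<rho> = 0" by blast
  interpret M: rhom "monsub 1 m" by (rule monsub_rhom[OF m(1)])
  have "map_poly (monsub 1 m) (pcompose P [:c, 1:]) = pcompose (map_poly (monsub 1 m) P) [:monsub 1 m c, 1:]"
    by (induction P) (simp_all add: pcompose_pCons M.map_add M.map_mult M.map_pC M.map_smult M.one M.zero)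
  then have "poly (map_poly (monsub 1 m) P) (monsub 1 m c + \<rho>) = 0"
    using m(2) by (simp add: P1_def poly_pcompose)
  with m(1) show ?case by blast
qed

declare One_nat_def [simp del]

lemma monsub_one [simp]: "monsub 1 1 a = a"
  by (simp add: monsub_def)

section \<open>Conjugates of a Puiseux root and Hermitian factorisation\<close>

lemma prod_linear_dvd:
  fixes p :: "'a::idom poly"
  assumes "finite S" "\<And>a. a \<in> S \<Longrightarrow> poly p a = 0"
  shows "(\<Prod>a\<in>S. [:- a, 1:]) dvd p"
  using assms
proof (induction S arbitrary: p)
  case empty
  then show ?case by simp
next
  case (insert a S)
  obtain q where q: "p = [:- a, 1:] * q"
    using insert.prems[of a] by (auto simp: poly_eq_0_iff_dvd elim: dvdE)
  have "poly q b = 0" if "b \<in> S" for b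
    using insert.prems[of b] insert.hyps that by (auto simp: q)
  from insert.IH[OF this] have "[:- a, 1:] * (\<Prod>a\<in>S. [:- a, 1:]) dvd p"
    unfolding q by (intro mult_dvd_mono) simp_all
  then show ?case using insert.hyps by simp
qed

lemma map_monsub_monsub:
  assumes "0 < m" "0 < m'"
  shows "map_poly (monsub c' m') (map_poly (monsub c m) p) = map_poly (monsub (c * c' ^ m) (m * m')) p"
  using assms by (simp add: poly_eq_iff rhom.coeff_map monsub_rhom monsub_monsub)

lemma map_monsub_inj:
  assumes "0 < m" "c \<noteq> 0" "map_poly (monsub c m) p = map_poly (monsub c m) q"
  shows "p = q"
proof -
  interpret M: rhom "monsub c m" by (rule monsub_rhom[OF assms(1)])
  have "monsub c m (coeff (p - q) n) = 0" for n
    using arg_cong[OF assms(3), of "\<lambda>r. coeff r n"] by (simp add: M.coeff_map M.diff)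
  then have "coeff (p - q) n = 0" for n using monsub_eq_0[OF assms(1,2)] by blast
  then have "p - q = 0" by (intro poly_eqI) simp
  then show ?thesis by simp
qed

text \<open>Division by the monic \<open>M\<close> is possible over \<open>C[[t]]\<close> itself,
  and pseudo-division performs it. The image of the remainder is divisible by the image of
  \<open>M\<close> but has smaller degree, so it vanishes, and the substitution is
  injective.\<close>

lemma monic_dvd_descend:
  assumes m: "0 < m" and M: "lead_coeff M = 1"
    and dvd: "map_poly (monsub 1 m) M dvd map_poly (monsub 1 m) P"
  shows "M dvd P"
proof -
  interpret H: rhom "monsub 1 m" by (rule monsub_rhom[OF m])
  obtain D R where DR: "pseudo_divmod P M = (D, R)" by fastforce
  have "M \<noteq> 0" using M by auto
  from pseudo_divmod[OF this DR] M have P: "P = M * D + R" and R: "R = 0 \<or> degree R < degree M"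
    by auto
  have "map_poly (monsub 1 m) R = map_poly (monsub 1 m) P - map_poly (monsub 1 m) M * map_poly (monsub 1 m) D"
    by (simp add: P H.map_add H.map_mult)
  then have d: "map_poly (monsub 1 m) M dvd map_poly (monsub 1 m) R"
    using dvd by simp
  have "map_poly (monsub 1 m) R = 0"
  proof (cases "R = 0")
    case False
    then have "degree (map_poly (monsub 1 m) R) < degree (map_poly (monsub 1 m) M)"
      using R H.monic_map(1)[OF M] map_poly_degree_leq[of "monsub 1 m" R] by simp
    then show ?thesis using d dvd_imp_degree_le leD by blast
  qed simp
  then have "R = 0" using map_monsub_inj[OF m, of 1 R 0] by simp
  then show ?thesis by (simp add: P)
qed

lemma map_fcnj_monsub:
  assumes "0 < m"
  shows "map_poly fcnj (map_poly (monsub c m) p) = map_poly (monsub (cnj c) m) (map_poly fcnj p)"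
  using assms by (simp add: poly_eq_iff rhom.coeff_map monsub_rhom fcnj_rhom fcnj_monsub)

lemma map_fcnj_fcnj [simp]: "map_poly fcnj (map_poly fcnj p) = p"
  by (simp add: poly_eq_iff rhom.coeff_map fcnj_rhom)

lemma order_map_fcnj: "order (fcnj a) (map_poly fcnj p) = order a p"
proof (cases "p = 0")
  case True
  then show ?thesis by (simp add: order_def)
next
  case False
  interpret C: rhom fcnj by (rule fcnj_rhom)
  have lin: "[:- fcnj b, 1:] ^ n = map_poly fcnj ([:- b, 1:] ^ n)" for b n
    by (simp add: C.map_power C.map_pC C.minus C.one)
  have mono: "[:- fcnj b, 1:] ^ n dvd map_poly fcnj q" if "[:- b, 1:] ^ n dvd q" for b n q
    using that unfolding lin by (auto elim!: dvdE simp: C.map_mult)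
  have iff: "[:- fcnj a, 1:] ^ n dvd map_poly fcnj p \<longleftrightarrow> [:- a, 1:] ^ n dvd p" for n
    using mono[of a n p] mono[of "fcnj a" n "map_poly fcnj p"] by auto
  have "map_poly fcnj p \<noteq> 0" using False by (metis map_fcnj_fcnj map_poly_0)
  then show ?thesis unfolding order_def iff using False by simp
qed

text \<open>A primitive \<open>m\<close>-th root of unity, here \<open>f 1\<close>, already detects
  divisibility.\<close>

lemma roots_unity_pow_dvd:
  assumes m: "0 < m" and n: "\<And>z::complex. z ^ m = 1 \<Longrightarrow> z ^ n = 1"
  shows "m dvd n"
proof -
  define f where "f = (\<lambda>k. cis (2 * pi * real k / real m))"
  have inj: "inj_on f {..<m}"
    using bij_betw_roots_unity[OF m] by (auto simp: bij_betw_def f_def)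
  have f: "f k = f 1 ^ k" for k by (simp add: f_def Complex.DeMoivre mult_ac)
  have fm: "f 1 ^ m = 1" using m by (simp add: f_def Complex.DeMoivre)
  have "f 1 ^ n = f 1 ^ (m * (n div m) + n mod m)" by simp
  also have "\<dots> = f (n mod m)" unfolding power_add power_mult fm f[of "n mod m"] by simp
  finally have "f (n mod m) = f 0" using n[OF fm] by (simp add: f[of 0])
  then have "n mod m = 0" using inj m by (auto simp: inj_on_def)
  then show ?thesis by auto
qed

text \<open>The norm of \<open>X - \<rho>\<close> from \<open>C((s))\<close> down to
  \<open>C((t))\<close> with \<open>t = s^m\<close>. The maps \<open>s -> z s\<close> permute the
  factors, so every coefficient of the product is invariant and contains only powers of
  \<open>s^m\<close>.\<close>

lemma orbit_poly:
  assumes m: "0 < m"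
  shows "\<exists>M. lead_coeff M = 1 \<and> degree M = m \<and>
           map_poly (monsub 1 m) M = (\<Prod>z\<in>{z. z ^ m = 1}. [:- monsub z 1 \<rho>, 1:])"
proof -
  define U where "U = {z::complex. z ^ m = 1}"
  have U: "finite U" "card U = m" using m card_roots_unity_eq[OF m] finite_roots_unity[of m]
    by (auto simp: U_def)
  define N where "N = (\<Prod>z\<in>U. [:- monsub z 1 \<rho>, 1:])"
  have inv: "map_poly (monsub w 1) N = N" if w: "w \<in> U" for w
  proof -
    interpret W: rhom "monsub w 1" by (rule monsub_rhom) simp
    have w0: "w \<noteq> 0" using w m by (auto simp: U_def zero_power)
    have "map_poly (monsub w 1) N = (\<Prod>z\<in>U. [:- monsub (z * w) 1 \<rho>, 1:])"
      by (simp add: N_def W.map_prod W.map_pC W.minus W.one monsub_monsub)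
    also have "\<dots> = (\<Prod>z\<in>U. [:- monsub z 1 \<rho>, 1:])"
      by (rule prod.reindex_bij_witness[of _ "\<lambda>z. z / w" "\<lambda>z. z * w"])
        (use w w0 in \<open>auto simp: U_def power_mult_distrib power_divide\<close>)
    finally show ?thesis by (simp add: N_def)
  qed
  have dvd: "m dvd n" if "coeff N j $ n \<noteq> 0" for j n
  proof (rule roots_unity_pow_dvd[OF m])
    fix z :: complex assume "z ^ m = 1"
    then have "map_poly (monsub z 1) N = N" by (intro inv) (simp add: U_def)
    then have "monsub z 1 (coeff N j) = coeff N j"
      by (metis monsub_rhom rhom.coeff_map zero_less_one)
    then have "monsub z 1 (coeff N j) $ n = coeff N j $ n" by simp
    then show "z ^ n = 1" using that by (simp add: monsub_nth)
  qed
  define M where "M = map_poly (\<lambda>a. Abs_fps (\<lambda>k. a $ (m * k))) N"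
  have cM: "coeff M j = Abs_fps (\<lambda>k. coeff N j $ (m * k))" for j
    unfolding M_def by (rule coeff_map_poly) (simp add: fps_eq_iff)
  have MN: "map_poly (monsub 1 m) M = N"
  proof (rule poly_eqI, rule fps_ext)
    fix j n
    show "coeff (map_poly (monsub 1 m) M) j $ n = coeff N j $ n"
      using m dvd[of j n] by (auto simp: rhom.coeff_map[OF monsub_rhom] monsub_nth cM)
  qed
  have dN: "degree N = m" unfolding N_def by (subst degree_prod_eq_sum_degree) (auto simp: U)
  have lN: "lead_coeff N = 1" by (simp add: N_def lead_coeff_prod)
  have l1: "coeff M m = 1" using lN m by (auto simp: cM dN fps_eq_iff)
  have "degree M \<le> m" using map_poly_degree_leq[of _ N] by (simp add: M_def dN)
  moreover have "m \<le> degree M" by (rule le_degree) (simp add: l1)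
  ultimately have "degree M = m" by simp
  then show ?thesis using MN l1 by (intro exI[of _ M]) (simp add: N_def U_def)
qed

text \<open>Equal conjugates make \<open>\<rho>\<close> invariant under a root of unity
  \<open>u\<close> of order \<open>k > 1\<close>. Then \<open>\<rho>\<close> is a series in
  \<open>s^k\<close> and yields a root with the smaller ramification index
  \<open>m / k\<close>.\<close>

lemma min_root_orbit_inj:
  assumes m: "0 < m" and root: "poly (map_poly (monsub 1 m) P) \<rho> = 0"
    and min: "\<And>m' \<sigma>. 0 < m' \<Longrightarrow> poly (map_poly (monsub 1 m') P) \<sigma> = 0 \<Longrightarrow> m \<le> m'"
  shows "inj_on (\<lambda>z. monsub z 1 \<rho>) {z. z ^ m = 1}"
proof (rule inj_onI, rule ccontr)
  fix z w :: complex
  assume zw: "z \<in> {z. z ^ m = 1}" "w \<in> {z. z ^ m = 1}" "monsub z 1 \<rho> = monsub w 1 \<rho>" "z \<noteq> w"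
  define u where "u = z / w"
  have w0: "w \<noteq> 0" using zw m by (auto simp: zero_power)
  have u: "u ^ m = 1" "u \<noteq> 1" using zw w0 by (auto simp: u_def power_divide)
  define k where "k = (LEAST k. 0 < k \<and> u ^ k = 1)"
  have k: "0 < k \<and> u ^ k = 1" unfolding k_def by (rule LeastI[of _ m]) (use m u in simp)
  have kdvd: "k dvd n" if "u ^ n = 1" for n
  proof -
    have "u ^ (k * (n div k) + n mod k) = 1" using that by simp
    then have "u ^ (n mod k) = 1" unfolding power_add power_mult using k by simp
    moreover have "n mod k < k" using k by simp
    ultimately have "\<not> 0 < n mod k" using not_less_Least[of "n mod k" "\<lambda>k. 0 < k \<and> u ^ k = 1"]
      by (auto simp: k_def)
    then show ?thesis by auto
  qed
  obtain m' where m': "m = m' * k" using kdvd[OF u(1)] by (metis dvdE mult.commute)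
  have m'0: "0 < m'" using m m' by auto
  define \<sigma> where "\<sigma> = Abs_fps (\<lambda>n. \<rho> $ (k * n))"
  have "\<rho> = monsub 1 k \<sigma>"
  proof (rule fps_ext)
    fix n
    have "z ^ n * \<rho> $ n = w ^ n * \<rho> $ n" using zw(3) by (simp add: fps_eq_iff monsub_nth)
    then have "\<rho> $ n \<noteq> 0 \<Longrightarrow> u ^ n = 1" using w0 by (auto simp: u_def power_divide)
    then have "\<rho> $ n \<noteq> 0 \<Longrightarrow> k dvd n" using kdvd by blast
    then show "\<rho> $ n = monsub 1 k \<sigma> $ n" using k by (auto simp: monsub_nth \<sigma>_def)
  qed
  moreover have "map_poly (monsub 1 m) P = map_poly (monsub 1 k) (map_poly (monsub 1 m') P)"
    using k m'0 by (simp add: map_monsub_monsub m')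
  ultimately have "monsub 1 k (poly (map_poly (monsub 1 m') P) \<sigma>) = 0"
    using root rhom.poly_map[OF monsub_rhom[of k 1]] k by metis
  then have "poly (map_poly (monsub 1 m') P) \<sigma> = 0" using monsub_eq_0[of k 1] k by simp
  then have "m \<le> m'" using min m'0 by blast
  then have "k = 1" using m' m'0 k by (metis One_nat_def le_antisym mult_le_cancel1 mult.right_neutral leI less_Suc0 not_le nat_neq_iff less_one)
  then show False using k u by simp
qed


lemma order_prod_linear:
  fixes f :: "'b \<Rightarrow> 'a::idom"
  assumes "finite U" "inj_on f U" "a \<in> U"
  shows "order (f a) (\<Prod>z\<in>U. [:- f z, 1:]) = 1"
proof -
  have s: "(\<Prod>z\<in>U. [:- f z, 1:]) = [:- f a, 1:] * (\<Prod>z\<in>U - {a}. [:- f z, 1:])"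
    using assms by (simp add: prod.remove)
  have nz: "poly (\<Prod>z\<in>U - {a}. [:- f z, 1:]) (f a) \<noteq> 0"
    using assms by (auto simp: poly_prod inj_on_def)
  then have "(\<Prod>z\<in>U - {a}. [:- f z, 1:]) \<noteq> 0" by auto
  then have "[:- f a, 1:] * (\<Prod>z\<in>U - {a}. [:- f z, 1:]) \<noteq> 0"
    by (simp only: mult_eq_0_iff) simp
  then have "order (f a) (\<Prod>z\<in>U. [:- f z, 1:])
      = order (f a) [:- f a, 1:] + order (f a) (\<Prod>z\<in>U - {a}. [:- f z, 1:])"
    unfolding s by (rule order_mult)
  also have "order (f a) (\<Prod>z\<in>U - {a}. [:- f z, 1:]) = 0" using nz by (rule order_0I)
  also have "order (f a) [:- f a, 1:] = 1" using order_power_n_n[of "f a" 1] by simp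
  finally show ?thesis by simp
qed

text \<open>A root \<open>\<rho>\<close> of odd order would be a real half-branch of \<open>P = 0\<close> on one side of \<open>t = 0\<close>,
  across which \<open>P\<close> changes sign.\<close>
definition even_real_branches :: "complex fps poly \<Rightarrow> bool" where
  "even_real_branches P \<longleftrightarrow> (\<forall>m>0. \<forall>\<epsilon>\<in>{1, -1}. \<forall>\<rho>. fcnj \<rho> = \<rho> \<longrightarrow> even (order \<rho> (map_poly (monsub \<epsilon> m) P)))"

text \<open>With \<open>m\<close> minimal the \<open>m\<close> conjugates of a root \<open>\<rho>\<close> are distinct, so their product \<open>M\<close>
  divides \<open>P\<close>. If complex conjugation maps the orbit of \<open>\<rho>\<close> to another one, the two products
  together divide \<open>P\<close>. Otherwise a twist \<open>s \<mapsto> \<eta>s\<close> makes \<open>\<rho>\<close> real, and since its order is even,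
  \<open>M\<close> divides \<open>P\<close> twice.\<close>
lemma hermitian_factor_step:
  assumes P: "lead_coeff P = 1" "0 < degree P" "map_poly fcnj P = P" and E: "even_real_branches P"
  shows "\<exists>M. lead_coeff M = 1 \<and> 0 < degree M \<and> M * map_poly fcnj M dvd P"
proof -
  interpret C: rhom fcnj by (rule fcnj_rhom)
  define A where "A = (\<lambda>m. 0 < m \<and> (\<exists>\<rho>. poly (map_poly (monsub 1 m) P) \<rho> = 0))"
  define m where "m = (LEAST m. A m)"
  have "\<exists>m. A m" using puiseux_root[OF P(1,2)] by (auto simp: A_def)
  then have Am: "A m" unfolding m_def by (rule LeastI_ex)
  have min: "m \<le> m'" if "0 < m'" "poly (map_poly (monsub 1 m') P) \<sigma> = 0" for m' \<sigma>
    unfolding m_def by (rule Least_le) (use that in \<open>auto simp: A_def\<close>)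
  obtain \<rho> where m: "0 < m" and root: "poly (map_poly (monsub 1 m) P) \<rho> = 0" using Am by (auto simp: A_def)
  interpret H: rhom "monsub 1 m" by (rule monsub_rhom[OF m])
  define U where "U = {z::complex. z ^ m = 1}"
  have U: "finite U" "1 \<in> U" using m finite_roots_unity[of m] by (auto simp: U_def)
  define orb where "orb = (\<lambda>z. monsub z 1 \<rho>)"
  have inj: "inj_on orb U" unfolding orb_def U_def by (rule min_root_orbit_inj[OF m root min])
  define N where "N = (\<Prod>z\<in>U. [:- orb z, 1:])"
  obtain M where M: "lead_coeff M = 1" "degree M = m" "map_poly (monsub 1 m) M = N"
    using orbit_poly[OF m, of \<rho>] by (auto simp: N_def U_def orb_def)
  have roots: "poly (map_poly (monsub 1 m) Q) (orb z) = 0"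
    if "poly (map_poly (monsub 1 m) Q) \<rho> = 0" "z \<in> U" for Q z
  proof -
    have "map_poly (monsub z 1) (map_poly (monsub 1 m) Q) = map_poly (monsub 1 m) Q"
      using m that by (simp add: map_monsub_monsub U_def)
    then have "poly (map_poly (monsub 1 m) Q) (orb z) = monsub z 1 (poly (map_poly (monsub 1 m) Q) \<rho>)"
      using rhom.poly_map[OF monsub_rhom[of 1 z], of "map_poly (monsub 1 m) Q" \<rho>] by (simp add: orb_def)
    then show ?thesis using that rhom.zero[OF monsub_rhom[of 1 z]] by simp
  qed
  have N_prod: "N = (\<Prod>a\<in>orb ` U. [:- a, 1:])" unfolding N_def using inj by (simp add: prod.reindex)
  have Mdvd: "M dvd Q" if "poly (map_poly (monsub 1 m) Q) \<rho> = 0" for Q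
  proof (rule monic_dvd_descend[OF m M(1)])
    show "map_poly (monsub 1 m) M dvd map_poly (monsub 1 m) Q"
      unfolding M(3) N_prod using U roots[OF that] by (intro prod_linear_dvd) auto
  qed
  have cU: "cnj z \<in> U" "cnj z * z = 1" if "z \<in> U" for z
  proof -
    show "cnj z \<in> U" using that by (simp add: U_def flip: complex_cnj_power)
    have "norm z = 1" using that m power_eq_1_iff[of z m] by (auto simp: U_def)
    then show "cnj z * z = 1" using complex_norm_square[of z] by (simp add: mult.commute)
  qed
  have co: "fcnj (orb z) = monsub (cnj z) 1 (fcnj \<rho>)" for z by (simp add: orb_def fcnj_monsub)
  have croot: "poly (map_poly (monsub 1 m) P) (fcnj a) = 0" if "poly (map_poly (monsub 1 m) P) a = 0" for a
  proof -
    have "map_poly fcnj (map_poly (monsub 1 m) P) = map_poly (monsub 1 m) P"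
      using m P(3) by (simp add: map_fcnj_monsub)
    then show ?thesis using C.poly_map[of "map_poly (monsub 1 m) P" a] that C.zero by simp
  qed
  show ?thesis
  proof (cases "fcnj \<rho> \<in> orb ` U")
    case False
    \<comment> \<open>Two orbits that meet coincide, so a common element would put
      \<open>fcnj \<rho>\<close> into the orbit of \<open>\<rho>\<close>.\<close>
    have disj: "orb ` U \<inter> fcnj ` orb ` U = {}"
    proof (rule ccontr)
      assume "\<not> ?thesis"
      then obtain z w where zw: "z \<in> U" "w \<in> U" "orb z = fcnj (orb w)" by auto
      have "monsub w 1 (fcnj (orb w)) = fcnj \<rho>" using cU(2)[OF zw(2)] by (simp add: co monsub_monsub)
      moreover have "orb (z * w) = monsub w 1 (orb z)" by (simp add: orb_def monsub_monsub)
      ultimately have "orb (z * w) = fcnj \<rho>" using zw(3) by simp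
      moreover have "z * w \<in> U" using zw by (simp add: U_def power_mult_distrib)
      ultimately show False using False by (metis imageI)
    qed
    have injc: "inj_on fcnj (orb ` U)" by (rule inj_on_inverseI[of _ fcnj]) simp
    have "map_poly fcnj N = (\<Prod>a\<in>orb ` U. [:- fcnj a, 1:])"
      by (simp add: N_prod C.map_prod C.map_pC C.minus C.one)
    also have "\<dots> = (\<Prod>a\<in>fcnj ` orb ` U. [:- a, 1:])" using injc by (simp add: prod.reindex)
    finally have "N * map_poly fcnj N = (\<Prod>a\<in>orb ` U \<union> fcnj ` orb ` U. [:- a, 1:])"
      using disj U by (simp add: prod.union_disjoint N_prod)
    moreover have "(\<Prod>a\<in>orb ` U \<union> fcnj ` orb ` U. [:- a, 1:]) dvd map_poly (monsub 1 m) P"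
      using U roots[OF root] croot by (intro prod_linear_dvd) auto
    ultimately have "map_poly (monsub 1 m) (M * map_poly fcnj M) dvd map_poly (monsub 1 m) P"
      using m by (simp add: H.map_mult M(3) map_fcnj_monsub[symmetric, of m 1, simplified])
    moreover have "lead_coeff (M * map_poly fcnj M) = 1"
      using C.monic_map(2)[OF M(1)] M(1) by (simp add: lead_coeff_mult)
    ultimately have "M * map_poly fcnj M dvd P" using monic_dvd_descend[OF m] by blast
    then show ?thesis using M m by blast
  next
    case True
    then obtain z where z: "z \<in> U" "fcnj \<rho> = orb z" by auto
    \<comment> \<open>Half of the rotation \<open>z\<close>: as \<open>|\<eta>| = 1\<close> and
      \<open>\<eta>^2 = z\<close>, conjugation sends \<open>orb \<eta>\<close> to
      \<open>orb (z * cnj \<eta>) = orb \<eta>\<close>. The twisted variable satisfies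
      \<open>t = \<epsilon> s^m\<close> with \<open>\<epsilon> = \<eta>^m\<close> equal to 1 or -1,
      so real \<open>s > 0\<close> describes one side of \<open>t = 0\<close>.\<close>
    define \<eta> where "\<eta> = csqrt z"
    have \<eta>2: "\<eta>\<^sup>2 = z" by (simp add: \<eta>_def)
    have "norm \<eta> ^ 2 = 1" using cU(2)[OF z(1)] \<eta>2
      by (metis complex_mod_mult_cnj mult.commute norm_one norm_power power2_eq_square power_mult_distrib real_sqrt_abs real_sqrt_eq_1_iff norm_ge_zero abs_of_nonneg)
    then have n\<eta>: "norm \<eta> = 1" using norm_ge_zero[of \<eta>] by (simp add: power2_eq_1_iff)
    then have c\<eta>: "cnj \<eta> * \<eta> = 1" using complex_norm_square[of \<eta>] by (simp add: mult.commute)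
    then have \<eta>0: "\<eta> \<noteq> 0" by auto
    define \<epsilon> where "\<epsilon> = \<eta> ^ m"
    have "\<epsilon>\<^sup>2 = (\<eta>\<^sup>2) ^ m" by (simp only: \<epsilon>_def power_mult[symmetric] mult.commute)
    then have "\<epsilon>\<^sup>2 = 1" using z(1) \<eta>2 by (simp add: U_def)
    then have \<epsilon>: "\<epsilon> \<in> {1, -1}" by (simp add: power2_eq_1_iff)
    have re: "fcnj (orb \<eta>) = orb \<eta>"
    proof -
      have "fcnj (orb \<eta>) = monsub (cnj \<eta>) 1 (orb z)" by (simp add: co z)
      also have "\<dots> = monsub (z * cnj \<eta>) 1 \<rho>" by (simp add: orb_def monsub_monsub)
      also have "z * cnj \<eta> = \<eta>" using c\<eta> by (simp add: \<eta>2[symmetric] power2_eq_square mult_ac)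
      finally show ?thesis by (simp add: orb_def)
    qed
    have tw: "map_poly (monsub \<epsilon> m) Q = map_poly (monsub \<eta> 1) (map_poly (monsub 1 m) Q)" for Q
      using m by (simp add: map_monsub_monsub \<epsilon>_def)
    interpret W: rhom "monsub \<eta> 1" by (rule monsub_rhom) simp
    obtain P1 where P1: "P = M * P1" using Mdvd[OF root] by (elim dvdE)
    have P10: "P1 \<noteq> 0" "M \<noteq> 0" using P(2) P1 by auto
    \<comment> \<open>The conjugates are distinct, so \<open>M\<close> uses up exactly one of an
      even number of zeros; at least one more is left for \<open>P1\<close>.\<close>
    have ordM: "order (orb \<eta>) (map_poly (monsub \<epsilon> m) M) = 1"
    proof -
      have "map_poly (monsub \<epsilon> m) M = (\<Prod>w\<in>U. [:- orb (w * \<eta>), 1:])"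
        by (simp add: tw M(3) N_def W.map_prod W.map_pC W.minus W.one orb_def monsub_monsub)
      moreover have "inj_on (\<lambda>w. orb (w * \<eta>)) U"
      proof (rule inj_onI)
        fix v w assume vw: "v \<in> U" "w \<in> U" "orb (v * \<eta>) = orb (w * \<eta>)"
        then have "monsub \<eta> 1 (orb v) = monsub \<eta> 1 (orb w)" by (simp add: orb_def monsub_monsub)
        then have "monsub \<eta> 1 (orb v - orb w) = 0" by (simp add: W.diff)
        then have "orb v - orb w = 0" by (rule monsub_eq_0[OF zero_less_one \<eta>0])
        then show "v = w" using inj vw by (simp add: inj_on_def)
      qed
      ultimately show ?thesis using order_prod_linear[OF U(1) _ U(2), of "\<lambda>w. orb (w * \<eta>)"] by simp
    qed
    have nz: "map_poly (monsub \<epsilon> m) Q \<noteq> 0" if "Q \<noteq> 0" for Q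
      using map_monsub_inj[OF m, of \<epsilon> Q 0] \<epsilon> that by auto
    have "even (order (orb \<eta>) (map_poly (monsub \<epsilon> m) P))"
      using E m \<epsilon> re unfolding even_real_branches_def by blast
    moreover have "order (orb \<eta>) (map_poly (monsub \<epsilon> m) P) = 1 + order (orb \<eta>) (map_poly (monsub \<epsilon> m) P1)"
      using nz P10 ordM by (simp add: P1 rhom.map_mult[OF monsub_rhom[OF m]] order_mult)
    ultimately have "order (orb \<eta>) (map_poly (monsub \<epsilon> m) P1) \<noteq> 0" by (metis add.right_neutral odd_one)
    then have "poly (map_poly (monsub \<epsilon> m) P1) (orb \<eta>) = 0" using order_root by blast
    then have "monsub \<eta> 1 (poly (map_poly (monsub 1 m) P1) \<rho>) = 0"
      using W.poly_map[of "map_poly (monsub 1 m) P1" \<rho>] by (simp add: tw orb_def)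
    then have "poly (map_poly (monsub 1 m) P1) \<rho> = 0" by (rule monsub_eq_0[OF zero_less_one \<eta>0])
    then have "M dvd P1" by (rule Mdvd)
    then have "M * M dvd P" unfolding P1 by (rule mult_dvd_mono[OF dvd_refl])
    \<comment> \<open>Conjugation sends the factor with parameter \<open>w\<close> to the one with
      \<open>z * cnj w\<close> and so only permutes the factors of \<open>N\<close>.\<close>
    moreover have "map_poly fcnj M = M"
    proof (rule map_monsub_inj[OF m, of 1])
      have "map_poly (monsub 1 m) (map_poly fcnj M) = map_poly fcnj N"
        using m M(3) map_fcnj_monsub[of m 1 M] by simp
      also have "\<dots> = (\<Prod>w\<in>U. [:- monsub (cnj w) 1 (orb z), 1:])"
        by (simp add: N_def C.map_prod C.map_pC C.minus C.one co z)
      also have "\<dots> = (\<Prod>w\<in>U. [:- orb (z * cnj w), 1:])"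
        by (simp add: orb_def monsub_monsub)
      also have "\<dots> = N" unfolding N_def
      proof (rule prod.reindex_bij_witness[of _ "\<lambda>w. z * cnj w" "\<lambda>w. z * cnj w"])
        fix w assume w: "w \<in> U"
        show "z * cnj (z * cnj w) = w" "z * cnj (z * cnj w) = w"
          using cU(2)[OF z(1)] by (simp_all add: mult_ac)
        show "z * cnj w \<in> U" "z * cnj w \<in> U" using z(1) cU(1)[OF w] by (simp_all add: U_def power_mult_distrib)
      qed simp_all
      finally show "map_poly (monsub 1 m) (map_poly fcnj M) = map_poly (monsub 1 m) M" by (simp add: M(3))
    qed simp
    ultimately show ?thesis using M m by metis
  qed
qed

text \<open>Peels off one \<open>M * map_poly fcnj M\<close> at a time. At a real
  \<open>\<rho>\<close> both factors have the same order, so an even number of zeros is removed and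
  the parity condition passes to the quotient.\<close>

lemma hermitian_factor:
  assumes "lead_coeff P = 1" "map_poly fcnj P = P" "even_real_branches P"
  shows "\<exists>Q. lead_coeff Q = 1 \<and> P = Q * map_poly fcnj Q"
  using assms
proof (induction "degree P" arbitrary: P rule: less_induct)
  case less
  interpret C: rhom fcnj by (rule fcnj_rhom)
  show ?case
  proof (cases "degree P = 0")
    case True
    then have "P = 1" using less.prems(1) by (metis degree_eq_zeroE lead_coeff_pCons(2) one_pCons pCons_0_0 lead_coeff_pCons(1) coeff_pCons_0)
    then show ?thesis by (intro exI[of _ 1]) (simp add: C.one)
  next
    case False
    then obtain M where M: "lead_coeff M = 1" "0 < degree M" "M * map_poly fcnj M dvd P"
      using hermitian_factor_step less.prems by blast
    then obtain P' where P': "P = M * map_poly fcnj M * P'" by (elim dvdE)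
    have lc: "lead_coeff (map_poly fcnj M) = 1" using C.monic_map(2)[OF M(1)] by simp
    then have l1: "lead_coeff P' = 1" using less.prems(1) M(1) by (simp add: P' lead_coeff_mult)
    have nz: "M \<noteq> 0" "map_poly fcnj M \<noteq> 0" "P' \<noteq> 0" using M lc l1 by auto
    have "degree P = degree M + degree (map_poly fcnj M) + degree P'"
      using nz by (simp add: P' degree_mult_eq)
    then have deg: "degree P' < degree P" using M(2) by simp
    have "M * map_poly fcnj M * map_poly fcnj P' = M * map_poly fcnj M * P'"
      using less.prems(2) by (simp add: P' C.map_mult mult_ac)
    then have inv: "map_poly fcnj P' = P'" using nz by simp
    have "even_real_branches P'" unfolding even_real_branches_def
    proof (intro allI ballI impI)
      fix m :: nat and \<epsilon> :: complex and \<rho>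
      assume h: "0 < m" "\<epsilon> \<in> {1, -1}" "fcnj \<rho> = \<rho>"
      interpret H: rhom "monsub \<epsilon> m" by (rule monsub_rhom[OF h(1)])
      have n: "map_poly (monsub \<epsilon> m) Q \<noteq> 0" if "Q \<noteq> 0" for Q
        using map_monsub_inj[OF h(1), of \<epsilon> Q 0] h(2) that by auto
      have "map_poly (monsub \<epsilon> m) (map_poly fcnj M) = map_poly fcnj (map_poly (monsub \<epsilon> m) M)"
        using map_fcnj_monsub[OF h(1), of \<epsilon> M] h(2) by auto
      then have "order \<rho> (map_poly (monsub \<epsilon> m) (map_poly fcnj M)) = order \<rho> (map_poly (monsub \<epsilon> m) M)"
        using order_map_fcnj[of \<rho> "map_poly (monsub \<epsilon> m) M"] h(3) by simp
      moreover have "even (order \<rho> (map_poly (monsub \<epsilon> m) P))"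
        using less.prems(3) h unfolding even_real_branches_def by blast
      ultimately show "even (order \<rho> (map_poly (monsub \<epsilon> m) P'))"
        using n nz by (simp add: P' H.map_mult order_mult)
    qed
    from less.hyps[OF deg l1 inv this] obtain Q where "lead_coeff Q = 1" "P' = Q * map_poly fcnj Q" by blast
    then show ?thesis using M(1)
      by (intro exI[of _ "M * Q"]) (simp add: P' C.map_mult lead_coeff_mult mult_ac)
  qed
qed

section \<open>From nonnegative real polynomials to two squares modulo a power of
  \<open>t - z\<close>\<close>

text \<open>Makes truncation legitimate: changing the argument modulo \<open>X^L\<close> changes the
  value only modulo \<open>X^L\<close>.\<close>

lemma minus_dvd_poly_diff: "a - b dvd poly p a - poly p b" for a b :: "'a::comm_ring_1"
proof (induction p)
  case (pCons c p)
  have "poly (pCons c p) a - poly (pCons c p) b = (a - b) * poly p a + b * (poly p a - poly p b)"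
    by (simp add: algebra_simps)
  then show ?case using pCons by simp
qed simp

lemma fps_X_power_dvd_nth: "fps_X ^ K dvd a \<longleftrightarrow> (\<forall>i<K. a $ i = 0)" for a :: "'a::comm_ring_1 fps"
proof
  assume "\<forall>i<K. a $ i = 0"
  then have "a = fps_X ^ K * fps_shift K a" by (auto simp: fps_eq_iff fps_X_power_mult_nth)
  then show "fps_X ^ K dvd a" by (rule dvdI)
qed (auto elim!: dvdE simp: fps_X_power_mult_nth)

definition cplx :: "real fps \<Rightarrow> complex fps" where
  "cplx a = Abs_fps (\<lambda>n. of_real (a $ n))"

lemma cplx_nth [simp]: "cplx a $ n = of_real (a $ n)"
  by (simp add: cplx_def)

lemma cplx_rhom: "rhom cplx"
  by unfold_locales (auto simp: fps_eq_iff fps_mult_nth)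

lemma fcnj_cplx [simp]: "fcnj (cplx a) = cplx a"
  by (simp add: fps_eq_iff)

lemma fcnj_eqE:
  assumes "fcnj a = a" obtains b where "a = cplx b"
proof
  have "cnj (a $ n) = a $ n" for n using assms by (simp add: fps_eq_iff)
  then show "a = cplx (Abs_fps (\<lambda>n. Re (a $ n)))"
    by (simp add: fps_eq_iff complex_eq_iff)
qed

definition emb :: "real poly \<Rightarrow> complex fps" where
  "emb p = cplx (fps_of_poly p)"

lemma emb_nth [simp]: "emb p $ n = of_real (coeff p n)"
  by (simp add: emb_def)

lemma emb_rhom: "rhom emb"
  unfolding emb_def
  by (intro rhom_compose[OF cplx_rhom]) (unfold_locales, simp_all add: fps_of_poly_add fps_of_poly_mult)

lemma fcnj_emb [simp]: "fcnj (emb p) = emb p"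
  by (simp add: emb_def)

lemma monsub_emb:
  assumes "0 < m"
  shows "monsub (of_real \<epsilon>) m (emb p) = emb (pcompose p (monom \<epsilon> m))"
proof (induction p)
  case 0
  then show ?case using assms by (simp add: rhom.zero[OF emb_rhom] rhom.zero[OF monsub_rhom])
next
  case (pCons a p)
  interpret E: rhom emb by (rule emb_rhom)
  interpret M: rhom "monsub (of_real \<epsilon>) m" by (rule monsub_rhom[OF assms])
  have e: "emb (pCons a p) = fps_const (of_real a) + fps_X * emb p"
    by (auto simp: fps_eq_iff coeff_pCons split: nat.splits)
  have c: "emb [:a:] = fps_const (of_real a)"
    by (auto simp: fps_eq_iff coeff_pCons split: nat.splits)
  have mc: "monsub (of_real \<epsilon>) m (fps_const (of_real a)) = fps_const (of_real a)"
    by (simp add: monsub_def)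
  have mx: "monsub (of_real \<epsilon>) m fps_X = emb (monom \<epsilon> m)"
    using assms by (auto simp: fps_eq_iff monsub_def)
  show ?case unfolding e M.add M.mult pCons.IH mc mx by (simp add: pcompose_pCons E.add E.mult c)
qed

text \<open>Just to the right of 0 a polynomial has the sign of its lowest nonzero
  coefficient.\<close>

lemma lowest_coeff_pos:
  fixes g :: "real poly"
  assumes low: "\<And>i. i < j \<Longrightarrow> coeff g i = 0" and c: "coeff g j \<noteq> 0"
    and d: "0 < d" "\<And>s. 0 < s \<Longrightarrow> s < d \<Longrightarrow> 0 \<le> poly g s"
  shows "0 < coeff g j"
proof (rule ccontr)
  assume "\<not> 0 < coeff g j"
  with c have neg: "coeff g j < 0" by simp
  define h where "h = poly_shift j g"
  have g: "g = monom 1 j * h"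
    by (auto simp: poly_eq_iff coeff_monom_mult h_def coeff_poly_shift low)
  have "poly h 0 = coeff g j" by (simp add: poly_0_coeff_0 h_def coeff_poly_shift)
  moreover have "isCont (poly h) 0" by simp
  ultimately have "eventually (\<lambda>x. poly h x < 0) (at 0)"
    using neg unfolding isCont_def by (intro order_tendstoD(2)[of _ "coeff g j"]) simp_all
  then obtain e where e: "0 < e" "\<And>x. x \<noteq> 0 \<Longrightarrow> \<bar>x\<bar> < e \<Longrightarrow> poly h x < 0"
    by (auto simp: eventually_at dist_real_def)
  define s where "s = min d e / 2"
  have s: "0 < s" "s < d" "s < e" using d e by (auto simp: s_def)
  then have "poly h s < 0" using e by simp
  then have "poly g s < 0" using s by (simp add: g poly_monom mult_pos_neg)
  then show False using d(2)[OF s(1,2)] by simp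
qed

lemma trunc_poly_ex:
  obtains p :: "real poly" where "\<And>i. coeff p i = (if i < K then u $ i else 0)"
proof
  show "coeff (\<Sum>i<K. monom (u $ i) i) i = (if i < K then u $ i else 0)" for i
    by (simp add: coeff_sum)
qed

text \<open>Let a real \<open>\<rho>\<close> have odd order \<open>k\<close> and write
  \<open>P = (r - \<rho>)^k H\<close>. Along the curves \<open>\<rho> + \<delta> s^N\<close> with
  \<open>\<delta> = 1\<close> and \<open>\<delta> = -1\<close> the lowest coefficients of
  \<open>P\<close> differ by the factor \<open>(-1)^k = -1\<close>. Both curves can be truncated to
  real polynomials, along which \<open>F\<close> is nonnegative for small
  \<open>s > 0\<close>.\<close>

lemma psd_even_real_branches:
  fixes F :: "real poly poly"
  assumes F: "F \<noteq> 0" and d: "0 < d" "\<And>t r. \<bar>t\<bar> < d \<Longrightarrow> 0 \<le> poly2 F t r"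
  shows "even_real_branches (map_poly emb F)"
  unfolding even_real_branches_def
proof (intro allI ballI impI, rule ccontr)
  fix m :: nat and \<epsilon>' :: complex and \<rho>
  define P where "P = map_poly (monsub \<epsilon>' m) (map_poly emb F)"
  define k where "k = order \<rho> P"
  assume m: "0 < m" and \<epsilon>': "\<epsilon>' \<in> {1, -1}" and \<rho>: "fcnj \<rho> = \<rho>"
    and odd: "odd (order \<rho> (map_poly (monsub \<epsilon>' m) (map_poly emb F)))"
  obtain \<epsilon> :: real where \<epsilon>: "\<epsilon>' = of_real \<epsilon>" "\<bar>\<epsilon>\<bar> = 1"
  proof (cases "\<epsilon>' = 1")
    case True then show ?thesis using that[of 1] by simp
  next
    case False then show ?thesis using that[of "-1"] \<epsilon>' by simp
  qed
  interpret E: rhom emb by (rule emb_rhom)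
  define F' where "F' = map_poly (\<lambda>p. pcompose p (monom \<epsilon> m)) F"
  have cF': "coeff F' n = pcompose (coeff F n) (monom \<epsilon> m)" for n
    unfolding F'_def by (rule coeff_map_poly) simp
  have PF': "P = map_poly emb F'"
    using m by (simp add: P_def poly_eq_iff rhom.coeff_map[OF monsub_rhom] E.coeff_map cF' \<epsilon> monsub_emb)
  have P0: "P \<noteq> 0"
  proof
    assume "P = 0"
    then have "map_poly emb F = 0"
      using map_monsub_inj[OF m, of \<epsilon>' "map_poly emb F" 0] \<epsilon>' by (auto simp: P_def)
    then have "emb (coeff F n) = 0" for n by (metis E.coeff_map coeff_0)
    then have "coeff F n = 0" for n by (auto simp: fps_eq_iff poly_eq_iff)
    then show False using F by (simp add: poly_eq_iff)
  qed
  obtain H where H: "P = [:- \<rho>, 1:] ^ k * H" "\<not> [:- \<rho>, 1:] dvd H"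
    using order_decomp[OF P0] unfolding k_def by blast
  have ok: "odd k" using odd by (simp add: k_def P_def)
  define h where "h = poly H \<rho>"
  have h0: "h \<noteq> 0" using H(2) by (simp add: h_def poly_eq_0_iff_dvd)
  define j where "j = subdegree h"
  have hj: "h $ j \<noteq> 0" using h0 by (simp add: j_def nth_subdegree_nonzero)
  have hl: "h $ i = 0" if "i < j" for i using that unfolding j_def by (rule nth_less_subdegree_zero)
  \<comment> \<open>The perturbation starts beyond the order \<open>j\<close> of \<open>h\<close>
    and leaves its lowest coefficient unchanged. \<open>L\<close> exceeds the order
    \<open>N * k + j\<close> of the value, so truncation at \<open>L\<close> does not disturb it
    either.\<close>
  define N where "N = Suc j"
  define L where "L = Suc (N * k + j)"
  obtain \<sigma> where \<sigma>: "\<rho> = cplx \<sigma>" using fcnj_eqE[OF \<rho>] .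
  obtain s where s: "\<And>i. coeff s i = (if i < L then \<sigma> $ i else 0)" using trunc_poly_ex[of L \<sigma>] by blast
  have main: "0 < Re (of_real (\<delta> ^ k) * h $ j) \<and> Im (of_real (\<delta> ^ k) * h $ j) = 0" if \<delta>: "\<bar>\<delta>\<bar> = 1" for \<delta> :: real
  proof -
    define \<tau> where "\<tau> = \<rho> + fps_const (of_real \<delta>) * fps_X ^ N"
    define g where "g = poly F' (s + monom \<delta> N)"
    have "fps_X ^ N dvd \<tau> - \<rho>" by (simp add: \<tau>_def)
    then have "fps_X ^ N dvd poly H \<tau> - h"
      unfolding h_def using minus_dvd_poly_diff dvd_trans by blast
    then have Hn: "poly H \<tau> $ i = h $ i" if "i \<le> j" for i
      using that unfolding fps_X_power_dvd_nth by (auto simp: N_def less_Suc_eq_le)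
    have Pt: "poly P \<tau> = fps_const (of_real (\<delta> ^ k)) * (fps_X ^ (N * k) * poly H \<tau>)"
      by (simp add: H(1) \<tau>_def power_mult_distrib fps_const_power mult.assoc flip: power_mult)
    have em: "emb (monom \<delta> N) = fps_const (of_real \<delta>) * fps_X ^ N"
      by (auto simp: fps_eq_iff)
    have "fps_X ^ L dvd emb (s + monom \<delta> N) - \<tau>"
      unfolding fps_X_power_dvd_nth \<tau>_def E.add em by (auto simp: s \<sigma>)
    then have "fps_X ^ L dvd poly P (emb (s + monom \<delta> N)) - poly P \<tau>"
      using minus_dvd_poly_diff dvd_trans by blast
    moreover have "poly P (emb (s + monom \<delta> N)) = emb g"
      unfolding PF' g_def by (rule E.poly_map)
    ultimately have gP: "of_real (coeff g i) = poly P \<tau> $ i" if "i < L" for i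
      using that unfolding fps_X_power_dvd_nth by (metis emb_nth eq_iff_diff_eq_0 fps_sub_nth)
    have gl: "coeff g i = 0" if "i < N * k + j" for i
    proof -
      have "poly P \<tau> $ i = 0"
        using that hl Hn[of "i - N * k"] by (auto simp: Pt fps_X_power_mult_nth)
      then show ?thesis using gP[of i] that by (simp add: L_def)
    qed
    have gj: "of_real (coeff g (N * k + j)) = of_real (\<delta> ^ k) * h $ j"
      using gP[of "N * k + j"] Hn[of j] by (simp add: Pt fps_X_power_mult_nth L_def)
    have "\<delta> \<noteq> 0" using \<delta> by auto
    then have gj0: "coeff g (N * k + j) \<noteq> 0" using gj hj by (metis mult_eq_0_iff of_real_0 of_real_eq_0_iff power_not_zero)
    have g0: "0 \<le> poly g x" if x: "0 < x" "x < min d 1" for x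
    proof -
      have "poly (poly F' q) x = poly2 F (\<epsilon> * x ^ m) (poly q x)" for q
      proof -
        have "poly (poly F' q) x = poly (map_poly (\<lambda>p. poly p x) F') (poly q x)"
        proof -
          interpret X: rhom "\<lambda>p. poly p x" by unfold_locales simp_all
          show ?thesis using X.poly_map[of F' q] by simp
        qed
        also have "map_poly (\<lambda>p. poly p x) F' = map_poly (\<lambda>p. poly p (\<epsilon> * x ^ m)) F"
          by (simp add: poly_eq_iff coeff_map_poly cF' poly_pcompose poly_monom)
        also have "poly \<dots> (poly q x) = poly2 F (\<epsilon> * x ^ m) (poly q x)"
        proof -
          interpret X: rhom "\<lambda>p. poly p (\<epsilon> * x ^ m)" by unfold_locales simp_all
          show ?thesis using X.poly_map[of F "[:poly q x:]"] by (simp add: poly2_def)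
        qed
        finally show ?thesis .
      qed
      moreover have "\<bar>\<epsilon> * x ^ m\<bar> < d"
      proof -
        have "x ^ m \<le> x ^ 1" using x m by (intro power_decreasing) auto
        then show ?thesis using x \<epsilon>(2) by (simp add: abs_mult)
      qed
      ultimately show ?thesis using d(2) by (simp add: g_def)
    qed
    have "0 < coeff g (N * k + j)"
      by (rule lowest_coeff_pos[of "N * k + j" g "min d 1"]) (use gl gj0 g0 d(1) in auto)
    then show ?thesis unfolding gj[symmetric] by simp
  qed
  show False using main[of 1] main[of "-1"] ok by simp
qed


lemma cplx_sqrt:
  assumes "0 < u $ 0"
  shows "\<exists>v. cplx v ^ 2 = cplx u"
proof -
  define v where "v = fps_radical (\<lambda>n x. root n x) (Suc 1) u"
  have "v ^ Suc 1 = u"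
    unfolding v_def using assms by (subst power_radical[symmetric]) (auto simp: real_root_pow_pos2)
  then have "v ^ 2 = u" by (simp add: numeral_2_eq_2 One_nat_def)
  then show ?thesis using rhom.power[OF cplx_rhom, of v 2] by (intro exI[of _ v]) simp
qed

lemma even_real_branches_smult:
  assumes "c \<noteq> 0" "even_real_branches (smult c P)"
  shows "even_real_branches P"
  unfolding even_real_branches_def
proof (intro allI ballI impI)
  fix m :: nat and \<epsilon> :: complex and \<rho>
  assume h: "0 < m" "\<epsilon> \<in> {1, -1}" "fcnj \<rho> = \<rho>"
  then have "monsub \<epsilon> m c \<noteq> 0" using monsub_eq_0[of m \<epsilon> c] assms(1) by auto
  then show "even (order \<rho> (map_poly (monsub \<epsilon> m) P))"
    using assms(2) h unfolding even_real_branches_def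
    by (metis order_smult rhom.map_smult[OF monsub_rhom])
qed

text \<open>The leading coefficient is a series with positive constant term, hence a unit and the
  square of a real series \<open>v\<close>. The monic quotient is \<open>Q\<close> times its
  conjugate, and \<open>v\<close> is absorbed into \<open>W = v Q\<close>.\<close>

lemma local_hermitian_factor:
  fixes F :: "real poly poly"
  assumes deg: "degree F = 2 * e" and lc: "0 < poly (lead_coeff F) 0"
    and d: "0 < d" "\<And>t r. \<bar>t\<bar> < d \<Longrightarrow> 0 \<le> poly2 F t r"
  shows "\<exists>W. degree W = e \<and> map_poly emb F = W * map_poly fcnj W"
proof -
  interpret E: rhom emb by (rule emb_rhom)
  interpret C: rhom fcnj by (rule fcnj_rhom)
  have F0: "F \<noteq> 0" using lc by auto
  define a where "a = emb (lead_coeff F)"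
  have a0: "a $ 0 \<noteq> 0" using lc by (simp add: a_def poly_0_coeff_0)
  then have ai: "a * inverse a = 1" by (simp add: inverse_mult_eq_1')
  have "0 < fps_of_poly (lead_coeff F) $ 0" using lc by (simp add: poly_0_coeff_0)
  then obtain v where v: "cplx v ^ 2 = a" using cplx_sqrt unfolding a_def emb_def by blast
  have ia: "fcnj (inverse a) = inverse a"
  proof -
    have "a * fcnj (inverse a) = fcnj (a * inverse a)" by (simp add: C.mult) (simp add: a_def)
    also have "\<dots> = a * inverse a" by (simp add: ai C.one)
    finally show ?thesis using a0 by auto
  qed
  have emb0: "emb p = 0 \<longleftrightarrow> p = 0" for p by (auto simp: fps_eq_iff poly_eq_iff)
  have dE: "degree (map_poly emb F) = 2 * e"
    using degree_map_poly[of emb F] emb0 by (simp add: deg)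
  define P where "P = smult (inverse a) (map_poly emb F)"
  have PF: "smult a P = map_poly emb F" by (simp add: P_def ai)
  have i0: "inverse a \<noteq> 0" using a0 by auto
  have "lead_coeff P = 1"
    using i0 by (simp add: P_def dE E.coeff_map deg[symmetric] a_def[symmetric]) (use ai in \<open>simp add: mult.commute\<close>)
  moreover have "map_poly fcnj P = P"
    by (simp add: P_def C.map_smult ia) (simp add: poly_eq_iff C.coeff_map E.coeff_map)
  moreover have "even_real_branches P"
  proof (rule even_real_branches_smult)
    show "a \<noteq> 0" using a0 by auto
    show "even_real_branches (smult a P)" unfolding PF by (rule psd_even_real_branches[OF F0 d])
  qed
  ultimately obtain Q where Q: "lead_coeff Q = 1" "P = Q * map_poly fcnj Q"
    using hermitian_factor by blast
  have "cplx v \<noteq> 0" using v a0 by auto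
  define W where "W = smult (cplx v) Q"
  have W: "W * map_poly fcnj W = map_poly emb F"
    by (simp add: W_def C.map_smult flip: PF v Q(2) power2_eq_square)
  have "degree P = degree Q + degree (map_poly fcnj Q)"
    using Q C.monic_map[OF Q(1)] by (metis degree_mult_eq leading_coeff_0_iff zero_neq_one)
  then have "degree P = 2 * degree Q" using C.monic_map(1)[OF Q(1)] by simp
  then have "degree W = e" using \<open>cplx v \<noteq> 0\<close> dE i0 by (simp add: W_def P_def)
  then show ?thesis using W by auto
qed

text \<open>Splitting \<open>W = A + i B\<close> into real and imaginary parts turns
  \<open>W\<close> times its conjugate into \<open>A^2 + B^2\<close>. Truncating the coefficients
  modulo \<open>t^K\<close> makes \<open>A\<close> and \<open>B\<close> polynomials in
  \<open>t\<close> without raising the degree in \<open>r\<close>.\<close>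

lemma local_two_squares_0:
  fixes F :: "real poly poly"
  assumes deg: "degree F = 2 * e" and lc: "0 < poly (lead_coeff F) 0"
    and d: "0 < d" "\<And>t r. \<bar>t\<bar> < d \<Longrightarrow> 0 \<le> poly2 F t r"
  shows "\<exists>A B. degree A \<le> e \<and> degree B \<le> e \<and> [:monom 1 K:] dvd F - A\<^sup>2 - B\<^sup>2"
proof -
  interpret E: rhom emb by (rule emb_rhom)
  interpret C: rhom fcnj by (rule fcnj_rhom)
  obtain W where W: "degree W = e" "map_poly emb F = W * map_poly fcnj W"
    using local_hermitian_factor[OF assms] by blast
  define cut where "cut = (\<lambda>f (u :: complex fps). \<Sum>i<K. monom (f (u $ i) :: real) i)"
  have cc: "coeff (cut f u) i = (if i < K then f (u $ i) else 0)" for f u i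
    by (simp add: cut_def coeff_sum)
  define A where "A = map_poly (cut Re) W"
  define B where "B = map_poly (cut Im) W"
  have cA: "coeff A n = cut Re (coeff W n)" and cB: "coeff B n = cut Im (coeff W n)" for n
    unfolding A_def B_def by (rule coeff_map_poly; simp add: cut_def)+
  define j where "j = fps_const \<i>"
  have j: "j * j = -1" "fcnj j = - j"
    by (simp_all add: j_def fps_eq_iff)
  \<comment> \<open>\<open>V\<close> is \<open>W\<close> with its coefficients cut off at order
    \<open>K\<close>.\<close>
  define V where "V = map_poly emb A + smult j (map_poly emb B)"
  have cV: "map_poly fcnj V = map_poly emb A - smult j (map_poly emb B)"
    by (simp add: V_def C.map_add C.map_smult j) (simp add: poly_eq_iff C.coeff_map E.coeff_map)
  have VV: "V * map_poly fcnj V = map_poly emb (A\<^sup>2 + B\<^sup>2)"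
  proof -
    have "V * map_poly fcnj V = (map_poly emb A)\<^sup>2 - smult (j * j) ((map_poly emb B)\<^sup>2)"
      by (subst cV) (simp add: V_def algebra_simps power2_eq_square)
    then show ?thesis by (simp add: j E.map_add E.map_power)
  qed
  have d1: "fps_X ^ K dvd coeff (W - V) n" for n
    unfolding fps_X_power_dvd_nth
    by (auto simp: V_def E.coeff_map cA cB cc j_def complex_eq_iff)
  then have d2: "fps_X ^ K dvd coeff (map_poly fcnj (W - V)) n" for n
    by (simp add: C.coeff_map fps_X_power_dvd_nth)
  have d1': "[:fps_X ^ K:] dvd W - V" and d2': "[:fps_X ^ K:] dvd map_poly fcnj (W - V)"
    using d1 d2 by (auto simp: const_poly_dvd_iff)
  have "map_poly emb (F - A\<^sup>2 - B\<^sup>2) = W * map_poly fcnj W - V * map_poly fcnj V"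
    by (simp add: E.map_diff E.map_add VV W(2))
  also have "\<dots> = (W - V) * map_poly fcnj W + V * map_poly fcnj (W - V)"
    by (simp add: C.map_diff algebra_simps)
  finally have "[:fps_X ^ K:] dvd map_poly emb (F - A\<^sup>2 - B\<^sup>2)"
    using d1' d2' by simp
  then have z: "coeff (coeff (F - A\<^sup>2 - B\<^sup>2) n) i = 0" if "i < K" for n i
    using that unfolding const_poly_dvd_iff fps_X_power_dvd_nth E.coeff_map emb_nth by (metis of_real_eq_0_iff)
  have "[:monom 1 K:] dvd F - A\<^sup>2 - B\<^sup>2"
    unfolding const_poly_dvd_iff
  proof
    fix n
    have "coeff (F - A\<^sup>2 - B\<^sup>2) n = monom 1 K * poly_shift K (coeff (F - A\<^sup>2 - B\<^sup>2) n)"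
      by (rule poly_eqI) (use z in \<open>auto simp: coeff_monom_mult coeff_poly_shift\<close>)
    then show "monom 1 K dvd coeff (F - A\<^sup>2 - B\<^sup>2) n" by (rule dvdI)
  qed
  moreover have "degree A \<le> e" "degree B \<le> e"
    unfolding A_def B_def W(1)[symmetric] by (rule map_poly_degree_leq)+
  ultimately show ?thesis by blast
qed

lemma pcompose_rhom: "rhom (\<lambda>p. pcompose p q)" for q :: "'a::idom poly"
  by unfold_locales (simp_all add: pcompose_1 pcompose_add pcompose_mult)

lemma poly_eval_rhom: "rhom (\<lambda>p. poly p (x :: 'a :: comm_ring_1))"
  by unfold_locales simp_all

lemma poly2_altdef: "poly2 F t r = poly (map_poly (\<lambda>p. poly p t) F) r"
  using rhom.poly_map[OF poly_eval_rhom, of t F "[:r:]"] by (simp add: poly2_def)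

lemma poly2_map_pcompose: "poly2 (map_poly (\<lambda>p. pcompose p q) F) t r = poly2 F (poly q t) r"
proof -
  have "map_poly (\<lambda>p. poly p t) (map_poly (\<lambda>p. pcompose p q) F) = map_poly (\<lambda>p. poly p (poly q t)) F"
    by (simp add: poly_eq_iff coeff_map_poly poly_pcompose)
  then show ?thesis by (simp add: poly2_altdef)
qed

lemma local_two_squares:
  fixes F :: "real poly poly"
  assumes deg: "degree F = 2 * e" and lc: "0 < poly (lead_coeff F) z"
    and psd: "\<And>t r. 0 \<le> poly2 F t r"
  shows "\<exists>A B. degree A \<le> e \<and> degree B \<le> e \<and> [:[:- z, 1:] ^ K:] dvd F - A\<^sup>2 - B\<^sup>2"
proof -
  define sh where "sh = (\<lambda>c. map_poly (\<lambda>p. pcompose p [:c, 1::real:]))"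
  have sh: "rhom (sh c)" for c
    unfolding sh_def by (rule rhom.map_poly_rhom[OF pcompose_rhom])
  have cs: "coeff (sh c G) n = pcompose (coeff G n) [:c, 1:]" for c G n
    unfolding sh_def by (rule coeff_map_poly) simp
  have ss: "sh (- c) (sh c G) = G" for c G
    by (simp add: poly_eq_iff cs pcompose_assoc[symmetric] pcompose_pCons)
  have degs: "degree (sh c G) = degree G" for c G
    unfolding sh_def by (rule degree_map_poly) (simp add: pcompose_eq_0_iff)
  have "\<exists>A B. degree A \<le> e \<and> degree B \<le> e \<and> [:monom 1 K:] dvd sh z F - A\<^sup>2 - B\<^sup>2"
  proof (rule local_two_squares_0[where d = 1])
    show "degree (sh z F) = 2 * e" using deg by (simp add: degs)
    show "0 < poly (lead_coeff (sh z F)) 0" using lc by (simp add: degs cs poly_pcompose)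
    show "0 \<le> poly2 (sh z F) t r" for t r using psd by (simp add: sh_def poly2_map_pcompose)
  qed simp
  then obtain A B where AB: "degree A \<le> e" "degree B \<le> e" "[:monom 1 K:] dvd sh z F - A\<^sup>2 - B\<^sup>2" by blast
  interpret S: rhom "sh (- z)" by (rule sh)
  obtain G where G: "sh z F - A\<^sup>2 - B\<^sup>2 = [:monom 1 K:] * G" using AB(3) by (elim dvdE)
  have "F - (sh (- z) A)\<^sup>2 - (sh (- z) B)\<^sup>2 = sh (- z) (sh z F - A\<^sup>2 - B\<^sup>2)"
    by (simp add: S.diff S.power ss)
  also have "\<dots> = sh (- z) [:monom 1 K:] * sh (- z) G" by (simp only: G S.mult)
  also have "sh (- z) [:monom 1 K:] = [:[:- z, 1:] ^ K:]"
    by (simp add: sh_def map_poly_pCons monom_altdef pcompose_power pcompose_pCons)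
  finally have "[:[:- z, 1:] ^ K:] dvd F - (sh (- z) A)\<^sup>2 - (sh (- z) B)\<^sup>2" by (metis dvd_triv_left)
  then show ?thesis using AB by (intro exI[of _ "sh (- z) A"] exI[of _ "sh (- z) B"]) (simp add: degs)
qed

section \<open>Sums of squares and the univariate case\<close>

lemma sosI: "set gs \<subseteq> A \<Longrightarrow> f = (\<Sum>g\<leftarrow>gs. g\<^sup>2) \<Longrightarrow> f \<in> sos A"
  by (auto simp: sos_def)

lemma sos_zero: "0 \<in> sos A"
  by (rule sosI[of "[]"]) auto

lemma sos_square: "g \<in> A \<Longrightarrow> g\<^sup>2 \<in> sos A"
  by (rule sosI[of "[g]"]) auto

lemma sos_add: "f \<in> sos A \<Longrightarrow> g \<in> sos A \<Longrightarrow> f + g \<in> sos A"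
proof -
  assume "f \<in> sos A" "g \<in> sos A"
  then obtain fs gs where "set fs \<subseteq> A" "f = (\<Sum>g\<leftarrow>fs. g\<^sup>2)" "set gs \<subseteq> A" "g = (\<Sum>g\<leftarrow>gs. g\<^sup>2)"
    by (auto simp: sos_def)
  then show ?thesis by (intro sosI[of "fs @ gs"]) auto
qed

lemma sos_sum: "(\<And>x. x \<in> S \<Longrightarrow> f x \<in> sos A) \<Longrightarrow> sum f S \<in> sos A"
  by (induction S rule: infinite_finite_induct) (auto intro: sos_zero sos_add)

lemma sos_induct [consumes 1, case_names zero step]:
  assumes "f \<in> sos A" "P 0" "\<And>g h. g \<in> A \<Longrightarrow> h \<in> sos A \<Longrightarrow> P h \<Longrightarrow> P (g\<^sup>2 + h)"
  shows "P f"
proof -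
  obtain gs where gs: "set gs \<subseteq> A" "f = (\<Sum>g\<leftarrow>gs. g\<^sup>2)" using assms(1) by (auto simp: sos_def)
  have "P (\<Sum>g\<leftarrow>gs. g\<^sup>2)" using gs(1)
    by (induction gs) (auto intro!: assms(2,3) intro: sosI)
  then show ?thesis by (simp add: gs)
qed

lemma sos_mult:
  assumes A: "\<And>x y. x \<in> A \<Longrightarrow> y \<in> A \<Longrightarrow> x * y \<in> A" and f: "f \<in> sos A" and g: "g \<in> sos A"
  shows "f * g \<in> sos A"
  using f
proof (induction rule: sos_induct)
  case zero
  then show ?case by (simp add: sos_zero)
next
  case (step a h)
  have "a\<^sup>2 * g \<in> sos A" using g
  proof (induction rule: sos_induct)
    case (step b k)
    have "a\<^sup>2 * (b\<^sup>2 + k) = (a * b)\<^sup>2 + a\<^sup>2 * k" by (simp add: algebra_simps power_mult_distrib)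
    then show ?case using step A \<open>a \<in> A\<close> by (auto intro!: sos_add sos_square)
  qed (simp add: sos_zero)
  then show ?case using step.IH by (simp add: distrib_right sos_add)
qed

lemma sos_mult_UNIV: "f \<in> sos UNIV \<Longrightarrow> g \<in> sos UNIV \<Longrightarrow> f * g \<in> sos UNIV"
  by (rule sos_mult) auto

lemma sos_one: "1 \<in> sos UNIV"
  using sos_square[of 1 UNIV] by simp

lemma sos_power: "f \<in> sos UNIV \<Longrightarrow> f ^ n \<in> sos UNIV"
  by (induction n) (simp_all add: sos_one sos_mult_UNIV)

lemma sos_even_power: "even n \<Longrightarrow> f ^ n \<in> sos UNIV"
proof -
  assume "even n"
  then obtain m where "n = 2 * m" by auto
  then show ?thesis by (simp add: power_even_eq sos_square)
qed
  
lemma sos_map: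
  assumes "rhom h" "f \<in> sos A"
  shows "h f \<in> sos (h ` A)"
  using assms(2)
proof (induction rule: sos_induct)
  case zero
  then show ?case using rhom.zero[OF assms(1)] by (simp add: sos_zero)
next
  case (step a k)
  then show ?case using rhom.add[OF assms(1)] rhom.power[OF assms(1)]
    by (auto intro!: sos_add sos_square)
qed

lemma sos_mono: "A \<subseteq> B \<Longrightarrow> f \<in> sos A \<Longrightarrow> f \<in> sos B"
  by (auto simp: sos_def)

lemma poly_nonneg_closure:
  fixes p :: "real poly"
  assumes "\<And>x. x \<noteq> a \<Longrightarrow> 0 \<le> poly p x"
  shows "0 \<le> poly p a"
proof (rule tendsto_lowerbound)
  show "(poly p \<longlongrightarrow> poly p a) (at a)" by (intro tendsto_intros)
  show "eventually (\<lambda>x. 0 \<le> poly p x) (at a)"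
    using assms by (auto simp: eventually_at_filter)
qed simp

lemma poly_root_double:
  fixes q :: "real poly"
  assumes "\<And>x. 0 \<le> (x - a) * poly q x"
  shows "poly q a = 0"
proof (rule antisym)
  have pos: "a < x \<Longrightarrow> 0 \<le> poly q x" and neg: "x < a \<Longrightarrow> poly q x \<le> 0" for x
    using assms[of x] by (simp_all add: zero_le_mult_iff)
  show "0 \<le> poly q a"
  proof (rule tendsto_lowerbound)
    show "(poly q \<longlongrightarrow> poly q a) (at_right a)"
      by (intro tendsto_intros)
    show "eventually (\<lambda>x. 0 \<le> poly q x) (at_right a)"
      by (auto simp: eventually_at_filter intro!: always_eventually pos neg)
  qed simp
  show "poly q a \<le> 0"
  proof (rule tendsto_upperbound)
    show "(poly q \<longlongrightarrow> poly q a) (at_left a)"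
      by (intro tendsto_intros)
    show "eventually (\<lambda>x. poly q x \<le> 0) (at_left a)"
      by (auto simp: eventually_at_filter intro!: always_eventually pos neg)
  qed simp
qed

text \<open>Induction on the degree. Nonnegativity forces a real root to be double; a nonreal root
  \<open>z\<close> splits off \<open>(x - z)(x - cnj z) = (x - Re z)^2 + (Im z)^2\<close>, which is
  positive on the line.\<close>

lemma univariate_psd_sos:
  fixes p :: "real poly"
  assumes "\<And>x. 0 \<le> poly p x"
  shows "p \<in> sos UNIV"
  using assms
proof (induction "degree p" arbitrary: p rule: less_induct)
  case less
  show ?case
  proof (cases "degree p = 0")
    case True
    then obtain c where c: "p = [:c:]" by (metis degree_eq_zeroE)
    then have "0 \<le> c" using less.prems[of 0] by simp
    then have "p = [:sqrt c:]\<^sup>2" by (simp add: c power2_eq_square)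
    then show ?thesis using sos_square by (metis UNIV_I)
  next
    case False
    define P where "P = map_poly complex_of_real p"
    interpret R: rhom complex_of_real by unfold_locales simp_all
    have "degree P = degree p" unfolding P_def by (rule degree_map_poly) simp
    then have "\<not> constant (poly P)" using False by (simp add: constant_degree)
    then obtain z where z: "poly P z = 0" using fundamental_theorem_of_algebra by blast
    show ?thesis
    proof (cases "Im z = 0")
      case True
      define a where "a = Re z"
      have "z = of_real a" using True by (simp add: a_def complex_eq_iff)
      then have "poly p a = 0" using z R.poly_map[of p a] by (simp add: P_def)
      then obtain q where q: "p = [:- a, 1:] * q" by (auto simp: poly_eq_0_iff_dvd elim: dvdE)
      have "poly q a = 0" by (rule poly_root_double) (use less.prems in \<open>auto simp: q algebra_simps\<close>)
      then obtain s where s: "q = [:- a, 1:] * s" by (auto simp: poly_eq_0_iff_dvd elim: dvdE)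
      have p: "p = [:- a, 1:]\<^sup>2 * s" by (simp only: q s power2_eq_square mult.assoc)
      have s1: "0 \<le> poly s x" if "x \<noteq> a" for x
        using less.prems[of x] that by (simp add: p zero_le_mult_iff)
      have "0 \<le> poly s x" for x using s1 poly_nonneg_closure[of a s] by (cases "x = a") auto
      moreover have "degree s < degree p"
      proof -
        have "s \<noteq> 0" using False p by auto
        then show ?thesis by (simp add: p degree_mult_eq degree_power_eq)
      qed
      ultimately have "s \<in> sos UNIV" using less.hyps by blast
      then show ?thesis unfolding p by (intro sos_mult_UNIV sos_square) auto
    next
      case False
      define d where "d = [:- Re z, 1:]\<^sup>2 + [:Im z:]\<^sup>2"
      have dd: "d = [:(Re z)\<^sup>2 + (Im z)\<^sup>2, - 2 * Re z, 1:]" by (simp add: d_def power2_eq_square)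
      have d2: "degree d = 2" by (simp add: dd)
      \<comment> \<open>A real polynomial of degree at most 1 with a nonreal root is zero, so
        \<open>d\<close> divides \<open>p\<close>.\<close>
      define r where "r = p mod d"
      have dz: "poly (map_poly complex_of_real d) z = 0"
        by (simp add: dd R.map_pC complex_eq_iff power2_eq_square algebra_simps)
      have "d \<noteq> 0" using d2 by auto
      then have "degree r < 2" using degree_mod_less'[of d p] d2
        by (cases "r = 0") (auto simp: r_def)
      then have rr: "r = [:coeff r 0, coeff r 1:]"
        by (auto simp: poly_eq_iff coeff_pCons split: nat.splits) (auto intro!: coeff_eq_0 simp: numeral_2_eq_2 One_nat_def)
      have "p = d * (p div d) + r" by (simp add: r_def)
      then have "P = map_poly complex_of_real d * map_poly complex_of_real (p div d) + map_poly complex_of_real r"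
        unfolding P_def using R.map_add R.map_mult by metis
      then have "poly (map_poly complex_of_real r) z = 0" using z dz by simp
      then have "poly (map_poly complex_of_real [:coeff r 0, coeff r 1:]) z = 0" using rr by simp
      then have "coeff r 1 = 0 \<and> coeff r 0 = 0"
        using False by (auto simp: R.map_pC complex_eq_iff)
      then have "r = 0" using rr by simp
      then have p: "p = d * (p div d)" unfolding r_def by (simp add: mod_eq_0_iff_dvd)
      have dpos: "0 < poly d x" for x using False by (simp add: d_def add_nonneg_pos)
      have "0 \<le> poly (p div d) x" for x
        using less.prems[of x] dpos[of x] arg_cong[OF p, of "\<lambda>q. poly q x"] 
        by (simp add: zero_le_mult_iff)
      moreover have "degree (p div d) < degree p"
      proof -
        have "degree p = degree d + degree (p div d)"
          using p \<open>degree p \<noteq> 0\<close> by (metis degree_0 degree_mult_eq mult_zero_left mult_zero_right)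
        then show ?thesis using d2 by simp
      qed
      ultimately have "p div d \<in> sos UNIV" using less.hyps by blast
      moreover have "d \<in> sos UNIV" unfolding d_def by (intro sos_add sos_square) auto
      ultimately show ?thesis using p sos_mult_UNIV by metis
    qed
  qed
qed

lemma poly2_eqI:
  assumes "\<And>t r. poly2 f t r = poly2 g t r"
  shows "f = g"
proof (rule poly_eqI)
  fix n
  have "map_poly (\<lambda>p. poly p t) f = map_poly (\<lambda>p. poly p t) g" for t
    using assms[of t] by (intro poly_eq_poly_eq_iff[THEN iffD1] ext) (simp add: poly2_altdef)
  then have "poly (coeff f n) t = poly (coeff g n) t" for t
    by (metis poly_eval_rhom rhom.coeff_map)
  then show "coeff f n = coeff g n" by (simp add: poly_eq_poly_eq_iff[symmetric] fun_eq_iff)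
qed

lemma poly_sum_le:
  fixes p :: "'a::comm_ring_1 poly"
  assumes "degree p \<le> d"
  shows "poly p x = (\<Sum>k\<le>d. coeff p k * x ^ k)"
  unfolding poly_altdef using assms
  by (intro sum.mono_neutral_left) (auto simp: coeff_eq_0)

lemma poly2_sum_coeffs:
  assumes "degree B \<le> d"
  shows "poly2 B t r = (\<Sum>k\<le>d. poly (coeff B k) t * r ^ k)"
proof -
  have "degree (map_poly (\<lambda>p. poly p t) B) \<le> d"
    using assms map_poly_degree_leq le_trans by blast
  then show ?thesis unfolding poly2_altdef
    by (subst poly_sum_le) (auto simp: rhom.coeff_map[OF poly_eval_rhom])
qed

lemma poly2_sum [simp]: "poly2 (sum f S) t r = (\<Sum>x\<in>S. poly2 (f x) t r)"
  by (induction S rule: infinite_finite_induct) simp_all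

lemma const_poly_rhom: "rhom (\<lambda>x. [:x:])"
  by unfold_locales simp_all

lemma poly2_map_const: "poly2 (map_poly (\<lambda>x. [:x:]) p) t r = poly p r"
  by (simp add: poly2_altdef map_poly_map_poly o_def)

lemma poly2_const [simp]: "poly2 [:p:] t r = poly p t"
  by (simp add: poly2_def)

text \<open>In the chart \<open>x = t y\<close> this is \<open>(x^2 + y^2) / y^2\<close>, the source
  of the denominators \<open>x^2 + y^2\<close>.\<close>

definition one_plus_sq :: "real poly poly" where
  "one_plus_sq = [:[:1, 0, 1:]:]"

lemma poly2_one_plus_sq [simp]: "poly2 one_plus_sq t r = 1 + t\<^sup>2"
  by (simp add: one_plus_sq_def power2_eq_square)

lemma one_plus_sq_sos: "one_plus_sq \<in> sos UNIV"
proof -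
  have eq: "one_plus_sq = 1\<^sup>2 + [:[:0, 1:]:]\<^sup>2" by (rule poly2_eqI) (simp add: power2_eq_square)
  show ?thesis unfolding eq by (intro sos_add sos_square) simp_all
qed

lemma nonneg_const_sos: "0 \<le> (c::real) \<Longrightarrow> [:[:c:]:] \<in> sos UNIV"
proof -
  assume "0 \<le> c"
  then have "[:[:c:]:] = [:[:sqrt c:]:]\<^sup>2" by (intro poly2_eqI) simp
  then show ?thesis using sos_square by (metis UNIV_I)
qed

section \<open>Strictly positive polynomials\<close>

lemma poly2_smult [simp]: "poly2 (smult a B) t r = poly a t * poly2 B t r"
  by (simp add: poly2_def)

text \<open>For \<open>t = tan \<phi>\<close> one has
  \<open>1 + i t = exp(i \<phi>) / cos \<phi>\<close>. After multiplication by
  \<open>cos^m \<phi>\<close> these are the trigonometric polynomials with frequencies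
  \<open>2 l - m\<close>.\<close>

definition conj_span :: "nat \<Rightarrow> (real \<Rightarrow> complex) \<Rightarrow> bool" where
  "conj_span m f \<longleftrightarrow> (\<exists>c. \<forall>t. f t = (\<Sum>l\<le>m. c l * Complex 1 t ^ l * Complex 1 (- t) ^ (m - l)))"

lemma conj_span_add: "conj_span m f \<Longrightarrow> conj_span m g \<Longrightarrow> conj_span m (\<lambda>t. f t + g t)"
  unfolding conj_span_def
proof (elim exE)
  fix c d
  assume "\<forall>t. f t = (\<Sum>l\<le>m. c l * Complex 1 t ^ l * Complex 1 (- t) ^ (m - l))"
    "\<forall>t. g t = (\<Sum>l\<le>m. d l * Complex 1 t ^ l * Complex 1 (- t) ^ (m - l))"
  then show "\<exists>c. \<forall>t. f t + g t = (\<Sum>l\<le>m. c l * Complex 1 t ^ l * Complex 1 (- t) ^ (m - l))"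
    by (intro exI[of _ "\<lambda>l. c l + d l"]) (simp add: distrib_right sum.distrib)
qed

lemma conj_span_scale: "conj_span m f \<Longrightarrow> conj_span m (\<lambda>t. a * f t)"
  unfolding conj_span_def
proof (elim exE)
  fix c
  assume "\<forall>t. f t = (\<Sum>l\<le>m. c l * Complex 1 t ^ l * Complex 1 (- t) ^ (m - l))"
  then show "\<exists>c. \<forall>t. a * f t = (\<Sum>l\<le>m. c l * Complex 1 t ^ l * Complex 1 (- t) ^ (m - l))"
    by (intro exI[of _ "\<lambda>l. a * c l"]) (simp add: sum_distrib_left mult.assoc)
qed

lemma conj_span_Suc:
  assumes "conj_span m f"
  shows "conj_span (Suc m) (\<lambda>t. Complex 1 t * f t)" "conj_span (Suc m) (\<lambda>t. Complex 1 (- t) * f t)"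
proof -
  obtain c where c: "f t = (\<Sum>l\<le>m. c l * Complex 1 t ^ l * Complex 1 (- t) ^ (m - l))" for t
    using assms by (auto simp: conj_span_def)
  have "Complex 1 t * f t = (\<Sum>l\<le>Suc m. (if l = 0 then 0 else c (l - 1)) * Complex 1 t ^ l * Complex 1 (- t) ^ (Suc m - l))" for t
    by (subst sum.atMost_Suc_shift) (simp add: c sum_distrib_left mult_ac)
  then show "conj_span (Suc m) (\<lambda>t. Complex 1 t * f t)"
    unfolding conj_span_def by (intro exI[of _ "\<lambda>l. if l = 0 then 0 else c (l - 1)"]) blast
  have "Complex 1 (- t) * f t = (\<Sum>l\<le>Suc m. (if l = Suc m then 0 else c l) * Complex 1 t ^ l * Complex 1 (- t) ^ (Suc m - l))" for t
    unfolding sum.atMost_Suc by (auto simp: c sum_distrib_left mult_ac Suc_diff_le intro!: sum.cong)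
  then show "conj_span (Suc m) (\<lambda>t. Complex 1 (- t) * f t)"
    unfolding conj_span_def by (intro exI[of _ "\<lambda>l. if l = Suc m then 0 else c l"]) blast
qed

text \<open>The degree is raised through \<open>1 = ((1 + i t) + (1 - i t)) / 2\<close> and
  \<open>t = ((1 + i t) - (1 - i t)) / (2 i)\<close>.\<close>

lemma conj_span_power: "k \<le> m \<Longrightarrow> conj_span m (\<lambda>t. of_real t ^ k)"
proof (induction m arbitrary: k)
  case 0
  then show ?case by (auto simp: conj_span_def)
next
  case (Suc m)
  show ?case
  proof (cases "k \<le> m")
    case True
    have "conj_span (Suc m) (\<lambda>t. (1/2) * (Complex 1 t * of_real t ^ k) + (1/2) * (Complex 1 (- t) * of_real t ^ k))"
      using Suc.IH[OF True] by (intro conj_span_add conj_span_scale conj_span_Suc)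
    moreover have "(1/2) * (Complex 1 t * of_real t ^ k) + (1/2) * (Complex 1 (- t) * of_real t ^ k) = of_real t ^ k" for t
    proof -
      have "(1/2) * Complex 1 t + (1/2) * Complex 1 (- t) = 1" by (simp add: complex_eq_iff)
      then show ?thesis by (metis distrib_right mult.assoc mult_1)
    qed
    ultimately show ?thesis by simp
  next
    case False
    then have k: "k = Suc m" using Suc.prems by simp
    have "conj_span (Suc m) (\<lambda>t. (- \<i>/2) * (Complex 1 t * of_real t ^ m) + (\<i>/2) * (Complex 1 (- t) * of_real t ^ m))"
      using Suc.IH[of m] by (intro conj_span_add conj_span_scale conj_span_Suc) simp_all
    moreover have "(- \<i>/2) * (Complex 1 t * of_real t ^ m) + (\<i>/2) * (Complex 1 (- t) * of_real t ^ m) = of_real t ^ k" for t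
    proof -
      have "(- \<i>/2) * Complex 1 t + (\<i>/2) * Complex 1 (- t) = of_real t" by (simp add: complex_eq_iff)
      then show ?thesis unfolding k power_Suc by (metis distrib_right mult.assoc)
    qed
    ultimately show ?thesis by simp
  qed
qed

lemma conj_span_poly:
  fixes p :: "real poly"
  assumes "degree p \<le> m"
  shows "conj_span m (\<lambda>t. of_real (poly p t))"
proof -
  have z: "conj_span m (\<lambda>t. 0)" unfolding conj_span_def by (intro exI[of _ "\<lambda>_. 0"]) simp
  have "conj_span m (\<lambda>t. \<Sum>k\<in>S. of_real (coeff p k) * of_real t ^ k)" if "S \<subseteq> {..m}" for S
    using finite_subset[OF that finite_atMost] that
    by (induction S rule: finite_induct) (auto intro!: z conj_span_add conj_span_scale conj_span_power)
  from this[of "{..m}"] show ?thesis using assms by (simp add: poly_sum_le)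
qed

text \<open>These are the normalised eigenvalues of the averaging operator at frequency
  \<open>2 j\<close>. Consecutive ones differ by the factor \<open>(N - j) / (N + j + 1)\<close>,
  which tends to 1.\<close>

lemma binomial_ratio_tendsto:
  "(\<lambda>N. real ((2 * N) choose (N + j)) / real ((2 * N) choose N)) \<longlonglongrightarrow> 1"
proof (induction j)
  case 0
  have "real ((2 * N) choose N) \<noteq> 0" for N by simp
  then show ?case by simp
next
  case (Suc j)
  have "(\<lambda>N. (real N - real j) / (real N + real j + 1)) \<longlonglongrightarrow> 1"
  proof -
    have "(\<lambda>N. 1 - (2 * real j + 1) / (real (j + 1) + real N)) \<longlonglongrightarrow> 1 - 0"
      by (intro tendsto_diff tendsto_const tendsto_divide_0[OF tendsto_const]
        filterlim_at_top_imp_at_infinity filterlim_tendsto_add_at_top[OF tendsto_const] filterlim_real_sequentially)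
    moreover have "1 - (2 * real j + 1) / (real (j + 1) + real N) = (real N - real j) / (real N + real j + 1)" for N
      by (simp add: field_simps)
    ultimately show ?thesis by simp
  qed
  from tendsto_mult[OF this Suc]
  have "(\<lambda>N. (real N - real j) / (real N + real j + 1) *
      (real ((2 * N) choose (N + j)) / real ((2 * N) choose N))) \<longlonglongrightarrow> 1" by simp
  moreover have "eventually (\<lambda>N. (real N - real j) / (real N + real j + 1) *
      (real ((2 * N) choose (N + j)) / real ((2 * N) choose N))
      = real ((2 * N) choose (N + Suc j)) / real ((2 * N) choose N)) sequentially"
    using eventually_ge_at_top[of "Suc j"]
  proof eventually_elim
    case (elim N)
    have p: "real N + real j + 1 \<noteq> 0" by linarith
    have aux: "p \<noteq> 0 \<Longrightarrow> p * Z = a * X \<Longrightarrow> a / p * X = Z" for p Z a X :: real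
      by (simp add: field_simps)
    have "Suc (N + j) * ((2 * N) choose Suc (N + j)) = (2 * N - (N + j)) * ((2 * N) choose (N + j))"
      by (simp only: binomial_absorption binomial_absorb_comp)
    then have "real (Suc (N + j)) * real ((2 * N) choose Suc (N + j)) = real (2 * N - (N + j)) * real ((2 * N) choose (N + j))"
      by (metis of_nat_mult)
    moreover have "real (2 * N - (N + j)) = real N - real j" using elim by simp
    ultimately have "(real N + real j + 1) * real ((2 * N) choose (N + Suc j)) = (real N - real j) * real ((2 * N) choose (N + j))"
      by (simp add: algebra_simps)
    then have "(real N - real j) / (real N + real j + 1) * real ((2 * N) choose (N + j)) = real ((2 * N) choose (N + Suc j))"
      using p aux by blast
    then show ?case by (simp only: times_divide_eq_right)
  qed
  ultimately show ?case by (rule Lim_transform_eventually)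
qed

text \<open>A \<open>J\<close>-th root of unity other than 1 has vanishing geometric sum, and
  \<open>|q| < J\<close> excludes the value 1 for nonzero \<open>q\<close>.\<close>

lemma sum_cis_roots:
  assumes J: "\<bar>q\<bar> < int J"
  shows "(\<Sum>j<J. cis (2 * pi * real j / real J * of_int q)) = (if q = 0 then of_nat J else 0)"
proof (cases "q = 0")
  case False
  have J0: "0 < J" using J by linarith
  define w where "w = cis (2 * pi * of_int q / real J)"
  have wj: "cis (2 * pi * real j / real J * of_int q) = w ^ j" for j
    by (simp add: w_def Complex.DeMoivre mult_ac)
  have "w ^ J = cis (2 * pi * of_int q)" using J0 by (simp add: w_def Complex.DeMoivre)
  then have wJ: "w ^ J = 1" by (simp add: cis_multiple_2pi)
  have "w \<noteq> 1"
  proof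
    define x where "x = pi * of_int q / real J"
    assume "w = 1"
    then have "cos (2 * x) = 1" by (simp add: w_def x_def complex_eq_iff mult.assoc)
    then have s: "sin x = 0" by (simp add: cos_double_sin)
    have ax: "0 < \<bar>x\<bar>" "\<bar>x\<bar> < pi"
    proof -
      show "0 < \<bar>x\<bar>" using False J0 by (simp add: x_def)
      have "real_of_int \<bar>q\<bar> < real J" using J by linarith
      then show "\<bar>x\<bar> < pi" using J0 by (simp add: x_def abs_mult divide_simps)
    qed
    then have "0 < sin \<bar>x\<bar>" by (intro sin_gt_zero)
    then show False using s by (cases "0 \<le> x") simp_all
  qed
  then have "(\<Sum>j<J. w ^ j) = 0" using wJ by (simp add: geometric_sum)
  then show ?thesis using False unfolding wj by simp
qed simp


lemma power_le_one_plus_square: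
  fixes r :: real
  assumes "k \<le> 2 * e"
  shows "\<bar>r\<bar> ^ k \<le> (1 + r\<^sup>2) ^ e"
proof -
  have "\<bar>r\<bar> ^ k \<le> (max 1 \<bar>r\<bar>) ^ k" by (intro power_mono) auto
  also have "\<dots> \<le> (max 1 \<bar>r\<bar>) ^ (2 * e)" using assms by (intro power_increasing) auto
  also have "\<dots> = ((max 1 \<bar>r\<bar>)\<^sup>2) ^ e" by (simp add: power_mult)
  also have "\<dots> \<le> (1 + r\<^sup>2) ^ e" by (intro power_mono) (auto simp: max_def)
  finally show ?thesis .
qed

text \<open>Binomial expansion of
  \<open>(1 + i t) exp(- i \<phi>) + (1 - i t) exp(i \<phi>)\<close>.\<close>

lemma cis_kernel_expand:
  "complex_of_real (2 * cos \<phi> + 2 * t * sin \<phi>) ^ (2 * N)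
     = (\<Sum>m\<le>2 * N. of_nat ((2 * N) choose m) * Complex 1 t ^ m * Complex 1 (- t) ^ (2 * N - m) * cis (2 * \<phi> * (real N - real m)))"
proof -
  have "complex_of_real (2 * cos \<phi> + 2 * t * sin \<phi>) = Complex 1 t * cis (- \<phi>) + Complex 1 (- t) * cis \<phi>"
    by (simp add: complex_eq_iff)
  then have "complex_of_real (2 * cos \<phi> + 2 * t * sin \<phi>) ^ (2 * N)
      = (\<Sum>m\<le>2 * N. of_nat ((2 * N) choose m) * (Complex 1 t * cis (- \<phi>)) ^ m * (Complex 1 (- t) * cis \<phi>) ^ (2 * N - m))"
    by (simp add: binomial_ring)
  also have "\<dots> = (\<Sum>m\<le>2 * N. of_nat ((2 * N) choose m) * Complex 1 t ^ m * Complex 1 (- t) ^ (2 * N - m) * cis (2 * \<phi> * (real N - real m)))"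
  proof (intro sum.cong refl)
    fix m assume m: "m \<in> {..2 * N}"
    have "cis (- \<phi>) ^ m * cis \<phi> ^ (2 * N - m) = cis (2 * \<phi> * (real N - real m))"
      using m by (simp add: Complex.DeMoivre cis_mult of_nat_diff algebra_simps)
    then show "of_nat ((2 * N) choose m) * (Complex 1 t * cis (- \<phi>)) ^ m * (Complex 1 (- t) * cis \<phi>) ^ (2 * N - m)
      = of_nat ((2 * N) choose m) * Complex 1 t ^ m * Complex 1 (- t) ^ (2 * N - m) * cis (2 * \<phi> * (real N - real m))"
      by (simp add: power_mult_distrib mult_ac)
  qed
  finally show ?thesis .
qed

text \<open>The kernel \<open>(cos \<phi> + t sin \<phi>)\<^sup>2\<^sup>N\<close> acts diagonally on the basis
  \<open>(1 + \<i>t)\<^sup>l (1 - \<i>t)\<^bsup>2n-l\<^esup>\<close>, and on trigonometric polynomials the average over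
  equally spaced angles is an exact quadrature.\<close>
lemma kernel_quadrature:
  assumes n: "n \<le> N" and l: "l \<le> 2 * n" and J: "N + n < J"
  shows "(\<Sum>j<J. complex_of_real (2 * cos (pi * real j / real J) + 2 * t * sin (pi * real j / real J)) ^ (2 * N)
            * cis (2 * (pi * real j / real J) * (real l - real n)))
     = of_nat J * of_nat ((2 * N) choose (N - n + l)) * of_real ((1 + t\<^sup>2) ^ (N - n)) * (Complex 1 t ^ l * Complex 1 (- t) ^ (2 * n - l))"
proof -
  define a where "a = (\<lambda>m. of_nat ((2 * N) choose m) * Complex 1 t ^ m * Complex 1 (- t) ^ (2 * N - m))"
  define m0 where "m0 = N - n + l"
  have m0: "m0 \<le> 2 * N" using n l by (simp add: m0_def)
  have "(\<Sum>j<J. complex_of_real (2 * cos (pi * real j / real J) + 2 * t * sin (pi * real j / real J)) ^ (2 * N)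
            * cis (2 * (pi * real j / real J) * (real l - real n)))
     = (\<Sum>j<J. \<Sum>m\<le>2 * N. a m * (cis (2 * (pi * real j / real J) * (real N - real m)) * cis (2 * (pi * real j / real J) * (real l - real n))))"
    unfolding cis_kernel_expand a_def sum_distrib_right by (simp only: mult.assoc)
  also have "\<dots> = (\<Sum>m\<le>2 * N. \<Sum>j<J. a m * (cis (2 * (pi * real j / real J) * (real N - real m)) * cis (2 * (pi * real j / real J) * (real l - real n))))"
    by (rule sum.swap)
  also have "\<dots> = (\<Sum>m\<le>2 * N. a m * (\<Sum>j<J. cis (2 * pi * real j / real J * of_int (int N - int m + int l - int n))))"
  proof -
    have "cis (2 * (pi * real j / real J) * (real N - real m)) * cis (2 * (pi * real j / real J) * (real l - real n))
      = cis (2 * pi * real j / real J * of_int (int N - int m + int l - int n))" for j m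
      unfolding cis_mult by (rule arg_cong[of _ _ cis]) (simp add: algebra_simps add_divide_distrib diff_divide_distrib)
    then show ?thesis by (simp only: sum_distrib_left)
  qed
  also have "\<dots> = (\<Sum>m\<le>2 * N. a m * (if m = m0 then of_nat J else 0))"
  proof (intro sum.cong refl)
    fix m assume m: "m \<in> {..2 * N}"
    have e: "int N - int m + int l - int n = 0 \<longleftrightarrow> m = m0" using n by (auto simp: m0_def)
    \<comment> \<open>The integer \<open>q\<close> is at most \<open>N + n < J\<close> in absolute
      value, so no other frequency is aliased onto 0.\<close>
    have "\<bar>int N - int m + int l - int n\<bar> < int J" using m l n J by auto
    from sum_cis_roots[OF this] show "a m * (\<Sum>j<J. cis (2 * pi * real j / real J * of_int (int N - int m + int l - int n)))
      = a m * (if m = m0 then of_nat J else 0)" unfolding e by simp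
  qed
  also have "\<dots> = a m0 * of_nat J" using m0 by (simp add: if_distrib cong: if_cong)
  also have "a m0 = of_nat ((2 * N) choose m0) * ((Complex 1 t * Complex 1 (- t)) ^ (N - n) * (Complex 1 t ^ l * Complex 1 (- t) ^ (2 * n - l)))"
  proof -
    have e: "2 * N - m0 = N - n + (2 * n - l)" using n l by (simp add: m0_def)
    show ?thesis unfolding a_def e by (simp add: m0_def power_add power_mult_distrib mult_ac)
  qed
  also have "Complex 1 t * Complex 1 (- t) = of_real (1 + t\<^sup>2)" by (simp add: complex_eq_iff power2_eq_square)
  finally show ?thesis by (simp add: m0_def mult_ac)
qed


text \<open>Putting \<open>t = tan \<phi>\<close> and multiplying by \<open>cos^(2 n) \<phi>\<close>
  turns \<open>f\<close> into a trigonometric polynomial, while \<open>(1 + t^2)^n\<close> becomes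
  1. A growth bound in \<open>t\<close> thus becomes uniform in \<open>\<phi>\<close>.\<close>

lemma homogeneous_nonneg:
  fixes c :: "nat \<Rightarrow> nat \<Rightarrow> complex"
  assumes c: "\<And>t r. of_real (f t r) = (\<Sum>k\<le>d. \<Sum>l\<le>2 * n. c k l * (Complex 1 t ^ l * Complex 1 (- t) ^ (2 * n - l)) * of_real r ^ k)"
    and f: "\<And>t r. C * (1 + t\<^sup>2) ^ n * g r \<le> f t r" and x: "cos \<phi> \<noteq> 0"
  shows "C * g r \<le> Re (\<Sum>k\<le>d. \<Sum>l\<le>2 * n. c k l * cis (2 * \<phi> * (real l - real n)) * of_real r ^ k)"
proof -
  define t where "t = tan \<phi>"
  have z: "of_real (cos \<phi>) * Complex 1 t = cis \<phi>" "of_real (cos \<phi>) * Complex 1 (- t) = cis (- \<phi>)"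
    using x by (simp_all add: complex_eq_iff t_def tan_def)
  have t: "(cos \<phi>) ^ (2 * n) * (1 + t\<^sup>2) ^ n = 1"
  proof -
    have "(cos \<phi>)\<^sup>2 * (1 + t\<^sup>2) = 1"
      using x sin_cos_squared_add[of \<phi>] by (simp add: t_def tan_def power_divide distrib_left)
    then show ?thesis by (simp add: power_mult flip: power_mult_distrib)
  qed
  have "of_real ((cos \<phi>) ^ (2 * n) * f t r) = (\<Sum>k\<le>d. \<Sum>l\<le>2 * n. c k l * cis (2 * \<phi> * (real l - real n)) * of_real r ^ k)"
    unfolding of_real_mult c sum_distrib_left
  proof (intro sum.cong refl)
    fix k l assume l: "l \<in> {..2 * n}"
    have "of_real ((cos \<phi>) ^ (2 * n)) = complex_of_real (cos \<phi>) ^ l * complex_of_real (cos \<phi>) ^ (2 * n - l)"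
      using l by (simp flip: power_add)
    then have "of_real ((cos \<phi>) ^ (2 * n)) * (Complex 1 t ^ l * Complex 1 (- t) ^ (2 * n - l))
        = (of_real (cos \<phi>) * Complex 1 t) ^ l * (of_real (cos \<phi>) * Complex 1 (- t)) ^ (2 * n - l)"
      by (simp add: power_mult_distrib mult_ac)
    also have "\<dots> = cis (2 * \<phi> * (real l - real n))"
      using l unfolding z Complex.DeMoivre cis_mult
      by (intro arg_cong[of _ _ cis]) (simp add: of_nat_diff algebra_simps)
    finally show "of_real ((cos \<phi>) ^ (2 * n)) * (c k l * (Complex 1 t ^ l * Complex 1 (- t) ^ (2 * n - l)) * of_real r ^ k)
      = c k l * cis (2 * \<phi> * (real l - real n)) * of_real r ^ k" by (simp add: mult_ac)
  qed
  then have "Re (\<Sum>k\<le>d. \<Sum>l\<le>2 * n. c k l * cis (2 * \<phi> * (real l - real n)) * of_real r ^ k) = (cos \<phi>) ^ (2 * n) * f t r"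
    by (metis Re_complex_of_real)
  moreover have "(cos \<phi>) ^ (2 * n) * (C * (1 + t\<^sup>2) ^ n * g r) \<le> (cos \<phi>) ^ (2 * n) * f t r"
    using f by (intro mult_left_mono) auto
  moreover have "(cos \<phi>) ^ (2 * n) * (C * (1 + t\<^sup>2) ^ n * g r) = C * g r"
    using t by (metis mult.assoc mult.commute mult_1)
  ultimately show ?thesis by simp
qed

text \<open>Dividing the Fourier coefficients of \<open>B\<close> by the eigenvalues gives a
  preimage under averaging. For large \<open>N\<close> its values at the nodes differ from those of
  \<open>B\<close> by less than the lower bound. They are then nonnegative polynomials in
  \<open>r\<close> alone, and averaging multiplies them by even powers.\<close>

lemma strictly_positive_sos:
  fixes B :: "real poly poly"
  assumes dB: "degree B \<le> 2 * e" and dc: "\<And>k. degree (coeff B k) \<le> 2 * n" and C: "0 < C"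
    and pos: "\<And>t r. C * (1 + t\<^sup>2) ^ n * (1 + r\<^sup>2) ^ e \<le> poly2 B t r"
  shows "\<exists>N. one_plus_sq ^ N * B \<in> sos UNIV"
proof -
  define w where "w = (\<lambda>t l. Complex 1 t ^ l * Complex 1 (- t) ^ (2 * n - l))"
  have "\<forall>k. \<exists>c. \<forall>t. of_real (poly (coeff B k) t) = (\<Sum>l\<le>2 * n. c l * w t l)"
    using conj_span_poly[OF dc] unfolding conj_span_def w_def by (auto simp: mult.assoc)
  then obtain c where c: "\<And>k t. of_real (poly (coeff B k) t) = (\<Sum>l\<le>2 * n. c k l * w t l)" by metis
  have Bc: "of_real (poly2 B t r) = (\<Sum>k\<le>2 * e. \<Sum>l\<le>2 * n. c k l * w t l * of_real r ^ k)" for t r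
    by (simp add: poly2_sum_coeffs[OF dB] c sum_distrib_right)
  \<comment> \<open>Distance of \<open>l\<close> from the middle index; by symmetry the binomial
    coefficient at \<open>N - n + l\<close> is the one at \<open>N + \<kappa> l\<close>.\<close>
  define \<kappa> where "\<kappa> = (\<lambda>l. if l \<le> n then n - l else l - n)"
  define \<mu> where "\<mu> = (\<lambda>N l. real ((2 * N) choose (N + \<kappa> l)) / real ((2 * N) choose N))"
  have \<mu>1: "(\<lambda>N. \<mu> N l) \<longlonglongrightarrow> 1" for l unfolding \<mu>_def by (rule binomial_ratio_tendsto)
  \<comment> \<open>Bounds, relative to \<open>(1 + r^2)^e\<close>, the effect of replacing
    \<open>c\<close> by \<open>c / \<mu>\<close>.\<close>
  define M where "M = (\<lambda>N. \<Sum>k\<le>2 * e. \<Sum>l\<le>2 * n. norm (c k l) * \<bar>inverse (\<mu> N l) - 1\<bar>)"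
  have "M \<longlonglongrightarrow> (\<Sum>k\<le>2 * e. \<Sum>l\<le>2 * n. norm (c k l) * \<bar>inverse 1 - 1\<bar>)"
    unfolding M_def by (intro tendsto_intros \<mu>1) simp
  then have "M \<longlonglongrightarrow> 0" by simp
  then have "eventually (\<lambda>N. M N < C) sequentially" using C by (rule order_tendstoD)
  with eventually_ge_at_top[of n] have "eventually (\<lambda>N. n \<le> N \<and> M N < C) sequentially"
    by eventually_elim auto
  then obtain N where N: "n \<le> N" "M N < C" by (auto simp: eventually_sequentially)
  \<comment> \<open>Beyond \<open>N + n\<close> for exact quadrature, and odd so that no node is
    \<open>pi / 2\<close>, the pole of \<open>tan\<close>.\<close>
  define J where "J = 2 * (N + n) + 1"
  define \<phi> where "\<phi> = (\<lambda>j. pi * real j / real J)"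
  define b where "b = (\<lambda>k l. c k l / of_real (\<mu> N l))"
  define G where "G = (\<lambda>j. \<Sum>k\<le>2 * e. monom (Re (\<Sum>l\<le>2 * n. b k l * cis (2 * \<phi> j * (real l - real n)))) k)"
  have \<mu>0: "\<mu> N l \<noteq> 0" if "l \<le> 2 * n" for l
    using N that by (auto simp: \<mu>_def \<kappa>_def)
  have \<mu>c: "\<mu> N l * real ((2 * N) choose N) = real ((2 * N) choose (N - n + l))" if "l \<le> 2 * n" for l
  proof -
    have "(2 * N) choose (N - n + l) = (2 * N) choose (N + \<kappa> l)"
    proof (cases "l \<le> n")
      case True
      then have "(2 * N) choose (N + \<kappa> l) = (2 * N) choose (2 * N - (N + \<kappa> l))"
        using N by (intro binomial_symmetric) (simp add: \<kappa>_def)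
      moreover have "2 * N - (N + \<kappa> l) = N - n + l" using True N by (simp add: \<kappa>_def)
      ultimately show ?thesis by simp
    next
      case False
      then have "N - n + l = N + \<kappa> l" using N by (simp add: \<kappa>_def)
      then show ?thesis by simp
    qed
    then show ?thesis by (simp add: \<mu>_def)
  qed
  have polyG: "poly (G j) r = Re (\<Sum>k\<le>2 * e. \<Sum>l\<le>2 * n. b k l * cis (2 * \<phi> j * (real l - real n)) * of_real r ^ k)" for j r
    by (simp add: G_def poly_sum poly_monom Re_sum flip: sum_distrib_right of_real_power)
  have cos0: "cos (\<phi> j) \<noteq> 0" if "j < J" for j
  proof
    assume "cos (\<phi> j) = 0"
    then obtain i :: int where "odd i" "\<phi> j = of_int i * (pi / 2)"
      unfolding cos_zero_iff_int by blast
    then have "pi * (2 * real j) = pi * (real_of_int i * real J)" by (simp add: \<phi>_def J_def field_simps)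
    then have "2 * real j = real_of_int i * real J" by (simp only: mult_cancel_left pi_neq_zero simp_thms)
    then have "2 * int j = i * int J" by (metis of_int_eq_iff of_int_mult of_int_of_nat_eq of_int_numeral)
    then have "even (i * int J)" by (metis dvd_triv_left)
    then show False using \<open>odd i\<close> by (simp add: J_def)
  qed
  have Gpos: "0 \<le> poly (G j) r" if j: "j < J" for j r
  proof -
    define z where "z = (\<lambda>l. cis (2 * \<phi> j * (real l - real n)))"
    have "C * (1 + r\<^sup>2) ^ e \<le> Re (\<Sum>k\<le>2 * e. \<Sum>l\<le>2 * n. c k l * z l * of_real r ^ k)"
      unfolding z_def using homogeneous_nonneg[OF Bc[unfolded w_def] pos cos0[OF j]] .
    moreover have "\<bar>Re (\<Sum>k\<le>2 * e. \<Sum>l\<le>2 * n. b k l * z l * of_real r ^ k) - Re (\<Sum>k\<le>2 * e. \<Sum>l\<le>2 * n. c k l * z l * of_real r ^ k)\<bar>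
        \<le> M N * (1 + r\<^sup>2) ^ e"
    proof -
      have "\<bar>Re (\<Sum>k\<le>2 * e. \<Sum>l\<le>2 * n. b k l * z l * of_real r ^ k) - Re (\<Sum>k\<le>2 * e. \<Sum>l\<le>2 * n. c k l * z l * of_real r ^ k)\<bar>
         \<le> norm (\<Sum>k\<le>2 * e. \<Sum>l\<le>2 * n. (b k l - c k l) * z l * of_real r ^ k)"
        unfolding minus_complex.sel[symmetric] sum_subtractf[symmetric] left_diff_distrib[symmetric] by (rule abs_Re_le_cmod)
      also have "\<dots> \<le> (\<Sum>k\<le>2 * e. \<Sum>l\<le>2 * n. norm ((b k l - c k l) * z l * of_real r ^ k))"
        by (intro order_trans[OF norm_sum] sum_mono norm_sum)
      also have "\<dots> \<le> (\<Sum>k\<le>2 * e. \<Sum>l\<le>2 * n. norm (c k l) * \<bar>inverse (\<mu> N l) - 1\<bar> * (1 + r\<^sup>2) ^ e)"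
      proof (intro sum_mono)
        fix k l assume kl: "k \<in> {..2 * e}" "l \<in> {..2 * n}"
        have "b k l - c k l = c k l * of_real (inverse (\<mu> N l) - 1)"
          by (simp add: b_def field_simps)
        then have "norm ((b k l - c k l) * z l * of_real r ^ k) = norm (c k l) * \<bar>inverse (\<mu> N l) - 1\<bar> * \<bar>r\<bar> ^ k"
          by (simp only: norm_mult norm_of_real norm_power) (simp add: z_def)
        also have "\<dots> \<le> norm (c k l) * \<bar>inverse (\<mu> N l) - 1\<bar> * (1 + r\<^sup>2) ^ e"
          using kl by (intro mult_left_mono power_le_one_plus_square) auto
        finally show "norm ((b k l - c k l) * z l * of_real r ^ k) \<le> norm (c k l) * \<bar>inverse (\<mu> N l) - 1\<bar> * (1 + r\<^sup>2) ^ e" .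
      qed
      also have "\<dots> = M N * (1 + r\<^sup>2) ^ e" by (simp add: M_def sum_distrib_right)
      finally show ?thesis .
    qed
    moreover have "M N * (1 + r\<^sup>2) ^ e \<le> C * (1 + r\<^sup>2) ^ e" using N(2) by (intro mult_right_mono) auto
    ultimately show ?thesis unfolding polyG z_def by linarith
  qed
  define K where "K = real J * real ((2 * N) choose N)"
  have K: "0 < K" by (simp add: K_def J_def)
  define L where "L = (\<lambda>j. [:[:2 * cos (\<phi> j), 2 * sin (\<phi> j):]:])"
  have "[:[:K:]:] * (one_plus_sq ^ (N - n) * B) = (\<Sum>j<J. L j ^ (2 * N) * map_poly (\<lambda>x. [:x:]) (G j))"
  proof (rule poly2_eqI)
    fix t r
    define p where "p = (\<lambda>j. 2 * cos (\<phi> j) + 2 * t * sin (\<phi> j))"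
    have "(\<Sum>j<J. p j ^ (2 * N) * poly (G j) r)
       = Re (\<Sum>j<J. of_real (p j) ^ (2 * N) * (\<Sum>k\<le>2 * e. \<Sum>l\<le>2 * n. b k l * cis (2 * \<phi> j * (real l - real n)) * of_real r ^ k))"
      by (simp add: polyG flip: of_real_power)
    also have "(\<Sum>j<J. of_real (p j) ^ (2 * N) * (\<Sum>k\<le>2 * e. \<Sum>l\<le>2 * n. b k l * cis (2 * \<phi> j * (real l - real n)) * of_real r ^ k))
       = (\<Sum>j<J. \<Sum>k\<le>2 * e. \<Sum>l\<le>2 * n. b k l * of_real r ^ k * (of_real (p j) ^ (2 * N) * cis (2 * \<phi> j * (real l - real n))))"
      by (simp only: sum_distrib_left mult_ac)
    also have "\<dots> = (\<Sum>k\<le>2 * e. \<Sum>j<J. \<Sum>l\<le>2 * n. b k l * of_real r ^ k * (of_real (p j) ^ (2 * N) * cis (2 * \<phi> j * (real l - real n))))"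
      by (rule sum.swap)
    also have "\<dots> = (\<Sum>k\<le>2 * e. \<Sum>l\<le>2 * n. b k l * of_real r ^ k * (\<Sum>j<J. of_real (p j) ^ (2 * N) * cis (2 * \<phi> j * (real l - real n))))"
      unfolding sum_distrib_left by (intro sum.cong refl sum.swap)
    also have "\<dots> = (\<Sum>k\<le>2 * e. \<Sum>l\<le>2 * n. of_real (K * (1 + t\<^sup>2) ^ (N - n)) * (c k l * w t l * of_real r ^ k))"
    proof (intro sum.cong refl)
      fix k l assume kl: "l \<in> {..2 * n}"
      have "(\<Sum>j<J. of_real (p j) ^ (2 * N) * cis (2 * \<phi> j * (real l - real n)))
         = of_nat J * of_nat ((2 * N) choose (N - n + l)) * of_real ((1 + t\<^sup>2) ^ (N - n)) * w t l"
        unfolding p_def \<phi>_def w_def using kl N by (intro kernel_quadrature) (auto simp: J_def)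
      also have "complex_of_nat ((2 * N) choose (N - n + l)) = of_real (\<mu> N l * real ((2 * N) choose N))"
        using kl by (subst \<mu>c) auto
      finally show "b k l * of_real r ^ k * (\<Sum>j<J. of_real (p j) ^ (2 * N) * cis (2 * \<phi> j * (real l - real n)))
         = of_real (K * (1 + t\<^sup>2) ^ (N - n)) * (c k l * w t l * of_real r ^ k)"
        using \<mu>0[of l] kl by (simp add: b_def K_def)
    qed
    also have "\<dots> = of_real (K * (1 + t\<^sup>2) ^ (N - n) * poly2 B t r)"
      by (simp only: of_real_mult Bc sum_distrib_left)
    finally have "(\<Sum>j<J. p j ^ (2 * N) * poly (G j) r) = K * (1 + t\<^sup>2) ^ (N - n) * poly2 B t r"
      by simp
    then show "poly2 ([:[:K:]:] * (one_plus_sq ^ (N - n) * B)) t r = poly2 (\<Sum>j<J. L j ^ (2 * N) * map_poly (\<lambda>x. [:x:]) (G j)) t r"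
      by (simp add: poly2_map_const L_def p_def mult.assoc mult.left_commute)
  qed
  also have "\<dots> \<in> sos UNIV"
  proof (intro sos_sum sos_mult_UNIV sos_even_power)
    fix j assume "j \<in> {..<J}"
    then have "G j \<in> sos UNIV" using Gpos by (intro univariate_psd_sos) auto
    from sos_map[OF rhom.map_poly_rhom[OF const_poly_rhom] this]
    show "map_poly (\<lambda>x. [:x:]) (G j) \<in> sos UNIV" using sos_mono by blast
  qed simp
  finally have s: "[:[:K:]:] * (one_plus_sq ^ (N - n) * B) \<in> sos UNIV" .
  have "[:[:1 / K:]:] * ([:[:K:]:] * (one_plus_sq ^ (N - n) * B)) \<in> sos UNIV"
    using K by (intro sos_mult_UNIV[OF nonneg_const_sos s]) simp
  also have "[:[:1 / K:]:] * ([:[:K:]:] * (one_plus_sq ^ (N - n) * B)) = one_plus_sq ^ (N - n) * B"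
    using K by (intro poly2_eqI) simp
  finally show ?thesis by blast
qed

section \<open>Removing isolated real zeros\<close>

text \<open>In \<open>poly2 f t r\<close> the outer variable is \<open>r\<close> and the inner one is \<open>t\<close>.\<close>
definition tdeg_le :: "real poly poly \<Rightarrow> nat \<Rightarrow> bool" where
  "tdeg_le X m \<longleftrightarrow> (\<forall>k. degree (coeff X k) \<le> m)"

lemma tdeg_le_mono: "tdeg_le X m \<Longrightarrow> m \<le> n \<Longrightarrow> tdeg_le X n"
  unfolding tdeg_le_def using le_trans by blast

lemma tdeg_le_add: "tdeg_le X m \<Longrightarrow> tdeg_le Y m \<Longrightarrow> tdeg_le (X + Y) m"
  by (auto simp: tdeg_le_def intro: degree_add_le)

lemma tdeg_le_diff: "tdeg_le X m \<Longrightarrow> tdeg_le Y m \<Longrightarrow> tdeg_le (X - Y) m"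
  by (auto simp: tdeg_le_def intro: degree_diff_le)

lemma tdeg_le_mult:
  assumes "tdeg_le X m" "tdeg_le Y n"
  shows "tdeg_le (X * Y) (m + n)"
  unfolding tdeg_le_def coeff_mult
proof (intro allI degree_sum_le)
  fix k i
  have "degree (coeff X i * coeff Y (k - i)) \<le> degree (coeff X i) + degree (coeff Y (k - i))"
    by (rule degree_mult_le)
  also have "\<dots> \<le> m + n" using assms by (intro add_mono) (auto simp: tdeg_le_def)
  finally show "degree (coeff X i * coeff Y (k - i)) \<le> m + n" .
qed simp

lemma tdeg_le_smult: "degree p \<le> m \<Longrightarrow> tdeg_le Y n \<Longrightarrow> tdeg_le (smult p Y) (m + n)"
  unfolding tdeg_le_def by (auto intro: order_trans[OF degree_mult_le] add_mono)

lemma tdeg_le_ex: "\<exists>m. tdeg_le X m"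
proof -
  have "degree (coeff X k) \<le> (\<Sum>i\<le>degree X. degree (coeff X i))" for k
    by (cases "k \<le> degree X") (auto intro: member_le_sum simp: coeff_eq_0)
  then show ?thesis by (auto simp: tdeg_le_def)
qed

lemma tdeg_le_list_ex: "\<exists>m. \<forall>g\<in>set gs. tdeg_le g m"
proof (induction gs)
  case (Cons g gs)
  then obtain m1 where "\<forall>g\<in>set gs. tdeg_le g m1" by blast
  moreover obtain m2 where "tdeg_le g m2" using tdeg_le_ex by blast
  ultimately show ?case by (intro exI[of _ "max m1 m2"]) (auto intro: tdeg_le_mono)
qed simp

lemma poly_bound:
  fixes p :: "real poly"
  assumes "degree p \<le> 2 * m"
  shows "\<bar>poly p t\<bar> \<le> (\<Sum>i\<le>2 * m. \<bar>coeff p i\<bar>) * (1 + t\<^sup>2) ^ m"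
proof -
  have "\<bar>poly p t\<bar> \<le> (\<Sum>i\<le>2 * m. \<bar>coeff p i\<bar> * \<bar>t\<bar> ^ i)"
    unfolding poly_sum_le[OF assms] by (rule order_trans[OF sum_abs]) (simp add: abs_mult power_abs)
  also have "\<dots> \<le> (\<Sum>i\<le>2 * m. \<bar>coeff p i\<bar> * (1 + t\<^sup>2) ^ m)"
    by (intro sum_mono mult_left_mono power_le_one_plus_square) auto
  finally show ?thesis by (simp add: sum_distrib_right)
qed

lemma poly2_bound:
  assumes d: "degree X \<le> 2 * e" and td: "tdeg_le X (2 * m)"
  shows "\<exists>C>0. \<forall>t r. \<bar>poly2 X t r\<bar> \<le> C * (1 + t\<^sup>2) ^ m * (1 + r\<^sup>2) ^ e"
proof -
  define C where "C = (\<Sum>k\<le>2 * e. \<Sum>i\<le>2 * m. \<bar>coeff (coeff X k) i\<bar>)"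
  have b: "\<bar>poly2 X t r\<bar> \<le> C * (1 + t\<^sup>2) ^ m * (1 + r\<^sup>2) ^ e" for t r
  proof -
    have "\<bar>poly2 X t r\<bar> \<le> (\<Sum>k\<le>2 * e. \<bar>poly (coeff X k) t\<bar> * \<bar>r\<bar> ^ k)"
      unfolding poly2_sum_coeffs[OF d] by (rule order_trans[OF sum_abs]) (simp add: abs_mult power_abs)
    also have "\<dots> \<le> (\<Sum>k\<le>2 * e. ((\<Sum>i\<le>2 * m. \<bar>coeff (coeff X k) i\<bar>) * (1 + t\<^sup>2) ^ m) * (1 + r\<^sup>2) ^ e)"
      using td by (intro sum_mono mult_mono power_le_one_plus_square poly_bound)
        (auto simp: tdeg_le_def intro!: mult_nonneg_nonneg sum_nonneg)
    also have "\<dots> = C * (1 + t\<^sup>2) ^ m * (1 + r\<^sup>2) ^ e" by (simp add: C_def sum_distrib_right)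
    finally show ?thesis .
  qed
  have "\<bar>poly2 X t r\<bar> \<le> (C + 1) * (1 + t\<^sup>2) ^ m * (1 + r\<^sup>2) ^ e" for t r
    by (rule order_trans[OF b]) (intro mult_right_mono; simp)
  moreover have "0 \<le> C" unfolding C_def by (intro sum_nonneg) auto
  ultimately show ?thesis by (intro exI[of _ "C + 1"]) auto
qed

lemma poly2_bound_compact:
  assumes d: "degree X \<le> 2 * e"
  shows "\<exists>C>0. \<forall>t r. \<bar>t\<bar> \<le> R \<longrightarrow> \<bar>poly2 X t r\<bar> \<le> C * (1 + r\<^sup>2) ^ e"
proof -
  obtain m where "tdeg_le X m" using tdeg_le_ex by blast
  then have "tdeg_le X (2 * m)" by (rule tdeg_le_mono) simp
  from poly2_bound[OF d this] obtain C where C: "0 < C"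
    "\<And>t r. \<bar>poly2 X t r\<bar> \<le> C * (1 + t\<^sup>2) ^ m * (1 + r\<^sup>2) ^ e" by blast
  have "\<bar>poly2 X t r\<bar> \<le> C * (1 + R\<^sup>2) ^ m * (1 + r\<^sup>2) ^ e" if "\<bar>t\<bar> \<le> R" for t r
  proof -
    have "t\<^sup>2 \<le> R\<^sup>2" using that abs_le_square_iff[of t R] by simp
    then have "C * (1 + t\<^sup>2) ^ m * (1 + r\<^sup>2) ^ e \<le> C * (1 + R\<^sup>2) ^ m * (1 + r\<^sup>2) ^ e"
      using C(1) by (intro mult_right_mono mult_left_mono power_mono) auto
    with C(2) show ?thesis by (rule order_trans)
  qed
  moreover have "0 < C * (1 + R\<^sup>2) ^ m" using C(1) by (intro mult_pos_pos zero_less_power) (auto intro: add_pos_nonneg)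
  ultimately show ?thesis by blast
qed

lemma linear_powers_coprime:
  fixes z z' :: real
  assumes "z \<noteq> z'"
  shows "coprime ([:- z, 1:] ^ K) ([:- z', 1:] ^ L)"
proof -
  have "\<not> [:- z, 1:] dvd [:- z', 1:]" using assms poly_eq_0_iff_dvd[of "[:- z', 1:]" z] by simp
  then have "coprime [:- z, 1:] [:- z', 1:]"
    by (intro prime_elem_imp_coprime) (auto intro!: irreducible_imp_prime_elem irreducible_linear_poly)
  then show ?thesis by (simp add: coprime_power_left_iff coprime_power_right_iff)
qed

lemma prod_powers_dvd:
  fixes p :: "real poly"
  assumes "finite Z" "\<And>z. z \<in> Z \<Longrightarrow> [:- z, 1:] ^ K dvd p"
  shows "(\<Prod>z\<in>Z. [:- z, 1:]) ^ K dvd p"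
  using assms
proof (induction Z rule: finite_induct)
  case (insert a Z)
  have "coprime ([:- a, 1:] ^ K) ((\<Prod>z\<in>Z. [:- z, 1:]) ^ K)"
    unfolding prod_power_distrib using insert.hyps
    by (intro prod_coprime_right linear_powers_coprime) auto
  then have "[:- a, 1:] ^ K * (\<Prod>z\<in>Z. [:- z, 1:]) ^ K dvd p" using insert by (intro divides_mult) auto
  then show ?case using insert.hyps by (simp only: prod.insert power_mult_distrib not_False_eq_True)
qed simp

lemma poly_crt:
  fixes Z :: "real set"
  assumes "finite Z" "z \<in> Z"
  shows "\<exists>p::real poly. [:- z, 1:] ^ K dvd p - 1 \<and> (\<forall>z'\<in>Z - {z}. [:- z', 1:] ^ K dvd p)"
proof -
  define G where "G = (\<Prod>z'\<in>Z - {z}. [:- z', 1:] ^ K)"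
  have "coprime ([:- z, 1:] ^ K) G"
    unfolding G_def by (intro prod_coprime_right linear_powers_coprime) auto
  then obtain a b where ab: "a * [:- z, 1:] ^ K + b * G = 1"
    using bezout_coefficients_fst_snd[of "[:- z, 1:] ^ K" G] by (metis coprime_imp_gcd_eq_1)
  have "b * G - 1 = - a * [:- z, 1:] ^ K" using ab by (simp add: algebra_simps)
  then have "[:- z, 1:] ^ K dvd b * G - 1" by simp
  moreover have "[:- z', 1:] ^ K dvd b * G" if "z' \<in> Z - {z}" for z'
    using that assms unfolding G_def by (intro dvd_mult dvd_prodI) auto
  ultimately show ?thesis by blast
qed

lemma dvd_diff_squares:
  fixes d F A A' B B' :: "'a::comm_ring_1"
  assumes "d dvd F - A'\<^sup>2 - B'\<^sup>2" "d dvd A - A'" "d dvd B - B'"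
  shows "d dvd F - A\<^sup>2 - B\<^sup>2"
proof -
  have eq: "F - A\<^sup>2 - B\<^sup>2 = (F - A'\<^sup>2 - B'\<^sup>2) - (A - A') * (A + A') - (B - B') * (B + B')"
    by (simp add: power2_eq_square algebra_simps)
  show ?thesis unfolding eq by (intro dvd_diff dvd_mult2 assms)
qed

text \<open>Chinese remaindering with multipliers \<open>p z\<close> in \<open>t\<close> alone keeps
  the degree in \<open>r\<close>. Agreement with the local solutions modulo \<open>(t - z)^K\<close>
  carries over to the squares.\<close>

lemma global_two_squares:
  fixes F :: "real poly poly"
  assumes Z: "finite Z" and loc: "\<And>z. z \<in> Z \<Longrightarrow> \<exists>A B. degree A \<le> e \<and> degree B \<le> e \<and> [:[:- z, 1:] ^ K:] dvd F - A\<^sup>2 - B\<^sup>2"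
  shows "\<exists>A B. degree A \<le> e \<and> degree B \<le> e \<and> [:(\<Prod>z\<in>Z. [:- z, 1:]) ^ K:] dvd F - A\<^sup>2 - B\<^sup>2"
proof -
  obtain A B where AB: "\<And>z. z \<in> Z \<Longrightarrow> degree (A z) \<le> e" "\<And>z. z \<in> Z \<Longrightarrow> degree (B z) \<le> e"
    "\<And>z. z \<in> Z \<Longrightarrow> [:[:- z, 1:] ^ K:] dvd F - (A z)\<^sup>2 - (B z)\<^sup>2"
    using loc by metis
  obtain p where p: "\<And>z. z \<in> Z \<Longrightarrow> [:- z, 1:] ^ K dvd p z - 1"
    "\<And>z z'. z \<in> Z \<Longrightarrow> z' \<in> Z \<Longrightarrow> z' \<noteq> z \<Longrightarrow> [:- z', 1:] ^ K dvd p z"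
    using poly_crt[OF Z, of _ K] by (metis DiffI singletonD)
  define comb where "comb = (\<lambda>A :: real \<Rightarrow> real poly poly. \<Sum>z\<in>Z. smult (p z) (A z))"
  have comb: "[:[:- z, 1:] ^ K:] dvd comb A - A z" if z: "z \<in> Z" for z A
  proof -
    have "comb A - A z = smult (p z - 1) (A z) + (\<Sum>z'\<in>Z - {z}. smult (p z') (A z'))"
      unfolding comb_def using Z z by (simp add: sum.remove smult_diff_left)
    moreover have "[:[:- z, 1:] ^ K:] dvd smult (p z - 1) (A z)"
      using p(1)[OF z] by (simp add: const_poly_dvd_iff)
    moreover have "[:[:- z, 1:] ^ K:] dvd (\<Sum>z'\<in>Z - {z}. smult (p z') (A z'))"
      using p(2) z by (intro dvd_sum) (simp add: const_poly_dvd_iff)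
    ultimately show ?thesis by simp
  qed
  have deg: "degree (comb A) \<le> e" if "\<And>z. z \<in> Z \<Longrightarrow> degree (A z) \<le> e" for A
    unfolding comb_def using that Z
    by (intro degree_sum_le) (auto intro: order_trans[OF degree_smult_le])
  have "[:[:- z, 1:] ^ K:] dvd F - (comb A)\<^sup>2 - (comb B)\<^sup>2" if "z \<in> Z" for z
    using AB(3)[OF that] comb[OF that] comb[OF that] by (rule dvd_diff_squares)
  then have "[:(\<Prod>z\<in>Z. [:- z, 1:]) ^ K:] dvd F - (comb A)\<^sup>2 - (comb B)\<^sup>2"
    unfolding const_poly_dvd_iff using Z by (intro allI prod_powers_dvd) auto
  then show ?thesis using deg AB by blast
qed

text \<open>Cauchy-Schwarz for the vectors \<open>(1, z)\<close> and \<open>(t, -1)\<close>, applied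
  to each factor.\<close>

lemma prod_linear_sq_upper:
  fixes t :: real
  assumes "finite Z"
  shows "(poly (\<Prod>z\<in>Z. [:- z, 1:]) t)\<^sup>2 \<le> (\<Prod>z\<in>Z. 1 + z\<^sup>2) * (1 + t\<^sup>2) ^ card Z"
proof -
  have "(poly (\<Prod>z\<in>Z. [:- z, 1:]) t)\<^sup>2 = (\<Prod>z\<in>Z. (t - z)\<^sup>2)"
    by (simp add: poly_prod prod_power_distrib)
  also have "\<dots> \<le> (\<Prod>z\<in>Z. (1 + z\<^sup>2) * (1 + t\<^sup>2))"
  proof (intro prod_mono conjI)
    fix z
    have "(1 + z\<^sup>2) * (1 + t\<^sup>2) - (t - z)\<^sup>2 = (1 + z * t)\<^sup>2" by (simp add: power2_eq_square algebra_simps)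
    then show "(t - z)\<^sup>2 \<le> (1 + z\<^sup>2) * (1 + t\<^sup>2)" by (metis diff_ge_0_iff_ge zero_le_power2)
  qed simp
  finally show ?thesis by (simp add: prod.distrib)
qed

text \<open>For such \<open>t\<close> one has \<open>|t - z| \<ge> |t| / 2\<close>, hence
  \<open>(t - z)^2 \<ge> t^2 / 4 \<ge> (1 + t^2) / 8\<close> because
  \<open>t^2 \<ge> 1\<close>.\<close>

lemma prod_linear_sq_lower:
  fixes t :: real
  assumes Z: "finite Z" and R: "\<And>z. z \<in> Z \<Longrightarrow> \<bar>z\<bar> \<le> R" and t: "2 * R + 1 \<le> \<bar>t\<bar>" "0 \<le> R"
  shows "(1/8) ^ card Z * (1 + t\<^sup>2) ^ card Z \<le> (poly (\<Prod>z\<in>Z. [:- z, 1:]) t)\<^sup>2"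
proof -
  have "(1/8) ^ card Z * (1 + t\<^sup>2) ^ card Z = (\<Prod>z\<in>Z. (1/8) * (1 + t\<^sup>2))"
    by (simp only: prod_constant power_mult_distrib)
  also have "\<dots> \<le> (\<Prod>z\<in>Z. (t - z)\<^sup>2)"
  proof (intro prod_mono conjI)
    fix z assume z: "z \<in> Z"
    have a: "\<bar>t\<bar> / 2 \<le> \<bar>t - z\<bar>" using R[OF z] t by linarith
    have "(t / 2)\<^sup>2 \<le> (t - z)\<^sup>2" using a abs_le_square_iff[of "t / 2" "t - z"] by simp
    moreover have "1\<^sup>2 \<le> t\<^sup>2" using t abs_le_square_iff[of 1 t] by simp
    ultimately show "(1/8) * (1 + t\<^sup>2) \<le> (t - z)\<^sup>2" by (simp add: power_divide)
  qed simp
  also have "\<dots> = (poly (\<Prod>z\<in>Z. [:- z, 1:]) t)\<^sup>2"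
    by (simp add: poly_prod prod_power_distrib)
  finally show ?thesis .
qed


text \<open>Near \<open>Z\<close> the polynomial \<open>f\<close> minus half its lower bound is a sum of two squares \<open>S\<close> up to a
  high power of \<open>h\<close>. Damping \<open>S\<close> by the factor \<open>(\<Psi> / q)\<^bsup>2j\<^esup>\<close>, which is \<open>1\<close> to high order at \<open>Z\<close> and
  tiny elsewhere, keeps \<open>f\<close> minus the damped \<open>S\<close> nonnegative everywhere; it equals \<open>H\<close> times a
  strictly positive polynomial \<open>W\<close>.\<close>
lemma poly2_pos_bound_sos:
  fixes f :: "real poly poly" and Z :: "real set"
  assumes Z: "finite Z" and deg: "degree f = 2 * e" and td: "tdeg_le f (2 * n)"
    and lc: "\<And>z. z \<in> Z \<Longrightarrow> 0 < poly (lead_coeff f) z"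
    and M: "0 < M" "card Z * M \<le> n" and c: "0 < c"
    and h: "h = (\<Prod>z\<in>Z. [:- z, 1:])"
    and bound: "\<And>t r. c * poly h t ^ (2 * M) * (1 + t\<^sup>2) ^ (n - card Z * M) * (1 + r\<^sup>2) ^ e \<le> poly2 f t r"
  shows "\<exists>N. one_plus_sq ^ N * f \<in> sos UNIV"
proof -
  define k where "k = card Z"
  define Q :: "real poly" where "Q = [:1, 0, 1:]"
  define H where "H = h ^ (2 * M)"
  define n1 where "n1 = n - k * M"
  define Rp :: "real poly poly" where "Rp = [:1, 0, 1:] ^ e"
  have Q: "poly Q t = 1 + t\<^sup>2" for t by (simp add: Q_def power2_eq_square)
  have Q1: "1 \<le> poly Q t" and Q0: "0 < poly Q t" for t by (simp_all add: Q add_pos_nonneg)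
  have Rp: "poly2 Rp t r = (1 + r\<^sup>2) ^ e" for t r
    by (simp add: Rp_def poly2_def power2_eq_square)
  have R1: "1 \<le> (1 + r\<^sup>2) ^ e" and R0: "0 < (1 + r\<^sup>2) ^ e" for r :: real
    by (simp_all add: one_le_power add_pos_nonneg)
  have dRp: "degree Rp = 2 * e" by (simp add: Rp_def degree_power_eq)
  have tRp: "tdeg_le Rp 0"
  proof -
    have "tdeg_le ([:1, 0, 1:] ^ i) 0" for i
    proof (induction i)
      case (Suc i)
      have "tdeg_le [:1, 0, 1:] 0"
        by (auto simp: tdeg_le_def coeff_pCons split: nat.splits)
      from tdeg_le_mult[OF this Suc] show ?case by simp
    qed (auto simp: tdeg_le_def coeff_1)
    then show ?thesis by (simp add: Rp_def)
  qed
  have lh: "lead_coeff h = 1" unfolding h by (simp add: lead_coeff_prod)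
  have h0: "h \<noteq> 0" using lh by auto
  have dh: "degree h = k" unfolding h k_def by (subst degree_prod_eq_sum_degree) auto
  have H0: "H \<noteq> 0" using h0 by (simp add: H_def)
  have dH: "degree H = 2 * M * k" using h0 by (simp add: H_def degree_power_eq dh)
  have Hge: "0 \<le> poly H t" for t by (simp add: H_def power_mult)
  \<comment> \<open>Half of the lower bound: \<open>F = f - P\<close> is still nonnegative and
    \<open>P\<close> is kept as a reserve.\<close>
  define P where "P = smult ([:c / 2:] * H * Q ^ n1) Rp"
  have P: "poly2 P t r = c / 2 * poly H t * poly Q t ^ n1 * (1 + r\<^sup>2) ^ e" for t r
    by (simp add: P_def Rp)
  define F where "F = f - P"
  have f_ge: "2 * poly2 P t r \<le> poly2 f t r" for t r
    using bound[of t r] by (simp add: P H_def Q n1_def k_def)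
  have Pge: "0 \<le> poly2 P t r" for t r
    unfolding P using c Hge Q0[THEN less_imp_le] R0[THEN less_imp_le]
    by (intro mult_nonneg_nonneg zero_le_power) auto
  have Fge: "0 \<le> poly2 F t r" for t r
  proof -
    have "poly2 F t r = poly2 f t r - poly2 P t r" by (simp add: F_def poly2_def)
    then show ?thesis using f_ge[of t r] Pge[of t r] by linarith
  qed
  have dP: "degree P \<le> 2 * e" unfolding P_def by (rule order_trans[OF degree_smult_le]) (simp add: dRp)
  have dF: "degree F \<le> 2 * e" unfolding F_def using deg dP by (intro degree_diff_le) auto
  \<comment> \<open>One more than the exponent in \<open>H\<close>: the error of the two squares is
    \<open>H\<close> times a multiple of \<open>h\<close>, and this additional \<open>h\<close>
    makes it small near \<open>Z\<close>.\<close>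
  define K where "K = 2 * M + 1"
  have "\<exists>A B. degree A \<le> e \<and> degree B \<le> e \<and> [:[:- z, 1:] ^ K:] dvd F - A\<^sup>2 - B\<^sup>2" if z: "z \<in> Z" for z
  proof (rule local_two_squares[OF _ _ Fge])
    \<comment> \<open>The reserve vanishes on the line \<open>t = z\<close>, so the leading
      coefficient of \<open>F\<close> there is that of \<open>f\<close>.\<close>
    have "poly h z = 0" using Z z by (auto simp: h poly_prod)
    then have "poly H z = 0" using M by (simp add: H_def zero_power)
    then have "poly (coeff P (2 * e)) z = 0" by (simp add: P_def)
    then have l: "poly (coeff F (2 * e)) z = poly (lead_coeff f) z" by (simp add: F_def deg)
    then have "coeff F (2 * e) \<noteq> 0" using lc[OF z] by auto
    then show "degree F = 2 * e" using dF le_degree by (metis le_antisym)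
    then show "0 < poly (lead_coeff F) z" using l lc[OF z] by simp
  qed
  from global_two_squares[OF Z this] obtain A0 B0 where AB0: "degree A0 \<le> e" "degree B0 \<le> e"
    "[:h ^ K:] dvd F - A0\<^sup>2 - B0\<^sup>2" unfolding h by blast
  define a where "a = k * K"
  \<comment> \<open>Reduction modulo \<open>h^K\<close> bounds the degree in \<open>t\<close> by
    \<open>a\<close>. Scaling by \<open>Q^a\<close> first multiplies the target \<open>F\<close> by
    \<open>Q^(2 a)\<close>, which lets it keep up with the reduced squares at infinity whatever the
    degrees of \<open>A0\<close> and \<open>B0\<close> were.\<close>
  define red where "red = (\<lambda>X. map_poly (\<lambda>p. (Q ^ a * p) mod h ^ K) X)"
  have cr: "coeff (red X) i = (Q ^ a * coeff X i) mod h ^ K" for X i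
    unfolding red_def by (rule coeff_map_poly) simp
  have dr: "degree (red X) \<le> degree X" for X unfolding red_def by (rule map_poly_degree_leq)
  have tr: "tdeg_le (red X) a" for X
  proof -
    have "degree (p mod h ^ K) \<le> a" for p
      using degree_mod_less'[of "h ^ K" p] h0
      by (cases "p mod h ^ K = 0") (auto simp: degree_power_eq dh a_def mult.commute)
    then show ?thesis by (simp add: tdeg_le_def cr)
  qed
  have rd: "[:h ^ K:] dvd red X - smult (Q ^ a) X" for X
    unfolding const_poly_dvd_iff by (simp add: cr mod_eq_dvd_iff[symmetric])
  define A where "A = red A0"
  define B where "B = red B0"
  define S where "S = A\<^sup>2 + B\<^sup>2"
  have "[:h ^ K:] dvd smult (Q ^ (2 * a)) F - (smult (Q ^ a) A0)\<^sup>2 - (smult (Q ^ a) B0)\<^sup>2"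
  proof -
    have "smult (Q ^ (2 * a)) F - (smult (Q ^ a) A0)\<^sup>2 - (smult (Q ^ a) B0)\<^sup>2 = smult (Q ^ (2 * a)) (F - A0\<^sup>2 - B0\<^sup>2)"
      by (simp add: power2_eq_square mult_2 power_add smult_diff_right)
    also have "[:h ^ K:] dvd \<dots>" using AB0(3) by (rule dvd_smult)
    finally show ?thesis .
  qed
  then have "[:h ^ K:] dvd smult (Q ^ (2 * a)) F - A\<^sup>2 - B\<^sup>2"
    unfolding A_def B_def using rd rd by (rule dvd_diff_squares)
  then obtain E where "smult (Q ^ (2 * a)) F - A\<^sup>2 - B\<^sup>2 = [:h ^ K:] * E" by (elim dvdE)
  then have E: "smult (Q ^ (2 * a)) F = S + smult (h ^ K) E" by (simp add: S_def algebra_simps)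
  have dA: "degree A \<le> e" and dB: "degree B \<le> e" unfolding A_def B_def using dr AB0 le_trans by blast+
  have dS: "degree S \<le> 2 * e" unfolding S_def
  proof (intro degree_add_le)
    show "degree (A\<^sup>2) \<le> 2 * e" using degree_power_le[of A 2] dA by simp
    show "degree (B\<^sup>2) \<le> 2 * e" using degree_power_le[of B 2] dB by simp
  qed
  have tS: "tdeg_le S (2 * a)" unfolding S_def power2_eq_square
    using tdeg_le_add[OF tdeg_le_mult[OF tr tr] tdeg_le_mult[OF tr tr], of A0 A0 B0 B0]
    by (simp add: A_def B_def mult_2)
  have Sge: "0 \<le> poly2 S t r" for t r by (simp add: S_def)
  have Ssos: "S \<in> sos UNIV" unfolding S_def by (intro sos_add sos_square) auto
  have dE: "degree E \<le> 2 * e"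
  proof -
    have "degree (smult (h ^ K) E) = degree E" using h0 by simp
    moreover have "smult (h ^ K) E = smult (Q ^ (2 * a)) F - S" using E by simp
    moreover have "degree (smult (Q ^ (2 * a)) F - S) \<le> 2 * e"
      using dF dS by (intro degree_diff_le order_trans[OF degree_smult_le])
    ultimately show ?thesis by simp
  qed
  define f2 where "f2 = smult (Q ^ (2 * a)) f"
  define n2 where "n2 = n1 + 2 * a"
  obtain Cs where Cs: "0 < Cs" "\<And>t r. \<bar>poly2 S t r\<bar> \<le> Cs * (1 + t\<^sup>2) ^ a * (1 + r\<^sup>2) ^ e"
    using poly2_bound[OF dS tS] by blast
  \<comment> \<open>The threshold of \<open>prod_linear_sq_lower\<close> when the sum of the
    \<open>|z|\<close> serves as the bound for \<open>Z\<close>.\<close>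
  define R where "R = 2 * (\<Sum>z\<in>Z. \<bar>z\<bar>) + 1"
  have R1': "1 \<le> R" unfolding R_def by (simp add: sum_nonneg)
  obtain Ce where Ce: "0 < Ce" "\<And>t r. \<bar>t\<bar> \<le> R \<Longrightarrow> \<bar>poly2 E t r\<bar> \<le> Ce * (1 + r\<^sup>2) ^ e"
    using poly2_bound_compact[OF dE] by blast
  \<comment> \<open>The first bound forces \<open>|t| < R\<close> in the region
    \<open>h^2 < \<eta> Q^k\<close>; the second then gives \<open>|h| Ce \<le> c / 4\<close>
    there.\<close>
  define \<eta> where "\<eta> = min ((1/8) ^ k) ((c / (4 * Ce))\<^sup>2 / (1 + R\<^sup>2) ^ k)"
  have RR: "0 < (1 + R\<^sup>2) ^ k" by (simp add: add_pos_nonneg)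
  have \<eta>: "0 < \<eta>" "\<eta> \<le> 1" "\<eta> * (1 + R\<^sup>2) ^ k \<le> (c / (4 * Ce))\<^sup>2"
  proof -
    show "0 < \<eta>" using c Ce(1) RR by (simp add: \<eta>_def)
    have "(1/8 :: real) ^ k \<le> 1" by (intro power_le_one) auto
    then show "\<eta> \<le> 1" by (simp add: \<eta>_def)
    have "\<eta> \<le> (c / (4 * Ce))\<^sup>2 / (1 + R\<^sup>2) ^ k" by (simp add: \<eta>_def)
    then show "\<eta> * (1 + R\<^sup>2) ^ k \<le> (c / (4 * Ce))\<^sup>2" using RR by (simp add: pos_le_divide_eq)
  qed
  have near: "\<bar>t\<bar> < R \<and> \<bar>poly h t\<bar> * Ce \<le> c / 4" if t: "(poly h t)\<^sup>2 < \<eta> * poly Q t ^ k" for t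
  proof -
    have zR: "\<bar>z\<bar> \<le> (\<Sum>z\<in>Z. \<bar>z\<bar>)" if "z \<in> Z" for z
      using Z that by (intro member_le_sum[where f = abs]) auto
    have tR: "\<bar>t\<bar> < R"
    proof (rule ccontr)
      assume "\<not> \<bar>t\<bar> < R"
      then have "(1/8) ^ k * (1 + t\<^sup>2) ^ k \<le> (poly h t)\<^sup>2"
        unfolding h k_def by (intro prod_linear_sq_lower[OF Z zR]) (auto simp: R_def sum_nonneg)
      moreover have "\<eta> * (1 + t\<^sup>2) ^ k \<le> (1/8) ^ k * (1 + t\<^sup>2) ^ k"
        by (intro mult_right_mono) (auto simp: \<eta>_def)
      ultimately show False using t by (simp add: Q)
    qed
    have "t\<^sup>2 \<le> R\<^sup>2" using tR abs_le_square_iff[of t R] by simp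
    then have "\<eta> * poly Q t ^ k \<le> \<eta> * (1 + R\<^sup>2) ^ k"
      using \<eta>(1) by (intro mult_left_mono power_mono) (auto simp: Q)
    then have "(poly h t)\<^sup>2 \<le> (c / (4 * Ce))\<^sup>2" using t \<eta>(3) by linarith
    then have "\<bar>poly h t\<bar> \<le> c / (4 * Ce)" using c Ce(1) abs_le_square_iff[of "poly h t" "c / (4 * Ce)"] by simp
    then show ?thesis using tR Ce(1) by (simp add: field_simps)
  qed
  \<comment> \<open>Outside that region \<open>H\<close> is at least \<open>w0 Q^(k M)\<close>;
    everywhere it is at most \<open>Cw Q^(k M)\<close>.\<close>
  define w0 where "w0 = \<eta> ^ M"
  define Cw where "Cw = (\<Prod>z\<in>Z. 1 + z\<^sup>2) ^ M"
  have w0: "0 < w0" "w0 \<le> 1" using \<eta> by (auto simp: w0_def power_le_one)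
  have Cw: "1 \<le> Cw" unfolding Cw_def by (intro one_le_power prod_ge_1) simp
  have Hup: "poly H t \<le> Cw * poly Q t ^ (k * M)" for t
  proof -
    have "((poly h t)\<^sup>2) ^ M \<le> ((\<Prod>z\<in>Z. 1 + z\<^sup>2) * (1 + t\<^sup>2) ^ k) ^ M"
      unfolding h k_def by (intro power_mono prod_linear_sq_upper[OF Z]) simp
    then show ?thesis by (simp add: H_def Cw_def Q power_mult_distrib power_mult)
  qed
  have Hlow: "w0 * poly Q t ^ (k * M) \<le> poly H t" if "\<not> (poly h t)\<^sup>2 < \<eta> * poly Q t ^ k" for t
  proof -
    have "(\<eta> * poly Q t ^ k) ^ M \<le> ((poly h t)\<^sup>2) ^ M"
      using that \<eta>(1) Q0[of t] by (intro power_mono) auto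
    then show ?thesis by (simp add: H_def w0_def power_mult_distrib power_mult)
  qed
  define q where "q = smult Cw (Q ^ (k * M))"
  \<comment> \<open>The damping factor is \<open>\<Psi> / q = 1 - H / q\<close>. It lies in
    \<open>[0, 1]\<close>, is 1 to order \<open>2 M\<close> at \<open>Z\<close>, and is at most
    \<open>\<theta> < 1\<close> outside the region near \<open>Z\<close>.\<close>
  define \<Psi> where "\<Psi> = q - H"
  have q: "poly q t = Cw * poly Q t ^ (k * M)" for t by (simp add: q_def)
  have q0: "0 < poly q t" for t unfolding q using Cw Q0[of t] by (intro mult_pos_pos zero_less_power) auto
  have \<Psi>0: "0 \<le> poly \<Psi> t" for t using Hup[of t] by (simp add: \<Psi>_def q)
  define \<theta> where "\<theta> = 1 - w0 / Cw"
  have \<theta>: "0 \<le> \<theta>" "\<theta> < 1" using w0 Cw by (auto simp: \<theta>_def)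
  have "0 < c / 2 * w0 / Cs" using c w0 Cs by simp
  \<comment> \<open>\<open>\<theta>^(2 j)\<close> has to push the size \<open>Cs\<close> of
    \<open>S\<close> below the available reserve.\<close>
  then obtain j where "\<theta> ^ j < c / 2 * w0 / Cs" using real_arch_pow_inv[OF _ \<theta>(2)] by blast
  then have "\<theta> ^ j * Cs < c / 2 * w0" using Cs(1) by (simp only: pos_less_divide_eq)
  moreover have "\<theta> ^ (2 * j) * Cs \<le> \<theta> ^ j * Cs"
    using \<theta> Cs by (intro mult_right_mono power_decreasing) auto
  ultimately have j: "\<theta> ^ (2 * j) * Cs \<le> c / 2 * w0" by linarith
  \<comment> \<open>Quotient of \<open>q^(2 j) - \<Psi>^(2 j)\<close> by
    \<open>q - \<Psi> = H\<close>, written as a sum of nonnegative terms.\<close>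
  define X where "X = (\<Sum>i<2 * j. \<Psi> ^ (2 * j - Suc i) * q ^ i)"
  have X: "q ^ (2 * j) - \<Psi> ^ (2 * j) = H * X"
  proof -
    have "q - \<Psi> = H" by (simp add: \<Psi>_def)
    then show ?thesis unfolding X_def by (simp only: power_diff_sumr2[of q "2 * j" \<Psi>])
  qed
  have X0: "0 \<le> poly X t" for t unfolding X_def poly_sum poly_mult poly_power
    using \<Psi>0 q0[THEN less_imp_le] by (intro sum_nonneg mult_nonneg_nonneg zero_le_power) auto
  \<comment> \<open>The quotient of \<open>q^(2 j) f2 - \<Psi>^(2 j) S\<close> by \<open>H\<close>:
    the reserve, the error \<open>h E\<close>, and the part \<open>X S\<close> of the squares that
    damping gives up.\<close>
  define W where "W = smult (q ^ (2 * j)) (smult ([:c / 2:] * Q ^ n2) Rp + smult h E) + smult X S"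
  have split: "smult (q ^ (2 * j)) f2 = smult H W + smult (\<Psi> ^ (2 * j)) S"
  proof (rule poly2_eqI)
    fix t r
    have eE: "poly Q t ^ (2 * a) * (poly2 f t r - poly2 P t r) = poly2 S t r + poly h t ^ K * poly2 E t r"
      using arg_cong[OF E, of "\<lambda>p. poly2 p t r"] by (simp add: F_def poly2_def)
    have eX: "poly q t ^ (2 * j) = poly \<Psi> t ^ (2 * j) + poly H t * poly X t"
      using arg_cong[OF X, of "\<lambda>p. poly p t"] by simp
    have eQ: "poly Q t ^ (2 * a) * poly2 f t r = poly2 S t r + poly H t * (c / 2 * poly Q t ^ n2 * (1 + r\<^sup>2) ^ e + poly h t * poly2 E t r)"
      using eE by (simp add: P H_def K_def n2_def power_add algebra_simps)
    have gen: "u * A = v * (u * G + x * B) + b * B" if "A = B + v * G" "u = b + v * x" for u A v G x B b :: real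
      using that by (simp add: algebra_simps)
    show "poly2 (smult (q ^ (2 * j)) f2) t r = poly2 (smult H W + smult (\<Psi> ^ (2 * j)) S) t r"
      using gen[OF eQ eX] by (simp add: f2_def W_def Rp)
  qed
  have dW: "degree W \<le> 2 * e" unfolding W_def
    using dE dS dRp by (intro degree_add_le order_trans[OF degree_smult_le]) auto
  define n3 where "n3 = 2 * j * k * M + n2"
  \<comment> \<open>Read off from \<open>H W = q^(2 j) f2 - \<Psi>^(2 j) S\<close>, where the
    degrees in \<open>t\<close> are known; this spares a bound for \<open>E\<close>.\<close>
  have tW: "tdeg_le W (2 * n3)" unfolding tdeg_le_def
  proof
    fix i
    have dQ: "degree (Q ^ l) \<le> 2 * l" for l using degree_power_le[of Q l] by (simp add: Q_def)
    have dq: "degree q \<le> 2 * (k * M)" unfolding q_def by (rule order_trans[OF degree_smult_le dQ])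
    then have d\<Psi>: "degree \<Psi> \<le> 2 * (k * M)" unfolding \<Psi>_def by (intro degree_diff_le) (simp_all add: dH)
    have dp: "degree (p ^ (2 * j)) \<le> 4 * j * k * M" if "degree p \<le> 2 * (k * M)" for p :: "real poly"
    proof -
      have "degree (p ^ (2 * j)) \<le> degree p * (2 * j)" by (rule degree_power_le)
      also have "\<dots> \<le> 2 * (k * M) * (2 * j)" using that by (intro mult_right_mono) auto
      finally show ?thesis by (simp add: mult_ac)
    qed
    have "tdeg_le f2 (2 * (2 * a) + 2 * n)" unfolding f2_def by (intro tdeg_le_smult dQ td)
    then have "tdeg_le (smult (q ^ (2 * j)) f2) (4 * j * k * M + (2 * (2 * a) + 2 * n))"
      by (intro tdeg_le_smult dp dq)
    moreover have "tdeg_le (smult (\<Psi> ^ (2 * j)) S) (4 * j * k * M + (2 * (2 * a) + 2 * n))"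
      by (rule tdeg_le_mono[OF tdeg_le_smult[OF dp[OF d\<Psi>] tS]]) simp
    ultimately have "tdeg_le (smult (q ^ (2 * j)) f2 - smult (\<Psi> ^ (2 * j)) S) (4 * j * k * M + (2 * (2 * a) + 2 * n))"
      by (rule tdeg_le_diff)
    then have "degree (H * coeff W i) \<le> 4 * j * k * M + (2 * (2 * a) + 2 * n)"
      by (simp add: split tdeg_le_def)
    then show "degree (coeff W i) \<le> 2 * n3"
    proof (cases "coeff W i = 0")
      case False
      assume "degree (H * coeff W i) \<le> 4 * j * k * M + (2 * (2 * a) + 2 * n)"
      then have "2 * M * k + degree (coeff W i) \<le> 4 * j * k * M + (2 * (2 * a) + 2 * n)"
        using False H0 by (simp add: degree_mult_eq dH)
      moreover have "2 * n = 2 * n1 + 2 * M * k" using M(2) by (simp add: n1_def k_def mult.commute algebra_simps)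
      ultimately show ?thesis by (simp add: n3_def n2_def)
    qed simp
  qed
  have n21: "poly Q t ^ n2 = poly Q t ^ n1 * poly Q t ^ (2 * a)" for t by (simp add: n2_def power_add)
  have n3q: "poly q t ^ (2 * j) * poly Q t ^ n2 = Cw ^ (2 * j) * poly Q t ^ n3" for t
    by (simp add: q n3_def power_mult_distrib power_add mult_ac flip: power_mult)
  have Wlow: "Cw ^ (2 * j) * (c / 4) * (1 + t\<^sup>2) ^ n3 * (1 + r\<^sup>2) ^ e \<le> poly2 W t r" for t r
  proof -
    define Y where "Y = poly Q t ^ n2 * (1 + r\<^sup>2) ^ e"
    have Y: "0 < Y" "(1 + r\<^sup>2) ^ e \<le> Y"
      using Q0[of t] R0[of r] mult_right_mono[OF one_le_power[OF Q1[of t], of n2], of "(1 + r\<^sup>2) ^ e"]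
      by (auto simp: Y_def)
    have W2: "poly2 W t r = poly q t ^ (2 * j) * (c / 2 * Y + poly h t * poly2 E t r) + poly X t * poly2 S t r"
      by (simp add: W_def Rp Y_def)
    have qj: "0 < poly q t ^ (2 * j)" using q0 by (rule zero_less_power)
    \<comment> \<open>Near \<open>Z\<close> half of the reserve absorbs the error
      \<open>h E\<close>, and \<open>X S\<close> only helps. Elsewhere \<open>W\<close> is estimated
      through \<open>split\<close>, with the damped \<open>S\<close> using up at most half of
      \<open>f2\<close>.\<close>
    have "poly q t ^ (2 * j) * (c / 4 * Y) \<le> poly2 W t r"
    proof (cases "(poly h t)\<^sup>2 < \<eta> * poly Q t ^ k")
      case True
      note nr = near[OF True]
      have "\<bar>poly h t * poly2 E t r\<bar> \<le> \<bar>poly h t\<bar> * (Ce * (1 + r\<^sup>2) ^ e)"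
        unfolding abs_mult using nr by (intro mult_left_mono Ce) auto
      also have "\<dots> \<le> c / 4 * (1 + r\<^sup>2) ^ e"
        unfolding mult.assoc[symmetric] using nr R0[of r] by (intro mult_right_mono) auto
      also have "\<dots> \<le> c / 4 * Y" using c Y by (intro mult_left_mono) auto
      finally have "c / 4 * Y \<le> c / 2 * Y + poly h t * poly2 E t r" by linarith
      then have "poly q t ^ (2 * j) * (c / 4 * Y) \<le> poly q t ^ (2 * j) * (c / 2 * Y + poly h t * poly2 E t r)"
        using qj by (intro mult_left_mono) auto
      then show ?thesis unfolding W2 using mult_nonneg_nonneg[OF X0 Sge, of t t r] by linarith
    next
      case False
      define G where "G = poly H t"
      have low: "w0 * poly Q t ^ (k * M) \<le> G" using Hlow[OF False] by (simp add: G_def)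
      have G: "0 < G" using low w0(1) Q0[of t] by (smt (verit) mult_pos_pos zero_less_power)
      have f2l: "c * G * Y \<le> poly2 f2 t r"
      proof -
        have "c * G * Y = poly Q t ^ (2 * a) * (2 * poly2 P t r)"
          by (simp add: P Y_def n21 G_def)
        also have "\<dots> \<le> poly Q t ^ (2 * a) * poly2 f t r"
          using f_ge Q0[of t] by (intro mult_left_mono) auto
        finally show ?thesis by (simp add: f2_def)
      qed
      have "poly \<Psi> t \<le> \<theta> * poly q t"
      proof -
        have "\<theta> * poly q t = poly q t - w0 * poly Q t ^ (k * M)" using Cw by (simp add: \<theta>_def q left_diff_distrib)
        then show ?thesis using low by (simp add: \<Psi>_def G_def)
      qed
      then have "poly \<Psi> t ^ (2 * j) \<le> \<theta> ^ (2 * j) * poly q t ^ (2 * j)"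
        using \<Psi>0[of t] by (metis power_mono power_mult_distrib)
      moreover have "poly2 S t r * w0 \<le> Cs * (G * Y)"
      proof -
        have "poly2 S t r * w0 \<le> (Cs * poly Q t ^ a * (1 + r\<^sup>2) ^ e) * w0"
          using Cs(2)[of t r] w0(1) by (intro mult_right_mono) (auto simp: Q)
        also have "\<dots> = Cs * ((w0 * poly Q t ^ a) * (1 + r\<^sup>2) ^ e)" by simp
        also have "\<dots> \<le> Cs * ((G * poly Q t ^ n2) * (1 + r\<^sup>2) ^ e)"
        proof (intro mult_left_mono mult_right_mono)
          have "poly Q t ^ a \<le> poly Q t ^ n2" using Q1[of t] by (intro power_increasing) (auto simp: n2_def)
          moreover have "1 \<le> poly Q t ^ (k * M)" using Q1[of t] by (rule one_le_power)
          then have "w0 \<le> G" using low w0(1) by (smt (verit) mult_le_cancel_left1)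
          ultimately show "w0 * poly Q t ^ a \<le> G * poly Q t ^ n2"
            using G Q0[of t] by (intro mult_mono) auto
        qed (use Cs R0[of r] in auto)
        finally show ?thesis by (simp add: Y_def mult.assoc)
      qed
      then have "poly2 S t r \<le> Cs * (G * Y) / w0" using w0(1) by (simp add: pos_le_divide_eq)
      ultimately have "poly \<Psi> t ^ (2 * j) * poly2 S t r \<le> (\<theta> ^ (2 * j) * poly q t ^ (2 * j)) * (Cs * (G * Y) / w0)"
        using Sge \<theta> qj by (intro mult_mono) auto
      also have "\<dots> = (\<theta> ^ (2 * j) * Cs) * (poly q t ^ (2 * j) * (G * Y) / w0)" by simp
      also have "\<dots> \<le> (c / 2 * w0) * (poly q t ^ (2 * j) * (G * Y) / w0)"
        using G Y qj w0 by (intro mult_right_mono[OF j]) auto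
      also have "\<dots> = poly q t ^ (2 * j) * (c / 2 * (G * Y))" using w0 by simp
      finally have "poly \<Psi> t ^ (2 * j) * poly2 S t r \<le> poly q t ^ (2 * j) * (c / 2 * (G * Y))" .
      moreover have "poly q t ^ (2 * j) * (c * G * Y) \<le> poly q t ^ (2 * j) * poly2 f2 t r"
        using f2l qj by (intro mult_left_mono) auto
      moreover have "poly q t ^ (2 * j) * poly2 f2 t r = G * poly2 W t r + poly \<Psi> t ^ (2 * j) * poly2 S t r"
        using arg_cong[OF split, of "\<lambda>p. poly2 p t r"] by (simp add: G_def)
      ultimately have "G * (poly q t ^ (2 * j) * (c / 2 * Y)) \<le> G * poly2 W t r"
        by (simp add: algebra_simps)
      then have "poly q t ^ (2 * j) * (c / 2 * Y) \<le> poly2 W t r" using G by simp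
      moreover have "poly q t ^ (2 * j) * (c / 4 * Y) \<le> poly q t ^ (2 * j) * (c / 2 * Y)"
        using qj Y c by (intro mult_left_mono mult_right_mono) auto
      ultimately show ?thesis by (rule order_trans[rotated])
    qed
    moreover have "poly q t ^ (2 * j) * (c / 4 * Y) = Cw ^ (2 * j) * (c / 4) * (1 + t\<^sup>2) ^ n3 * (1 + r\<^sup>2) ^ e"
      using n3q[of t] by (simp add: Y_def Q mult_ac)
    ultimately show ?thesis by (simp only:)
  qed
  have "0 < Cw ^ (2 * j) * (c / 4)" using Cw c by simp
  from strictly_positive_sos[OF dW _ this Wlow] tW obtain N where N: "one_plus_sq ^ N * W \<in> sos UNIV"
    by (auto simp: tdeg_le_def)
  have sp: "[:p ^ (2 * l):] \<in> sos UNIV" for p :: "real poly" and l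
  proof -
    have "[:p ^ (2 * l):] = [:p ^ l:]\<^sup>2" by (simp add: power2_eq_square flip: power_add mult_2)
    then show ?thesis using sos_square by (metis UNIV_I)
  qed
  have "[:H:] * (one_plus_sq ^ N * W) + [:\<Psi> ^ (2 * j):] * (one_plus_sq ^ N * S) \<in> sos UNIV"
    unfolding H_def by (intro sos_add sos_mult_UNIV[OF sp] N sos_mult_UNIV[OF sos_power[OF one_plus_sq_sos] Ssos])
  also have "[:H:] * (one_plus_sq ^ N * W) + [:\<Psi> ^ (2 * j):] * (one_plus_sq ^ N * S) = one_plus_sq ^ N * smult (q ^ (2 * j)) f2"
    unfolding split by (simp add: algebra_simps)
  finally have s: "one_plus_sq ^ N * smult (q ^ (2 * j)) f2 \<in> sos UNIV" .
  have "[:[:1 / Cw ^ (2 * j):]:] * (one_plus_sq ^ N * smult (q ^ (2 * j)) f2) \<in> sos UNIV"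
    using Cw by (intro sos_mult_UNIV[OF nonneg_const_sos s]) simp
  also have "[:[:1 / Cw ^ (2 * j):]:] * (one_plus_sq ^ N * smult (q ^ (2 * j)) f2) = one_plus_sq ^ (N + 2 * j * (k * M) + 2 * a) * f"
    using Cw by (intro poly2_eqI) (simp add: f2_def q Q power_add power_mult_distrib mult_ac flip: power_mult)
  finally show ?thesis by blast
qed

section \<open>Lower bounds at infinity and near the zeros\<close>

text \<open>For \<open>|x| \<ge> 2 C / c\<close> the lower terms amount to at most half of the bound
  for the leading one. The factor \<open>(1/2)^m\<close> comes from
  \<open>(1 + x^2) / 2 \<le> x^2\<close>; the weight \<open>w\<close> leaves room for a power of
  \<open>1 + r^2\<close> when \<open>x\<close> is \<open>t\<close>.\<close>

lemma lead_dominates: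
  fixes a :: "nat \<Rightarrow> real"
  assumes lead: "c * w \<le> a (2 * m)" and rest: "(\<Sum>i<2 * m. \<bar>a i\<bar>) \<le> C * w"
    and x: "1 \<le> \<bar>x\<bar>" "2 * C \<le> c * \<bar>x\<bar>" and w: "0 \<le> w" and c: "0 < c"
  shows "c / 2 * (1/2) ^ m * (1 + x\<^sup>2) ^ m * w \<le> (\<Sum>i\<le>2 * m. a i * x ^ i)"
proof -
  define s where "s = (\<Sum>i<2 * m. a i * x ^ i)"
  have "\<bar>x\<bar> * \<bar>s\<bar> \<le> (\<Sum>i<2 * m. \<bar>a i\<bar> * \<bar>x\<bar> ^ Suc i)"
    unfolding s_def abs_mult[symmetric] sum_distrib_left
    by (rule order_trans[OF sum_abs]) (simp add: abs_mult power_abs mult_ac)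
  also have "\<dots> \<le> (\<Sum>i<2 * m. \<bar>a i\<bar> * \<bar>x\<bar> ^ (2 * m))"
    using x(1) by (intro sum_mono mult_left_mono power_increasing) auto
  also have "\<dots> \<le> C * w * x ^ (2 * m)"
    unfolding sum_distrib_right[symmetric] using rest by (simp add: power_mult mult_right_mono)
  finally have "\<bar>x\<bar> * \<bar>s\<bar> \<le> C * w * x ^ (2 * m)" .
  moreover have "C * (w * x ^ (2 * m)) \<le> (c / 2 * \<bar>x\<bar>) * (w * x ^ (2 * m))"
    using x(2) w by (intro mult_right_mono) (auto simp: power_mult)
  ultimately have "\<bar>x\<bar> * \<bar>s\<bar> \<le> \<bar>x\<bar> * (c / 2 * (w * x ^ (2 * m)))" by (simp add: mult_ac)
  then have s: "\<bar>s\<bar> \<le> c / 2 * (w * x ^ (2 * m))"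
    using x(1) mult_le_cancel_left_pos[of "\<bar>x\<bar>" "\<bar>s\<bar>" "c / 2 * (w * x ^ (2 * m))"] by linarith
  have "c * w * x ^ (2 * m) \<le> a (2 * m) * x ^ (2 * m)"
    using lead by (intro mult_right_mono) (auto simp: power_mult)
  moreover have "(\<Sum>i\<le>2 * m. a i * x ^ i) = s + a (2 * m) * x ^ (2 * m)"
    by (simp add: s_def lessThan_Suc_atMost[symmetric])
  ultimately have "c / 2 * (w * x ^ (2 * m)) \<le> (\<Sum>i\<le>2 * m. a i * x ^ i)" using s by (simp add: algebra_simps)
  moreover have "c / 2 * (w * ((1/2) ^ m * (1 + x\<^sup>2) ^ m)) \<le> c / 2 * (w * x ^ (2 * m))"
  proof -
    have "1 \<le> x\<^sup>2" using x(1) abs_le_square_iff[of 1 x] by simp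
    then have "((1 + x\<^sup>2) / 2) ^ m \<le> (x\<^sup>2) ^ m" by (intro power_mono) auto
    then have "(1/2) ^ m * (1 + x\<^sup>2) ^ m \<le> x ^ (2 * m)" by (simp add: power_divide power_mult)
    then show ?thesis using w c by (intro mult_left_mono) auto
  qed
  ultimately show ?thesis by (simp add: mult_ac)
qed

lemma poly_attains_min:
  fixes p :: "real poly"
  assumes "0 \<le> R"
  shows "\<exists>x\<in>{-R..R}. \<forall>y\<in>{-R..R}. poly p x \<le> poly p y"
proof (rule continuous_attains_inf)
  show "continuous_on {-R..R} (poly p)" by (intro continuous_intros)
qed (use assms in auto)

lemma poly_pos_compact:
  fixes p :: "real poly"
  assumes "\<And>x. \<bar>x\<bar> \<le> R \<Longrightarrow> 0 < poly p x"
  shows "\<exists>c>0. \<forall>x. \<bar>x\<bar> \<le> R \<longrightarrow> c \<le> poly p x"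
proof (cases "0 \<le> R")
  case True
  then obtain x where x: "x \<in> {-R..R}" "\<And>y. y \<in> {-R..R} \<Longrightarrow> poly p x \<le> poly p y"
    using poly_attains_min by meson
  then show ?thesis using assms[of x] by (intro exI[of _ "poly p x"]) (auto simp: abs_le_iff)
qed (auto intro!: exI[of _ 1])

text \<open>A Lojasiewicz inequality, by induction on the degree: each root \<open>a\<close> of
  \<open>p\<close> is one of \<open>g\<close>, so \<open>|g|\<close> is at most a constant times
  \<open>|x - a|\<close>, and every linear factor of \<open>p\<close> costs one power of
  \<open>g\<close>.\<close>

lemma poly_root_lower_bound:
  fixes p g :: "real poly"
  assumes "p \<noteq> 0" "\<And>x. poly p x = 0 \<Longrightarrow> poly g x = 0" "0 \<le> R"
  shows "\<exists>M c. 0 < c \<and> (\<forall>x. \<bar>x\<bar> \<le> R \<longrightarrow> c * \<bar>poly g x\<bar> ^ M \<le> \<bar>poly p x\<bar>)"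
  using assms(1,2)
proof (induction "degree p" arbitrary: p rule: less_induct)
  case less
  show ?case
  proof (cases "\<exists>a. poly p a = 0")
    case False
    have "\<exists>c>0. \<forall>x. \<bar>x\<bar> \<le> R \<longrightarrow> c \<le> poly (p * p) x"
      using False by (intro poly_pos_compact) (auto simp: zero_less_mult_iff linorder_neq_iff)
    then obtain c where c: "0 < c" "\<And>x. \<bar>x\<bar> \<le> R \<Longrightarrow> c \<le> poly p x * poly p x" by auto
    have "sqrt c * \<bar>poly g x\<bar> ^ 0 \<le> \<bar>poly p x\<bar>" if "\<bar>x\<bar> \<le> R" for x
      using c(2)[OF that] real_sqrt_le_mono[of c "(poly p x)\<^sup>2"] by (simp add: power2_eq_square)
    then show ?thesis using c(1) by (intro exI[of _ 0] exI[of _ "sqrt c"]) auto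
  next
    case True
    then obtain a where a: "poly p a = 0" by blast
    then obtain q where q: "p = [:- a, 1:] * q" by (auto simp: poly_eq_0_iff_dvd elim: dvdE)
    have ga: "poly g a = 0" using less.prems(2) a by blast
    then obtain k where k: "g = [:- a, 1:] * k" by (auto simp: poly_eq_0_iff_dvd elim: dvdE)
    have q0: "q \<noteq> 0" using less.prems q by auto
    then have "degree p = Suc (degree q)" unfolding q by (subst degree_mult_eq) auto
    then obtain M c where Mc: "0 < c" "\<And>x. \<bar>x\<bar> \<le> R \<Longrightarrow> c * \<bar>poly g x\<bar> ^ M \<le> \<bar>poly q x\<bar>"
      using less.hyps[of q] q0 less.prems(2) by (auto simp: q)
    obtain C where C: "0 < C" "\<And>x. \<bar>x\<bar> \<le> R \<Longrightarrow> \<bar>poly k x\<bar> \<le> C"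
      using poly2_bound_compact[of "[:k:]" 0 R] by auto
    have "c / C * \<bar>poly g x\<bar> ^ Suc M \<le> \<bar>poly p x\<bar>" if x: "\<bar>x\<bar> \<le> R" for x
    proof -
      have "\<bar>poly g x\<bar> / C \<le> \<bar>x - a\<bar>"
        using mult_left_mono[OF C(2)[OF x], of "\<bar>x - a\<bar>"] C(1) by (simp add: k abs_mult pos_divide_le_eq algebra_simps flip: abs_mult)
      then have "(\<bar>poly g x\<bar> / C) * (c * \<bar>poly g x\<bar> ^ M) \<le> \<bar>x - a\<bar> * \<bar>poly q x\<bar>"
        using Mc C(1) x by (intro mult_mono) auto
      also have "\<dots> = \<bar>poly p x\<bar>" by (simp add: q flip: abs_mult) (simp add: algebra_simps)
      finally show ?thesis by (simp add: mult_ac)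
    qed
    then show ?thesis using Mc(1) C(1) by (intro exI[of _ "Suc M"] exI[of _ "c / C"]) auto
  qed
qed

lemma poly2_swap_sum:
  assumes "tdeg_le f m"
  shows "poly2 f t r = (\<Sum>i\<le>m. poly (map_poly (\<lambda>p. coeff p i) f) r * t ^ i)"
proof -
  have "poly2 f t r = (\<Sum>k\<le>degree f. (\<Sum>i\<le>m. coeff (coeff f k) i * t ^ i) * r ^ k)"
  proof -
    have "poly (coeff f k) t = (\<Sum>i\<le>m. coeff (coeff f k) i * t ^ i)" for k
      using assms by (intro poly_sum_le) (simp add: tdeg_le_def)
    then show ?thesis by (simp add: poly2_sum_coeffs[OF order_refl])
  qed
  also have "\<dots> = (\<Sum>i\<le>m. \<Sum>k\<le>degree f. coeff (coeff f k) i * t ^ i * r ^ k)"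
    by (simp add: sum_distrib_right sum.swap[of _ "{..m}"])
  also have "\<dots> = (\<Sum>i\<le>m. poly (map_poly (\<lambda>p. coeff p i) f) r * t ^ i)"
  proof (intro sum.cong refl)
    fix i
    have "poly (map_poly (\<lambda>p. coeff p i) f) r = (\<Sum>k\<le>degree f. coeff (coeff f k) i * r ^ k)"
      by (subst poly_sum_le[OF map_poly_degree_leq]) (simp add: coeff_map_poly)
    then show "(\<Sum>k\<le>degree f. coeff (coeff f k) i * t ^ i * r ^ k) = poly (map_poly (\<lambda>p. coeff p i) f) r * t ^ i"
      by (simp add: sum_distrib_left mult_ac)
  qed
  finally show ?thesis .
qed

text \<open>For large \<open>t\<close> the coefficient of \<open>t^(2 n)\<close> dominates, and
  \<open>top\<close> keeps it away from zero relative to \<open>(1 + r^2)^e\<close>.\<close>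

lemma lower_bound_far:
  fixes f :: "real poly poly"
  assumes deg: "degree f \<le> 2 * e" and td: "tdeg_le f (2 * n)" and c: "0 < c"
    and top: "\<And>r. c * (1 + r\<^sup>2) ^ e \<le> poly (map_poly (\<lambda>p. coeff p (2 * n)) f) r"
  shows "\<exists>R c'. 1 \<le> R \<and> 0 < c' \<and> (\<forall>t r. R \<le> \<bar>t\<bar> \<longrightarrow> c' * (1 + t\<^sup>2) ^ n * (1 + r\<^sup>2) ^ e \<le> poly2 f t r)"
proof -
  define a where "a = (\<lambda>i. map_poly (\<lambda>p. coeff p i) f)"
  have da: "degree (a i) \<le> 2 * e" for i
    unfolding a_def using deg map_poly_degree_leq le_trans by blast
  define C where "C = (\<Sum>i<2 * n. \<Sum>k\<le>2 * e. \<bar>coeff (a i) k\<bar>)"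
  have C: "(\<Sum>i<2 * n. \<bar>poly (a i) r\<bar>) \<le> C * (1 + r\<^sup>2) ^ e" for r
    unfolding C_def sum_distrib_right[of _ "{..<2 * n}"] by (intro sum_mono poly_bound da)
  define R where "R = max 1 (2 * C / c)"
  have "c / 2 * (1/2) ^ n * (1 + t\<^sup>2) ^ n * (1 + r\<^sup>2) ^ e \<le> poly2 f t r" if t: "R \<le> \<bar>t\<bar>" for t r
  proof -
    have "2 * C / c \<le> \<bar>t\<bar>" using t by (simp add: R_def)
    then have "2 * C \<le> c * \<bar>t\<bar>" using c by (simp add: pos_divide_le_eq mult.commute)
    then show ?thesis unfolding poly2_swap_sum[OF td] a_def[symmetric]
      using t C top c by (intro lead_dominates) (auto simp: R_def a_def)
  qed
  then show ?thesis using c by (intro exI[of _ R] exI[of _ "c / 2 * (1/2) ^ n"]) (auto simp: R_def)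
qed

lemma lower_bound_far_r:
  fixes f :: "real poly poly"
  assumes deg: "degree f = 2 * e" and lc: "\<And>t. 0 < poly (lead_coeff f) t"
  shows "\<exists>R2 c'. 1 \<le> R2 \<and> 0 < c' \<and> (\<forall>t r. \<bar>t\<bar> \<le> R \<longrightarrow> R2 \<le> \<bar>r\<bar> \<longrightarrow> c' * (1 + r\<^sup>2) ^ e \<le> poly2 f t r)"
proof -
  obtain c where c: "0 < c" "\<And>t. \<bar>t\<bar> \<le> R \<Longrightarrow> c \<le> poly (lead_coeff f) t"
    using poly_pos_compact[of R "lead_coeff f"] lc by blast
  have "\<exists>C. \<forall>k t. \<bar>t\<bar> \<le> R \<longrightarrow> \<bar>poly (coeff f k) t\<bar> \<le> C k"
  proof -
    have "\<exists>C. \<forall>t. \<bar>t\<bar> \<le> R \<longrightarrow> \<bar>poly (coeff f k) t\<bar> \<le> C" for k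
      using poly2_bound_compact[of "[:coeff f k:]" 0 R] by auto
    then show ?thesis by metis
  qed
  then obtain B where B: "\<And>k t. \<bar>t\<bar> \<le> R \<Longrightarrow> \<bar>poly (coeff f k) t\<bar> \<le> B k" by blast
  define C where "C = (\<Sum>k<2 * e. B k)"
  define R2 where "R2 = max 1 (2 * C / c)"
  have "c / 2 * (1/2) ^ e * (1 + r\<^sup>2) ^ e \<le> poly2 f t r" if t: "\<bar>t\<bar> \<le> R" and r: "R2 \<le> \<bar>r\<bar>" for t r
  proof -
    have "2 * C / c \<le> \<bar>r\<bar>" using r by (simp add: R2_def)
    then have x: "2 * C \<le> c * \<bar>r\<bar>" using c by (simp add: pos_divide_le_eq mult.commute)
    have "c / 2 * (1/2) ^ e * (1 + r\<^sup>2) ^ e * 1 \<le> (\<Sum>k\<le>2 * e. poly (coeff f k) t * r ^ k)"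
    proof (rule lead_dominates[OF _ _ _ x])
      show "c * 1 \<le> poly (coeff f (2 * e)) t" using c(2)[OF t] deg by simp
      show "(\<Sum>i<2 * e. \<bar>poly (coeff f i) t\<bar>) \<le> C * 1" unfolding C_def mult_1_right using B[OF t] by (intro sum_mono)
    qed (use r c in \<open>auto simp: R2_def\<close>)
    then show ?thesis by (simp add: poly2_sum_coeffs[OF eq_refl[OF deg]])
  qed
  then show ?thesis using c(1) by (intro exI[of _ R2] exI[of _ "c / 2 * (1/2) ^ e"]) (auto simp: R2_def)
qed

lemma poly_min_deriv:
  fixes p :: "real poly"
  assumes "\<bar>r\<bar> < R" "\<And>x. \<bar>x\<bar> \<le> R \<Longrightarrow> poly p r \<le> poly p x"
  shows "poly (pderiv p) r = 0"
proof (rule DERIV_local_min[OF poly_DERIV])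
  show "0 < R - \<bar>r\<bar>" using assms(1) by simp
  show "\<forall>y. \<bar>r - y\<bar> < R - \<bar>r\<bar> \<longrightarrow> poly p r \<le> poly p y" using assms(2) by auto
qed

lemma map_poly_eval_pderiv: "map_poly (\<lambda>p. poly p t) (pderiv f) = pderiv (map_poly (\<lambda>p. poly p t) f)"
  by (rule poly_eqI) (simp add: coeff_map_poly coeff_pderiv)

text \<open>At an interior minimum of \<open>f(t, \<sqdot>)\<close> the Bezout identity reads \<open>u f = D(t)\<close>.\<close>
lemma lower_bound_bezout:
  fixes f :: "real poly poly"
  assumes deg: "degree f = 2 * e" and lc: "\<And>t. 0 < poly (lead_coeff f) t"
    and bez: "u * f + v * pderiv f = [:D:]" and psd: "\<And>t r. 0 \<le> poly2 f t r" and R: "0 \<le> R"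
  shows "\<exists>c>0. \<forall>t r. \<bar>t\<bar> \<le> R \<longrightarrow> c * \<bar>poly D t\<bar> * (1 + r\<^sup>2) ^ e \<le> poly2 f t r"
proof -
  obtain R2 c where c: "1 \<le> R2" "0 < c"
    "\<And>t r. \<bar>t\<bar> \<le> R \<Longrightarrow> R2 \<le> \<bar>r\<bar> \<Longrightarrow> c * (1 + r\<^sup>2) ^ e \<le> poly2 f t r"
    using lower_bound_far_r[OF deg lc] by metis
  obtain B where B: "0 < B" "\<And>t. \<bar>t\<bar> \<le> R \<Longrightarrow> \<bar>poly D t\<bar> \<le> B"
    using poly2_bound_compact[of "[:D:]" 0 R] by auto
  define eu where "eu = degree u"
  obtain U0 where U0: "0 < U0" "\<And>t r. \<bar>t\<bar> \<le> R \<Longrightarrow> \<bar>poly2 u t r\<bar> \<le> U0 * (1 + r\<^sup>2) ^ eu"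
    using poly2_bound_compact[of u eu R] by (auto simp: eu_def)
  define U where "U = U0 * (1 + R2\<^sup>2) ^ eu"
  have U: "0 < U" using U0 by (simp add: U_def add_pos_nonneg)
  have Ub: "\<bar>poly2 u t r\<bar> \<le> U" if "\<bar>t\<bar> \<le> R" "\<bar>r\<bar> \<le> R2" for t r
  proof -
    have "r\<^sup>2 \<le> R2\<^sup>2" using that abs_le_square_iff[of r R2] by simp
    then have "U0 * (1 + r\<^sup>2) ^ eu \<le> U" unfolding U_def using U0 by (intro mult_left_mono power_mono) auto
    then show ?thesis using U0(2)[OF that(1), of r] by linarith
  qed
  \<comment> \<open>\<open>1 / U\<close> serves a minimum with \<open>|x| < R2\<close>, where the
    derivative vanishes; \<open>c / B\<close> serves one at the boundary, where the growth of
    \<open>f\<close> in \<open>r\<close> takes over.\<close>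
  define m where "m = min (c / B) (1 / U)"
  have m: "0 < m" using c B U by (simp add: m_def)
  have inner: "m * \<bar>poly D t\<bar> \<le> poly2 f t r" if t: "\<bar>t\<bar> \<le> R" and r: "\<bar>r\<bar> \<le> R2" for t r
  proof -
    define p where "p = map_poly (\<lambda>q. poly q t) f"
    have p: "poly p x = poly2 f t x" for x by (simp add: p_def poly2_altdef)
    obtain x where x: "x \<in> {-R2..R2}" "\<And>y. y \<in> {-R2..R2} \<Longrightarrow> poly p x \<le> poly p y"
      using poly_attains_min[of R2 p] c(1) by auto
    have "m * \<bar>poly D t\<bar> \<le> poly p x"
    proof (cases "\<bar>x\<bar> < R2")
      case True
      have "poly (pderiv p) x = 0" by (rule poly_min_deriv[OF True]) (use x in \<open>auto simp: abs_le_iff\<close>)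
      then have "poly2 (pderiv f) t x = 0"
        by (simp add: poly2_altdef map_poly_eval_pderiv p_def)
      then have "poly D t = poly2 u t x * poly p x"
        using arg_cong[OF bez, of "\<lambda>q. poly2 q t x"] by (simp add: p)
      then have "\<bar>poly D t\<bar> \<le> U * poly p x"
        using mult_right_mono[OF Ub[OF t, of x], of "poly p x"] True psd by (simp add: p abs_mult)
      then have "1 / U * \<bar>poly D t\<bar> \<le> poly p x" using U by (simp add: pos_divide_le_eq mult.commute)
      moreover have "m * \<bar>poly D t\<bar> \<le> 1 / U * \<bar>poly D t\<bar>" by (intro mult_right_mono) (auto simp: m_def)
      ultimately show ?thesis by linarith
    next
      case False
      have "m * \<bar>poly D t\<bar> \<le> c / B * B" using m B(2)[OF t] c B by (intro mult_mono) (auto simp: m_def)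
      also have "\<dots> = c * 1" using B by simp
      also have "\<dots> \<le> c * (1 + x\<^sup>2) ^ e" using c by (intro mult_left_mono one_le_power) auto
      also have "\<dots> \<le> poly p x" unfolding p using False by (intro c(3)[OF t]) simp
      finally show ?thesis .
    qed
    also have "\<dots> \<le> poly p r" using r by (intro x) (auto simp: abs_le_iff)
    finally show ?thesis by (simp add: p)
  qed
  define E where "E = (1 + R2\<^sup>2) ^ e"
  have E: "1 \<le> E" by (simp add: E_def one_le_power)
  have "m / E * \<bar>poly D t\<bar> * (1 + r\<^sup>2) ^ e \<le> poly2 f t r" if t: "\<bar>t\<bar> \<le> R" for t r
  proof (cases "\<bar>r\<bar> \<le> R2")
    case True
    then have "r\<^sup>2 \<le> R2\<^sup>2" using abs_le_square_iff[of r R2] c(1) by simp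
    then have "(1 + r\<^sup>2) ^ e \<le> E" unfolding E_def by (intro power_mono) auto
    then have "m / E * \<bar>poly D t\<bar> * (1 + r\<^sup>2) ^ e \<le> m / E * \<bar>poly D t\<bar> * E"
      using m E by (intro mult_left_mono) auto
    also have "\<dots> = m * \<bar>poly D t\<bar>" using E by simp
    finally show ?thesis using inner[OF t True] by linarith
  next
    case False
    have "m / E * \<bar>poly D t\<bar> \<le> c / B * B"
    proof (intro mult_mono)
      have "m / E \<le> m / 1" using E m by (intro divide_left_mono) auto
      then show "m / E \<le> c / B" by (simp add: m_def)
    qed (use B(2)[OF t] c B m E in auto)
    then have "m / E * \<bar>poly D t\<bar> \<le> c" using B by simp
    then have "m / E * \<bar>poly D t\<bar> * (1 + r\<^sup>2) ^ e \<le> c * (1 + r\<^sup>2) ^ e" by (intro mult_right_mono) auto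
    then show ?thesis using c(3)[OF t, of r] False by linarith
  qed
  then show ?thesis using m E by (intro exI[of _ "m / E"]) auto
qed

text \<open>Supplies the lower bound that \<open>poly2_pos_bound_sos\<close> asks for: from the top
  coefficient when \<open>t\<close> is large, and otherwise from \<open>D\<close>, which is at least
  a constant times a power of \<open>|h|\<close>.\<close>

lemma normalised_psd_sos:
  fixes f :: "real poly poly"
  assumes psd: "\<And>t r. 0 \<le> poly2 f t r" and deg: "degree f = 2 * e" and td: "tdeg_le f (2 * n)"
    and lc: "\<And>t. 0 < poly (lead_coeff f) t" and c0: "0 < c0"
    and top: "\<And>r. c0 * (1 + r\<^sup>2) ^ e \<le> poly (map_poly (\<lambda>p. coeff p (2 * n)) f) r"
    and bez: "u * f + v * pderiv f = [:D:]" and D: "D \<noteq> 0"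
  shows "\<exists>N. one_plus_sq ^ N * f \<in> sos UNIV"
proof -
  obtain R c1 where c1: "1 \<le> R" "0 < c1"
    "\<And>t r. R \<le> \<bar>t\<bar> \<Longrightarrow> c1 * (1 + t\<^sup>2) ^ n * (1 + r\<^sup>2) ^ e \<le> poly2 f t r"
    using lower_bound_far[OF eq_refl[OF deg] td c0 top] by metis
  have R0: "0 \<le> R" using c1 by simp
  obtain c2 where c2: "0 < c2"
    "\<And>t r. \<bar>t\<bar> \<le> R \<Longrightarrow> c2 * \<bar>poly D t\<bar> * (1 + r\<^sup>2) ^ e \<le> poly2 f t r"
    using lower_bound_bezout[OF deg lc bez psd R0] by metis
  define Z where "Z = {t. poly D t = 0}"
  have Z: "finite Z" unfolding Z_def by (rule poly_roots_finite[OF D])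
  define h where "h = (\<Prod>z\<in>Z. [:- z, 1:])"
  have "poly h x = 0" if "poly D x = 0" for x using that Z by (auto simp: h_def poly_prod Z_def)
  then obtain M0 c3 where c3: "0 < c3" "\<And>t. \<bar>t\<bar> \<le> R \<Longrightarrow> c3 * \<bar>poly h t\<bar> ^ M0 \<le> \<bar>poly D t\<bar>"
    using poly_root_lower_bound[OF D _ R0, of h] by metis
  \<comment> \<open>The successor makes \<open>M\<close> positive, and \<open>2 * M\<close> is at
    least \<open>M0\<close>.\<close>
  define M where "M = Suc M0"
  define k where "k = card Z"
  define C where "C = (\<Prod>z\<in>Z. 1 + z\<^sup>2) ^ M"
  have C1: "1 \<le> C" unfolding C_def by (intro one_le_power prod_ge_1) simp
  have hup: "poly h t ^ (2 * M) \<le> C * (1 + t\<^sup>2) ^ (k * M)" for t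
  proof -
    have "((poly h t)\<^sup>2) ^ M \<le> ((\<Prod>z\<in>Z. 1 + z\<^sup>2) * (1 + t\<^sup>2) ^ k) ^ M"
      unfolding h_def k_def by (intro power_mono prod_linear_sq_upper[OF Z]) simp
    then show ?thesis by (simp add: C_def power_mult_distrib power_mult)
  qed
  obtain B where B: "0 < B" "\<And>t. \<bar>t\<bar> \<le> R \<Longrightarrow> \<bar>poly h t\<bar> \<le> B"
    using poly2_bound_compact[of "[:h:]" 0 R] by auto
  define G where "G = (1 + R\<^sup>2) ^ n * B ^ (2 * M - M0)"
  have G: "0 < G" using B by (simp add: G_def add_pos_nonneg)
  define c where "c = min (c1 / C) (c2 * c3 / G)"
  have c: "0 < c" using c1 c2 c3 C1 G by (simp add: c_def)
  \<comment> \<open>The factor \<open>(1 + t^2)^(k M)\<close> balances the growth of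
    \<open>h^(2 M)\<close> at infinity.\<close>
  define f' where "f' = smult ([:1, 0, 1:] ^ (k * M)) f"
  have f': "poly2 f' t r = (1 + t\<^sup>2) ^ (k * M) * poly2 f t r" for t r
    by (simp add: f'_def power2_eq_square)
  have f'_eq: "f' = one_plus_sq ^ (k * M) * f"
    by (rule poly2_eqI) (simp add: f')
  have n0: "([:1, 0, 1:] :: real poly) ^ (k * M) \<noteq> 0" by simp
  have "\<exists>N. one_plus_sq ^ N * f' \<in> sos UNIV"
  proof (rule poly2_pos_bound_sos[OF Z _ _ _ _ _ c h_def])
    show "degree f' = 2 * e" using n0 by (simp add: f'_def deg)
    show "tdeg_le f' (2 * (n + k * M))"
      unfolding f'_def distrib_left by (subst add.commute, intro tdeg_le_smult td) (simp add: degree_power_eq)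
    show "0 < poly (lead_coeff f') z" if "z \<in> Z" for z
      using lc n0 by (simp add: f'_def add_pos_nonneg zero_less_mult_iff)
    show "0 < M" "card Z * M \<le> n + k * M" by (simp_all add: M_def k_def)
    show "c * poly h t ^ (2 * M) * (1 + t\<^sup>2) ^ (n + k * M - card Z * M) * (1 + r\<^sup>2) ^ e \<le> poly2 f' t r" for t r
    proof -
      have e1: "n + k * M - card Z * M = n" by (simp add: k_def)
      have Q1: "1 \<le> (1 + t\<^sup>2) ^ (k * M)" by (simp add: one_le_power)
      have h0: "0 \<le> poly h t ^ (2 * M)" by (simp add: power_mult)
      show ?thesis
      proof (cases "R \<le> \<bar>t\<bar>")
        case True
        have "c * poly h t ^ (2 * M) \<le> c1 / C * (C * (1 + t\<^sup>2) ^ (k * M))"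
          using c hup[of t] h0 c1 C1 by (intro mult_mono) (auto simp: c_def)
        also have "\<dots> = c1 * (1 + t\<^sup>2) ^ (k * M)" using C1 by simp
        finally have "c * poly h t ^ (2 * M) * ((1 + t\<^sup>2) ^ n * (1 + r\<^sup>2) ^ e) \<le> c1 * (1 + t\<^sup>2) ^ (k * M) * ((1 + t\<^sup>2) ^ n * (1 + r\<^sup>2) ^ e)"
          by (intro mult_right_mono) auto
        also have "\<dots> = (1 + t\<^sup>2) ^ (k * M) * (c1 * (1 + t\<^sup>2) ^ n * (1 + r\<^sup>2) ^ e)" by simp
        also have "\<dots> \<le> (1 + t\<^sup>2) ^ (k * M) * poly2 f t r" using True by (intro mult_left_mono c1) auto
        finally show ?thesis unfolding e1 f' by (simp add: mult.assoc)
      next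
        case False
        then have t: "\<bar>t\<bar> \<le> R" by simp
        have t2: "t\<^sup>2 \<le> R\<^sup>2" using t abs_le_square_iff[of t R] by simp
        have "poly h t ^ (2 * M) = \<bar>poly h t\<bar> ^ (2 * M - M0) * \<bar>poly h t\<bar> ^ M0"
        proof -
          have "2 * M - M0 + M0 = 2 * M" by (simp add: M_def)
          moreover have "\<bar>poly h t\<bar> ^ (2 * M) = poly h t ^ (2 * M)" by (simp add: power_even_abs)
          ultimately show ?thesis by (metis power_add)
        qed
        also have "\<dots> \<le> B ^ (2 * M - M0) * \<bar>poly h t\<bar> ^ M0"
          using B(2)[OF t] by (intro mult_right_mono power_mono) auto
        finally have "poly h t ^ (2 * M) * (1 + t\<^sup>2) ^ n \<le> (B ^ (2 * M - M0) * \<bar>poly h t\<bar> ^ M0) * (1 + R\<^sup>2) ^ n"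
          using t2 B by (intro mult_mono power_mono) auto
        then have hG: "poly h t ^ (2 * M) * (1 + t\<^sup>2) ^ n \<le> G * \<bar>poly h t\<bar> ^ M0" by (simp add: G_def mult_ac)
        have "c * (poly h t ^ (2 * M) * (1 + t\<^sup>2) ^ n) \<le> (c2 * c3 / G) * (G * \<bar>poly h t\<bar> ^ M0)"
          by (rule mult_mono[OF _ hG]) (use h0 c2 c3 G in \<open>auto simp: c_def\<close>)
        also have "\<dots> = c2 * (c3 * \<bar>poly h t\<bar> ^ M0)" using G by simp
        also have "\<dots> \<le> c2 * \<bar>poly D t\<bar>" using c2 c3(2)[OF t] by (intro mult_left_mono) auto
        finally have "c * (poly h t ^ (2 * M) * (1 + t\<^sup>2) ^ n) * (1 + r\<^sup>2) ^ e \<le> c2 * \<bar>poly D t\<bar> * (1 + r\<^sup>2) ^ e"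
          by (intro mult_right_mono) auto
        also have "\<dots> \<le> poly2 f t r" by (rule c2(2)[OF t])
        also have "\<dots> \<le> (1 + t\<^sup>2) ^ (k * M) * poly2 f t r" using Q1 psd[of t r] by (simp add: mult_le_cancel_right1)
        finally show ?thesis unfolding e1 f' by (simp add: mult.assoc)
      qed
    qed
  qed
  then obtain N where "one_plus_sq ^ N * (one_plus_sq ^ (k * M) * f) \<in> sos UNIV" unfolding f'_eq by blast
  then have "one_plus_sq ^ (N + k * M) * f \<in> sos UNIV" by (simp add: power_add mult.assoc)
  then show ?thesis by blast
qed

section \<open>Square factors and the Bezout identity\<close>

lemma poly_nonneg_closure_finite:
  fixes p :: "real poly"
  assumes "finite S" "\<And>x. x \<notin> S \<Longrightarrow> 0 \<le> poly p x"
  shows "0 \<le> poly p a"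
proof (rule tendsto_lowerbound)
  show "(poly p \<longlongrightarrow> poly p a) (at a)" by (intro tendsto_intros)
  have "eventually (\<lambda>x. \<forall>b\<in>S. x \<noteq> b) (at a)"
    using assms(1) by (intro eventually_ball_finite) (auto intro: eventually_neq_at_within)
  then show "eventually (\<lambda>x. 0 \<le> poly p x) (at a)"
    by eventually_elim (use assms(2) in auto)
qed simp

lemma poly2_slice_t: "poly (poly f [:r:]) t = poly2 f t r"
  by (simp add: poly2_def)

text \<open>\<open>s\<close> vanishes identically on only finitely many lines
  \<open>r = const\<close> and at finitely many points of any other; continuity along
  \<open>t\<close> and then along \<open>r\<close> fills the gaps.\<close>

lemma poly2_nonneg_cancel:
  assumes s: "s \<noteq> 0" and fg: "\<And>t r. 0 \<le> (poly2 s t r)\<^sup>2 * poly2 g t r"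
  shows "0 \<le> poly2 g t r"
proof -
  have main: "0 \<le> poly2 g t r" if r: "poly s [:r:] \<noteq> 0" for t r
  proof -
    have "0 \<le> poly (poly g [:r:]) t"
    proof (rule poly_nonneg_closure_finite[OF poly_roots_finite[OF r]])
      fix x assume "x \<notin> {x. poly (poly s [:r:]) x = 0}"
      then show "0 \<le> poly (poly g [:r:]) x"
        using fg[of x r] by (simp add: poly2_slice_t zero_le_mult_iff)
    qed
    then show ?thesis by (simp add: poly2_slice_t)
  qed
  have fin: "finite {r. poly s [:r:] = 0}"
  proof -
    have "(\<lambda>r. [:r:]) ` {r. poly s [:r:] = 0} \<subseteq> {x. poly s x = 0}" by auto
    then have "finite ((\<lambda>r. [:r:]) ` {r. poly s [:r:] = 0})" using poly_roots_finite[OF s] finite_subset by blast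
    then show ?thesis by (rule finite_imageD) (auto simp: inj_on_def)
  qed
  have "0 \<le> poly (map_poly (\<lambda>p. poly p t) g) r"
  proof (rule poly_nonneg_closure_finite[OF fin])
    fix x assume "x \<notin> {r. poly s [:r:] = 0}"
    then have "0 \<le> poly2 g t x" using main by blast
    then show "0 \<le> poly (map_poly (\<lambda>p. poly p t) g) x" by (simp only: poly2_altdef)
  qed
  then show ?thesis by (simp only: poly2_altdef)
qed

lemma const_linear_dvd_iff: "[:[:- a, 1:]:] dvd f \<longleftrightarrow> (\<forall>r. poly2 f a r = 0)"
proof
  assume "\<forall>r. poly2 f a r = 0"
  then have "map_poly (\<lambda>p. poly p a) f = 0"
    by (intro poly_eq_poly_eq_iff[THEN iffD1] ext) (simp add: poly2_altdef)
  then have "poly (coeff f n) a = 0" for n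
    by (metis coeff_0 poly_eval_rhom rhom.coeff_map)
  then show "[:[:- a, 1:]:] dvd f" by (simp add: const_poly_dvd_iff poly_eq_0_iff_dvd)
qed (auto elim!: dvdE)

lemma linear_dvd_iff: "[:- [:a:], 1:] dvd f \<longleftrightarrow> (\<forall>t. poly2 f t a = 0)"
proof
  assume "\<forall>t. poly2 f t a = 0"
  then have "poly f [:a:] = 0"
    by (intro poly_eq_poly_eq_iff[THEN iffD1] ext) (simp add: poly2_def)
  then show "[:- [:a:], 1:] dvd f" by (simp add: poly_eq_0_iff_dvd)
qed (auto elim!: dvdE simp: poly2_def)

text \<open>Tailored to its use: no repeated factor involving \<open>r\<close>, for the Bezout
  identity, and no line \<open>t = a\<close> of zeros. Factors in \<open>t\<close> alone without
  real zeros may remain, even repeated.\<close>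

definition square_reduced :: "real poly poly \<Rightarrow> bool" where
  "square_reduced f \<longleftrightarrow> f \<noteq> 0 \<and> (\<forall>s. 0 < degree s \<longrightarrow> \<not> s\<^sup>2 dvd f) \<and> (\<forall>a. \<not> [:[:- a, 1:]:] dvd f)"

text \<open>A factor \<open>t - a\<close> must occur twice, for otherwise the sign would change
  across the line \<open>t = a\<close>. The measure includes the degree of the leading coefficient
  so that removing factors in \<open>t\<close> alone decreases it too.\<close>

lemma square_reduction:
  assumes "f \<noteq> 0" "\<And>t r. 0 \<le> poly2 f t r"
  shows "\<exists>s g. f = s\<^sup>2 * g \<and> square_reduced g \<and> (\<forall>t r. 0 \<le> poly2 g t r)"
  using assms
proof (induction "degree f + degree (lead_coeff f)" arbitrary: f rule: less_induct)
  case less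
  have step: ?case if s: "f = s\<^sup>2 * g" "0 < degree s \<or> 0 < degree (lead_coeff s)" for s g
  proof -
    have nz: "s \<noteq> 0" "g \<noteq> 0" using less.prems s by auto
    have psd: "0 \<le> poly2 g t r" for t r
      by (rule poly2_nonneg_cancel[OF nz(1)]) (use less.prems(2) in \<open>simp add: s\<close>)
    have "degree f = 2 * degree s + degree g" using nz by (simp add: s degree_mult_eq degree_power_eq)
    moreover have "degree (lead_coeff f) = 2 * degree (lead_coeff s) + degree (lead_coeff g)"
      unfolding s(1) lead_coeff_mult lead_coeff_power
      using nz by (simp add: degree_mult_eq degree_power_eq)
    ultimately have "degree g + degree (lead_coeff g) < degree f + degree (lead_coeff f)" using s(2) by linarith
    from less.hyps[OF this nz(2) psd] obtain s' g' where "g = s'\<^sup>2 * g'" "square_reduced g'" "\<forall>t r. 0 \<le> poly2 g' t r"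
      by blast
    then show ?thesis by (intro exI[of _ "s * s'"] exI[of _ g']) (simp add: s power_mult_distrib mult_ac)
  qed
  show ?case
  proof (cases "\<exists>s. 0 < degree s \<and> s\<^sup>2 dvd f")
    case True
    then obtain s g where "0 < degree s" "f = s\<^sup>2 * g" by (metis dvdE)
    then show ?thesis using step by blast
  next
    case False
    show ?thesis
    proof (cases "\<exists>a. [:[:- a, 1:]:] dvd f")
      case True
      then obtain a where "[:[:- a, 1:]:] dvd f" by blast
      then obtain g where g: "f = [:[:- a, 1:]:] * g" by (elim dvdE)
      have "poly2 g a r = 0" for r
      proof -
        have "poly (poly g [:r:]) a = 0"
          by (rule poly_root_double) (use less.prems(2) in \<open>simp add: g poly2_slice_t\<close>)
        then show ?thesis by (simp add: poly2_slice_t)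
      qed
      then have "[:[:- a, 1:]:] dvd g" by (simp add: const_linear_dvd_iff)
      then obtain g' where g': "g = [:[:- a, 1:]:] * g'" by (elim dvdE)
      have "f = [:[:- a, 1:]:]\<^sup>2 * g'" by (simp only: g g' power2_eq_square mult.assoc)
      then show ?thesis by (rule step) simp
    next
      case no: False
      then have "square_reduced f" using False less.prems(1) unfolding square_reduced_def by blast
      then show ?thesis using less.prems(2) by (intro exI[of _ 1] exI[of _ f]) simp
    qed
  qed
qed

lemma prime_factor_pos_degree:
  fixes h :: "real poly poly"
  assumes "0 < degree h"
  shows "\<exists>p. prime_elem p \<and> 0 < degree p \<and> p dvd h"
proof (rule ccontr)
  assume no: "\<not> ?thesis"
  have "h \<noteq> 0" using assms by auto
  then obtain A where A: "\<And>x. x \<in># A \<Longrightarrow> prime_elem x" "normalize (prod_mset A) = normalize h"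
    using prime_factorization_exists by blast
  have dvd: "prod_mset A dvd h" "h dvd prod_mset A" using A(2) by (auto dest: associatedD1 associatedD2)
  have "degree x = 0" if "x \<in># A" for x
    using no A(1)[OF that] dvd_trans[OF dvd_prod_mset[OF that] dvd(1)] by auto
  then have "degree (prod_mset A) = 0"
  proof (induction A)
    case (add x A)
    then show ?case using degree_mult_le[of x "prod_mset A"] by simp
  qed simp
  moreover have "prod_mset A \<noteq> 0" using dvd(1) \<open>h \<noteq> 0\<close> by auto
  ultimately show False using dvd_imp_degree_le[OF dvd(2)] assms by simp
qed

text \<open>A substitute for the Euclidean algorithm over \<open>R(t)\<close>. A combination
  \<open>h\<close> of least degree in \<open>r\<close> pseudo-divides all others. If its degree is 0
  it is the wanted \<open>D\<close>; otherwise a prime factor of positive degree divides both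
  polynomials, since it cannot divide the multiplier of pseudo-division.\<close>

lemma bezout_or_common_factor:
  fixes f g :: "real poly poly"
  assumes "f \<noteq> 0"
  shows "(\<exists>p. prime_elem p \<and> 0 < degree p \<and> p dvd f \<and> p dvd g) \<or> (\<exists>u v D. D \<noteq> 0 \<and> u * f + v * g = [:D:])"
proof -
  define I where "I = {h. h \<noteq> 0 \<and> (\<exists>u v. h = u * f + v * g)}"
  have "f = 1 * f + 0 * g" by simp
  then have "f \<in> I" using assms unfolding I_def by blast
  then obtain h where h: "h \<in> I" "\<And>x. x \<in> I \<Longrightarrow> degree h \<le> degree x"
    using ex_has_least_nat[of "\<lambda>x. x \<in> I" f degree] by blast
  obtain u v where uv: "h = u * f + v * g" and h0: "h \<noteq> 0" using h(1) by (auto simp: I_def)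
  show ?thesis
  proof (cases "degree h = 0")
    case True
    then obtain D where "h = [:D:]" by (metis degree_eq_zeroE)
    then show ?thesis using uv h0 by auto
  next
    case False
    then obtain p where p: "prime_elem p" "0 < degree p" "p dvd h" using prime_factor_pos_degree[of h] by auto
    have "p dvd x" if x: "\<exists>a b. x = a * f + b * g" for x
    proof -
      obtain q r where qr: "pseudo_divmod x h = (q, r)" by fastforce
      define c where "c = lead_coeff h ^ (Suc (degree x) - degree h)"
      have e: "smult c x = h * q + r" and r: "r = 0 \<or> degree r < degree h"
        using pseudo_divmod[OF h0 qr] by (auto simp: c_def)
      obtain a b where ab: "x = a * f + b * g" using x by blast
      have "r = (smult c a - u * q) * f + (smult c b - v * q) * g"
        using e by (simp add: ab uv algebra_simps smult_add_right)
      then have "r \<noteq> 0 \<longrightarrow> r \<in> I" unfolding I_def by blast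
      then have "r = 0" using h(2)[of r] r by linarith
      then have "p dvd [:c:] * x" using e p(3) by simp
      then have "p dvd [:c:] \<or> p dvd x" using p(1) prime_elem_dvd_mult_iff by blast
      moreover have "\<not> p dvd [:c:]"
      proof
        assume "p dvd [:c:]"
        moreover have "[:c:] \<noteq> 0" using h0 by (simp add: c_def)
        ultimately show False using dvd_imp_degree_le[of p "[:c:]"] p(2) by simp
      qed
      ultimately show ?thesis by blast
    qed
    from this[of f] this[of g] have "p dvd f" "p dvd g"
      by (metis add.right_neutral mult_1 mult_zero_left, metis add_0 mult_1 mult_zero_left)
    then show ?thesis using p by blast
  qed
qed

text \<open>A prime \<open>p\<close> of positive degree that divides \<open>f = p g\<close> and its
  derivative divides \<open>g * pderiv p\<close>; by degree it cannot divide
  \<open>pderiv p\<close>, so \<open>p^2\<close> divides \<open>f\<close>.\<close>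

lemma square_free_bezout:
  fixes f :: "real poly poly"
  assumes "f \<noteq> 0" "\<And>s. 0 < degree s \<Longrightarrow> \<not> s\<^sup>2 dvd f"
  shows "\<exists>u v D. D \<noteq> 0 \<and> u * f + v * pderiv f = [:D:]"
proof -
  have "\<not> (prime_elem p \<and> 0 < degree p \<and> p dvd f \<and> p dvd pderiv f)" for p
  proof (intro notI, elim conjE)
    assume p: "prime_elem p" "0 < degree p" "p dvd f" "p dvd pderiv f"
    obtain g where g: "f = p * g" using p(3) by (elim dvdE)
    have "pderiv f = p * pderiv g + g * pderiv p" by (simp add: g pderiv_mult)
    then have "p dvd g * pderiv p" using p(4) by (metis dvd_add_right_iff dvd_triv_left)
    then have "p dvd g \<or> p dvd pderiv p" using p(1) prime_elem_dvd_mult_iff by blast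
    moreover have "\<not> p dvd pderiv p"
      using dvd_imp_degree_le[of p "pderiv p"] p(2) by (auto simp: degree_pderiv pderiv_eq_0_iff)
    ultimately have "p\<^sup>2 dvd f" by (simp add: g power2_eq_square)
    then show False using assms(2)[OF p(2)] by simp
  qed
  then show ?thesis using bezout_or_common_factor[OF assms(1)] by blast
qed

text \<open>A zero of a nonnegative polynomial is a minimum in \<open>r\<close>, so both terms on
  the left of the identity vanish. Zeros thus lie over the roots of \<open>D\<close>.\<close>

lemma zero_of_bezout:
  assumes psd: "\<And>t r. 0 \<le> poly2 f t r" and bez: "u * f + v * pderiv f = [:D:]" and z: "poly2 f t r = 0"
  shows "poly D t = 0"
proof -
  have "poly (pderiv (map_poly (\<lambda>p. poly p t) f)) r = 0"
    by (rule poly_min_deriv[of r "\<bar>r\<bar> + 1"]) (use psd z in \<open>simp_all flip: poly2_altdef\<close>)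
  then have "poly2 (pderiv f) t r = 0" by (simp add: poly2_altdef map_poly_eval_pderiv)
  then show ?thesis using arg_cong[OF bez, of "\<lambda>q. poly2 q t r"] z by simp
qed

text \<open>Leading coefficients of nonzero squares are positive and cannot cancel.\<close>

lemma sos_degree:
  fixes p :: "real poly"
  assumes "p \<in> sos UNIV"
  shows "p = 0 \<or> even (degree p) \<and> 0 < lead_coeff p"
  using assms
proof (induction rule: sos_induct)
  case (step g h)
  have sq: "degree (g\<^sup>2) = 2 * degree g" "0 < lead_coeff (g\<^sup>2)" if "g \<noteq> 0"
    using that unfolding lead_coeff_power by (simp_all add: degree_power_eq)
  show ?case
  proof (cases "g = 0 \<or> h = 0")
    case True
    then show ?thesis using step.IH sq by auto
  next
    case False
    then have g: "even (degree (g\<^sup>2))" "0 < lead_coeff (g\<^sup>2)" and h: "even (degree h)" "0 < lead_coeff h"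
      using step.IH sq by auto
    consider "degree (g\<^sup>2) < degree h" | "degree h < degree (g\<^sup>2)" | "degree (g\<^sup>2) = degree h" by linarith
    then show ?thesis
    proof cases
      case 1
      then have "coeff (g\<^sup>2) (degree h) = 0" by (rule coeff_eq_0)
      then show ?thesis using h by (simp add: degree_add_eq_right[OF 1])
    next
      case 2
      then have "degree (g\<^sup>2 + h) = degree (g\<^sup>2)" by (rule degree_add_eq_left)
      then show ?thesis using g 2 by (simp only: coeff_add coeff_eq_0 add_0_right simp_thms)
    next
      case 3
      then have c: "0 < coeff (g\<^sup>2 + h) (degree h)" using g h by simp
      then have "degree (g\<^sup>2 + h) = degree h"
        using degree_add_le[of "g\<^sup>2" "degree h" h] 3 by (metis antisym le_degree less_irrefl order_refl)
      then show ?thesis using c h by simp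
    qed
  qed
qed simp

lemma univariate_psd_degree:
  fixes p :: "real poly"
  assumes "\<And>x. 0 \<le> poly p x" "p \<noteq> 0"
  shows "even (degree p)" "0 < lead_coeff p"
  using sos_degree[OF univariate_psd_sos[OF assms(1)]] assms(2) by auto

lemma univariate_pos_bound:
  fixes p :: "real poly"
  assumes pos: "\<And>x. 0 < poly p x" and deg: "degree p = 2 * e"
  shows "\<exists>c>0. \<forall>x. c * (1 + x\<^sup>2) ^ e \<le> poly p x"
proof -
  have "p \<noteq> 0" using pos[of 0] by auto
  then have lp: "0 < lead_coeff p" using pos univariate_psd_degree[of p] by (simp add: less_imp_le)
  have lc: "0 < poly (lead_coeff (map_poly (\<lambda>x. [:x:]) p)) t" for t
    using lp by (simp add: degree_map_poly rhom.coeff_map[OF const_poly_rhom])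
  have dm: "degree (map_poly (\<lambda>x. [:x:]) p) = 2 * e" by (simp add: degree_map_poly deg)
  obtain R c where c: "1 \<le> R" "0 < c" "\<And>r. R \<le> \<bar>r\<bar> \<Longrightarrow> c * (1 + r\<^sup>2) ^ e \<le> poly p r"
    using lower_bound_far_r[OF dm lc, of 0] by (auto simp: poly2_map_const)
  obtain m where m: "0 < m" "\<And>x. \<bar>x\<bar> \<le> R \<Longrightarrow> m \<le> poly p x" using poly_pos_compact[of R p] pos by blast
  define E where "E = (1 + R\<^sup>2) ^ e"
  have E: "0 < E" by (simp add: E_def add_pos_nonneg)
  have "min c (m / E) * (1 + x\<^sup>2) ^ e \<le> poly p x" for x
  proof (cases "\<bar>x\<bar> \<le> R")
    case True
    then have "x\<^sup>2 \<le> R\<^sup>2" using abs_le_square_iff[of x R] c(1) by simp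
    then have "(1 + x\<^sup>2) ^ e \<le> E" unfolding E_def by (intro power_mono) auto
    then have "min c (m / E) * (1 + x\<^sup>2) ^ e \<le> (m / E) * E" using m E by (intro mult_mono) auto
    then show ?thesis using m(2)[OF True] E by simp
  next
    case False
    have "min c (m / E) * (1 + x\<^sup>2) ^ e \<le> c * (1 + x\<^sup>2) ^ e" by (intro mult_right_mono) auto
    then show ?thesis using c(3)[of x] False by linarith
  qed
  then show ?thesis using c m E by (intro exI[of _ "min c (m / E)"]) auto
qed

section \<open>Cancelling even powers of linear factors\<close>

lemma sos_cancel_square:
  fixes P F :: "'a::idom"
  assumes P: "P \<noteq> 0" and real: "\<And>gs. P dvd (\<Sum>g\<leftarrow>gs. g\<^sup>2) \<Longrightarrow> \<forall>g\<in>set gs. P dvd g"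
  shows "P ^ (2 * n) * F \<in> sos UNIV \<Longrightarrow> F \<in> sos UNIV"
proof (induction n)
  case (Suc n)
  then obtain gs where gs: "P ^ (2 * Suc n) * F = (\<Sum>g\<leftarrow>gs. g\<^sup>2)" by (auto simp: sos_def)
  have "P dvd (\<Sum>g\<leftarrow>gs. g\<^sup>2)" unfolding gs[symmetric] by simp
  from real[OF this] have "\<forall>g\<in>set gs. \<exists>k. g = P * k" by (auto elim: dvdE)
  then obtain k where k: "\<forall>g\<in>set gs. g = P * k g" by metis
  have "(\<Sum>g\<leftarrow>gs. g\<^sup>2) = (\<Sum>g\<leftarrow>gs. P\<^sup>2 * (k g)\<^sup>2)"
    using k by (intro arg_cong[of _ _ sum_list] map_cong refl) (metis power_mult_distrib)
  also have "\<dots> = P\<^sup>2 * (\<Sum>g\<leftarrow>map k gs. g\<^sup>2)" by (simp add: sum_list_const_mult o_def)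
  finally have "P\<^sup>2 * (P ^ (2 * n) * F) = P\<^sup>2 * (\<Sum>g\<leftarrow>map k gs. g\<^sup>2)"
    using gs by (simp add: power2_eq_square mult_ac)
  then have "P ^ (2 * n) * F = (\<Sum>g\<leftarrow>map k gs. g\<^sup>2)" using P by simp
  then show ?case by (intro Suc.IH sosI[of "map k gs"]) auto
qed simp

lemma sum_list_squares_zero:
  assumes "(\<Sum>g\<leftarrow>gs. (f g)\<^sup>2) = (0::real)" "g \<in> set gs"
  shows "f g = 0"
proof -
  have "\<forall>x\<in>set (map (\<lambda>g. (f g)\<^sup>2) gs). x = 0"
    using assms(1) by (subst sum_list_nonneg_eq_0_iff[symmetric]) auto
  then show ?thesis using assms(2) by simp
qed

lemma poly2_sum_list: "poly2 (\<Sum>g\<leftarrow>gs. h g) t r = (\<Sum>g\<leftarrow>gs. poly2 (h g) t r)"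
  by (induction gs) simp_all

lemma sos_cancel_linear_r: "[:- [:a:], 1:] ^ (2 * n) * F \<in> sos UNIV \<Longrightarrow> F \<in> sos UNIV" for F :: "real poly poly"
proof (rule sos_cancel_square)
  fix gs :: "real poly poly list"
  assume "[:- [:a:], 1:] dvd (\<Sum>g\<leftarrow>gs. g\<^sup>2)"
  then have "(\<Sum>g\<leftarrow>gs. (poly2 g t a)\<^sup>2) = 0" for t unfolding linear_dvd_iff by (simp add: poly2_sum_list)
  then show "\<forall>g\<in>set gs. [:- [:a:], 1:] dvd g"
    using sum_list_squares_zero[of "\<lambda>g. poly2 g _ a"] unfolding linear_dvd_iff by blast
qed simp

lemma sos_cancel_linear_t: "[:[:- a, 1:]:] ^ (2 * n) * F \<in> sos UNIV \<Longrightarrow> F \<in> sos UNIV" for F :: "real poly poly"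
proof (rule sos_cancel_square)
  fix gs :: "real poly poly list"
  assume "[:[:- a, 1:]:] dvd (\<Sum>g\<leftarrow>gs. g\<^sup>2)"
  then have "(\<Sum>g\<leftarrow>gs. (poly2 g a r)\<^sup>2) = 0" for r unfolding const_linear_dvd_iff by (simp add: poly2_sum_list)
  then show "\<forall>g\<in>set gs. [:[:- a, 1:]:] dvd g"
    using sum_list_squares_zero[of "\<lambda>g. poly2 g a _"] unfolding const_linear_dvd_iff by blast
qed simp

section \<open>Changes of coordinates\<close>

lemma poly2_pcompose_shift [simp]: "poly2 (pcompose p [:[:a:], 1:]) t r = poly2 p t (a + r)"
  by (simp add: poly2_def poly_pcompose)

lemma tdeg_le_pcompose_shift: "tdeg_le f m \<Longrightarrow> tdeg_le (pcompose f [:[:c:], 1:]) m"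
proof (induction f)
  case (pCons a p)
  have "tdeg_le p m" using pCons.prems unfolding tdeg_le_def by (metis coeff_pCons_Suc)
  moreover have "tdeg_le [:[:c:], 1:] 0" by (auto simp: tdeg_le_def coeff_pCons split: nat.splits)
  ultimately have "tdeg_le ([:[:c:], 1:] * pcompose p [:[:c:], 1:]) (0 + m)"
    using pCons.IH by (intro tdeg_le_mult)
  moreover have "degree a \<le> m" using pCons.prems unfolding tdeg_le_def by (metis coeff_pCons_0)
  then have "tdeg_le [:a:] m" by (auto simp: tdeg_le_def coeff_pCons split: nat.splits)
  ultimately show ?case unfolding pcompose_pCons by (intro tdeg_le_add) simp_all
qed simp

lemma reverse_power_sum:
  fixes c :: "nat \<Rightarrow> real"
  assumes "x \<noteq> 0"
  shows "(\<Sum>k\<le>d. c k * x ^ (d - k)) = x ^ d * (\<Sum>k\<le>d. c k * (1 / x) ^ k)"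
  unfolding sum_distrib_left
proof (intro sum.cong refl)
  fix k assume "k \<in> {..d}"
  then have "x ^ d = x ^ (d - k) * x ^ k" by (simp flip: power_add)
  then show "c k * x ^ (d - k) = x ^ d * (c k * (1 / x) ^ k)" using assms by (simp add: power_divide)
qed

lemma inversion_ex:
  assumes "degree G \<le> L"
  shows "\<exists>G'. \<forall>t r. r \<noteq> a \<longrightarrow> poly2 G' t r = (r - a) ^ L * poly2 G t (1 / (r - a))"
proof -
  define H where "H = (\<Sum>k\<le>L. monom (coeff G k) (L - k))"
  have "poly2 (pcompose H [:[:- a:], 1:]) t r = (r - a) ^ L * poly2 G t (1 / (r - a))" if "r \<noteq> a" for t r
  proof -
    have "poly2 (pcompose H [:[:- a:], 1:]) t r = poly2 H t (r - a)" by simp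
    also have "\<dots> = (\<Sum>k\<le>L. poly (coeff G k) t * (r - a) ^ (L - k))"
      by (simp add: H_def) (simp add: poly2_def poly_monom)
    also have "\<dots> = (r - a) ^ L * poly2 G t (1 / (r - a))"
      using that by (simp add: reverse_power_sum poly2_sum_coeffs[OF assms])
    finally show ?thesis .
  qed
  then show ?thesis by blast
qed

lemma poly2_eqI_r:
  assumes "\<And>t r. r \<noteq> a \<Longrightarrow> poly2 f t r = poly2 g t r"
  shows "f = g"
proof -
  have "f * [:- [:a:], 1:] = g * [:- [:a:], 1:]"
  proof (rule poly2_eqI)
    fix t r
    have "poly2 [:- [:a:], 1:] t r = r - a" by (simp add: poly2_def)
    then show "poly2 (f * [:- [:a:], 1:]) t r = poly2 (g * [:- [:a:], 1:]) t r"
      using assms[of r t] by (cases "r = a") (simp_all only: poly2_simps, simp_all)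
  qed
  then show ?thesis by (simp only: mult_cancel_right) auto
qed

lemma poly2_eqI_t:
  assumes "\<And>t r. t \<noteq> a \<Longrightarrow> poly2 f t r = poly2 g t r"
  shows "f = g"
proof -
  have "f * [:[:- a, 1:]:] = g * [:[:- a, 1:]:]"
  proof (rule poly2_eqI)
    fix t r
    show "poly2 (f * [:[:- a, 1:]:]) t r = poly2 (g * [:[:- a, 1:]:]) t r"
      using assms[of t r] by (cases "t = a") (simp_all only: poly2_simps poly2_const, simp_all)
  qed
  then show ?thesis by (simp only: mult_cancel_right) auto
qed

lemma coeff_mult_top:
  fixes p q :: "'a::comm_semiring_0 poly"
  assumes "degree p \<le> i" "degree q \<le> j"
  shows "coeff (p * q) (i + j) = coeff p i * coeff q j"
proof -
  have "coeff (p * q) (i + j) = (\<Sum>l\<le>i + j. if l = i then coeff p i * coeff q j else 0)"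
    unfolding coeff_mult
  proof (intro sum.cong refl)
    fix l
    show "coeff p l * coeff q (i + j - l) = (if l = i then coeff p i * coeff q j else 0)"
    proof (cases l i rule: linorder_cases)
      case less
      then have "degree q < i + j - l" using assms(2) by linarith
      then show ?thesis using less by (simp add: coeff_eq_0)
    next
      case greater
      then have "degree p < l" using assms(1) by linarith
      then show ?thesis using greater by (simp add: coeff_eq_0)
    qed simp
  qed
  then show ?thesis by simp
qed

definition pos_denom_sos :: "real poly poly \<Rightarrow> bool" where
  "pos_denom_sos f \<longleftrightarrow> (\<exists>N. one_plus_sq ^ N * f \<in> sos UNIV)"

lemma sum_list_mult_const_real: "(\<Sum>g\<leftarrow>gs. c * h g) = c * (\<Sum>g\<leftarrow>gs. h g)" for c :: real
  by (induction gs) (simp_all add: distrib_left)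

text \<open>Under \<open>\<rho> = 1 / (r - a)\<close> each square becomes polynomial after
  multiplication by \<open>(r - a)^(2 K)\<close>. What is left of this power beside \<open>f\<close>
  is an even power of \<open>r - a\<close>, which a sum of squares can cancel.\<close>

lemma pos_denom_sos_inversion:
  assumes f: "\<And>t \<rho>. \<rho> \<noteq> 0 \<Longrightarrow> poly2 f' t \<rho> = \<rho> ^ (2 * e) * poly2 f t (a + 1 / \<rho>)"
    and good: "pos_denom_sos f'"
  shows "pos_denom_sos f"
proof -
  obtain N gs where gs: "one_plus_sq ^ N * f' = (\<Sum>g\<leftarrow>gs. g\<^sup>2)"
    using good by (auto simp: pos_denom_sos_def sos_def)
  \<comment> \<open>At least \<open>e\<close>, so that \<open>K - e\<close> is a true difference,
    and at least every \<open>degree g\<close>.\<close>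
  define K where "K = e + (\<Sum>g\<leftarrow>gs. degree g)"
  have dg: "degree g \<le> K" if "g \<in> set gs" for g
    using that member_le_sum_list[of "degree g" "map degree gs"] by (simp add: K_def)
  have "\<forall>g\<in>set gs. \<exists>g'. \<forall>t r. r \<noteq> a \<longrightarrow> poly2 g' t r = (r - a) ^ K * poly2 g t (1 / (r - a))"
    using inversion_ex dg by blast
  then obtain k where k: "\<And>g t r. g \<in> set gs \<Longrightarrow> r \<noteq> a \<Longrightarrow> poly2 (k g) t r = (r - a) ^ K * poly2 g t (1 / (r - a))"
    by metis
  have "[:- [:a:], 1:] ^ (2 * (K - e)) * (one_plus_sq ^ N * f) = (\<Sum>g\<leftarrow>gs. (k g)\<^sup>2)"
  proof (rule poly2_eqI_r)
    fix t r assume r: "r \<noteq> a"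
    define \<rho> where "\<rho> = 1 / (r - a)"
    have \<rho>: "\<rho> \<noteq> 0" "a + 1 / \<rho> = r" using r by (simp_all add: \<rho>_def)
    have "poly2 (\<Sum>g\<leftarrow>gs. (k g)\<^sup>2) t r = (\<Sum>g\<leftarrow>gs. (r - a) ^ (2 * K) * (poly2 g t \<rho>)\<^sup>2)"
      unfolding poly2_sum_list
      by (intro arg_cong[of _ _ sum_list] map_cong refl) (simp add: k[OF _ r] \<rho>_def power_mult_distrib power_even_eq)
    also have "\<dots> = (r - a) ^ (2 * K) * (\<Sum>g\<leftarrow>gs. (poly2 g t \<rho>)\<^sup>2)" by (rule sum_list_mult_const_real)
    also have "(\<Sum>g\<leftarrow>gs. (poly2 g t \<rho>)\<^sup>2) = poly2 (one_plus_sq ^ N * f') t \<rho>" by (simp add: gs poly2_sum_list)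
    also have "\<dots> = (1 + t\<^sup>2) ^ N * (\<rho> ^ (2 * e) * poly2 f t r)" using f[OF \<rho>(1), of t] \<rho>(2) by simp
    also have "(r - a) ^ (2 * K) * \<dots> = ((r - a) ^ (2 * K) * \<rho> ^ (2 * e)) * ((1 + t\<^sup>2) ^ N * poly2 f t r)" by simp
    also have "(r - a) ^ (2 * K) * \<rho> ^ (2 * e) = (r - a) ^ (2 * (K - e))"
    proof -
      have "2 * K = 2 * (K - e) + 2 * e" by (simp add: K_def)
      then have "(r - a) ^ (2 * K) = (r - a) ^ (2 * (K - e)) * (r - a) ^ (2 * e)" by (metis power_add)
      then show ?thesis using r by (simp add: \<rho>_def power_divide)
    qed
    finally have "poly2 (\<Sum>g\<leftarrow>gs. (k g)\<^sup>2) t r = (r - a) ^ (2 * (K - e)) * ((1 + t\<^sup>2) ^ N * poly2 f t r)" .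
    moreover have "poly2 [:- [:a:], 1:] t r = r - a" by (simp add: poly2_def)
    ultimately show "poly2 ([:- [:a:], 1:] ^ (2 * (K - e)) * (one_plus_sq ^ N * f)) t r = poly2 (\<Sum>g\<leftarrow>gs. (k g)\<^sup>2) t r"
      by (simp only: poly2_simps poly2_one_plus_sq)
  qed
  also have "\<dots> \<in> sos UNIV" by (rule sosI[of "map k gs"]) (simp_all add: o_def)
  finally have "one_plus_sq ^ N * f \<in> sos UNIV" by (rule sos_cancel_linear_r)
  then show ?thesis by (auto simp: pos_denom_sos_def)
qed

text \<open>The rotation of the circle \<open>\<real> \<union> {\<infinity>}\<close> that exchanges \<open>a\<close> and \<open>\<infinity>\<close>, acting on
  polynomials of degree at most \<open>L\<close>.\<close>
definition rot :: "real \<Rightarrow> nat \<Rightarrow> real poly \<Rightarrow> real poly" where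
  "rot a L p = (\<Sum>i\<le>L. smult (coeff p i) ([:1, a:] ^ i * [:- a, 1:] ^ (L - i)))"

lemma rot_0 [simp]: "rot a L 0 = 0"
  by (simp add: rot_def)

lemma poly_rot:
  assumes "degree p \<le> L" "t \<noteq> a"
  shows "poly (rot a L p) t = (t - a) ^ L * poly p ((a * t + 1) / (t - a))"
proof -
  have "poly (rot a L p) t = (\<Sum>i\<le>L. coeff p i * ((a * t + 1) ^ i * (t - a) ^ (L - i)))"
    by (simp add: rot_def poly_sum algebra_simps)
  also have "\<dots> = (\<Sum>i\<le>L. (t - a) ^ L * (coeff p i * ((a * t + 1) / (t - a)) ^ i))"
  proof (intro sum.cong refl)
    fix i assume "i \<in> {..L}"
    then have "(t - a) ^ L = (t - a) ^ (L - i) * (t - a) ^ i" by (simp flip: power_add)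
    then show "coeff p i * ((a * t + 1) ^ i * (t - a) ^ (L - i)) = (t - a) ^ L * (coeff p i * ((a * t + 1) / (t - a)) ^ i)"
      using assms(2) by (simp add: power_divide)
  qed
  finally show ?thesis by (simp add: poly_sum_le[OF assms(1)] sum_distrib_left)
qed

lemma poly_rot_pole: "poly (rot a L p) a = coeff p L * (1 + a\<^sup>2) ^ L"
proof -
  have "poly (rot a L p) a = (\<Sum>i\<le>L. if i = L then coeff p L * (1 + a\<^sup>2) ^ L else 0)"
    unfolding rot_def poly_sum by (intro sum.cong refl) (auto simp: power_0_left power2_eq_square)
  then show ?thesis by simp
qed

lemma degree_rot: "degree (rot a L p) \<le> L"
  unfolding rot_def
proof (intro degree_sum_le order_trans[OF degree_smult_le])
  fix i assume i: "i \<in> {..L}"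
  have "degree ([:1, a:] ^ i * [:- a, 1:] ^ (L - i)) \<le> degree ([:1, a:] ^ i) + degree ([:- a, 1:] ^ (L - i))"
    by (rule degree_mult_le)
  also have "\<dots> \<le> 1 * i + 1 * (L - i)"
    by (intro add_mono order_trans[OF degree_power_le] mult_right_mono) auto
  finally show "degree ([:1, a:] ^ i * [:- a, 1:] ^ (L - i)) \<le> L" using i by simp
qed simp

text \<open>Companion of \<open>poly_rot_pole\<close>: the values at \<open>a\<close> and at
  infinity change places, the latter being the coefficient of index \<open>L\<close>.\<close>

lemma coeff_rot_top:
  assumes "degree p \<le> L"
  shows "coeff (rot a L p) L = poly p a"
proof -
  have "coeff ([:1, a:] ^ i * [:- a, 1:] ^ (L - i)) L = a ^ i" if i: "i \<le> L" for i
  proof -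
    have d: "degree ([:1, a:] ^ i) \<le> i" using degree_power_le[of "[:1, a:]" i] by (auto split: if_splits)
    have "coeff ([:1, a:] ^ i) i = a ^ i"
    proof (induction i)
      case (Suc i)
      have "degree ([:1, a:] ^ i) \<le> i" using degree_power_le[of "[:1, a:]" i] by (auto split: if_splits)
      then have "coeff ([:1, a:] ^ i) (Suc i) = 0" by (intro coeff_eq_0) simp
      then show ?case using Suc by simp
    qed simp
    moreover have "coeff ([:- a, 1:] ^ (L - i)) (L - i) = 1" by (rule coeff_linear_power)
    moreover have "coeff ([:1, a:] ^ i * [:- a, 1:] ^ (L - i)) (i + (L - i)) = coeff ([:1, a:] ^ i) i * coeff ([:- a, 1:] ^ (L - i)) (L - i)"
      using d degree_linear_power[of "- a" "L - i"] by (intro coeff_mult_top) auto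
    ultimately show ?thesis using i by simp
  qed
  then have "coeff (rot a L p) L = (\<Sum>i\<le>L. coeff p i * a ^ i)" by (simp add: rot_def coeff_sum)
  then show ?thesis by (simp add: poly_sum_le[OF assms])
qed

definition rot2 :: "real \<Rightarrow> nat \<Rightarrow> real poly poly \<Rightarrow> real poly poly" where
  "rot2 a L f = map_poly (rot a L) f"

lemma coeff_rot2 [simp]: "coeff (rot2 a L f) k = rot a L (coeff f k)"
  by (simp add: rot2_def coeff_map_poly)

lemma tdeg_le_rot2: "tdeg_le (rot2 a L f) L"
  by (simp add: tdeg_le_def degree_rot)

lemma poly2_rot2:
  assumes "tdeg_le f L" "t \<noteq> a"
  shows "poly2 (rot2 a L f) t r = (t - a) ^ L * poly2 f ((a * t + 1) / (t - a)) r"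
proof -
  have "degree (rot2 a L f) \<le> degree f" unfolding rot2_def by (rule map_poly_degree_leq)
  from poly2_sum_coeffs[OF this] have "poly2 (rot2 a L f) t r = (\<Sum>k\<le>degree f. (t - a) ^ L * (poly (coeff f k) ((a * t + 1) / (t - a)) * r ^ k))"
    using assms by (simp add: poly_rot tdeg_le_def mult.assoc)
  then show ?thesis by (simp add: poly2_sum_coeffs[OF order_refl] sum_distrib_left)
qed

text \<open>\<open>rot\<close> is linear and acts on \<open>t\<close>, whereas the derivative is
  taken in \<open>r\<close>.\<close>

lemma pderiv_rot2: "pderiv (rot2 a L f) = rot2 a L (pderiv f)"
proof (rule poly_eqI)
  fix k
  have s: "rot a L (smult c p) = smult c (rot a L p)" for c p
    by (rule poly_eqI) (simp add: rot_def coeff_sum sum_distrib_left mult.assoc)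
  have n: "of_nat m * (p :: real poly) = smult (of_nat m) p" for m p
    by (simp add: of_nat_poly)
  show "coeff (pderiv (rot2 a L f)) k = coeff (rot2 a L (pderiv f)) k"
    by (simp only: coeff_pderiv coeff_rot2 n s)
qed

text \<open>With \<open>a = tan \<alpha>\<close> and \<open>t = tan \<phi>\<close> this is
  \<open>s = cot (\<phi> - \<alpha>)\<close>, an isometry of the circle. Accordingly
  \<open>1 + t^2\<close> changes only by a positive constant and a square, so denominators of this
  form are preserved.\<close>

lemma rot_involution:
  assumes "t \<noteq> (a :: real)"
  defines "s \<equiv> (a * t + 1) / (t - a)"
  shows "s - a = (1 + a\<^sup>2) / (t - a)" "s \<noteq> a" "(a * s + 1) / (s - a) = t" "1 + s\<^sup>2 = (1 + a\<^sup>2) * (1 + t\<^sup>2) / (t - a)\<^sup>2"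
proof -
  have q: "1 + a\<^sup>2 \<noteq> 0" by (simp add: add_pos_nonneg less_imp_neq[symmetric])
  show sa: "s - a = (1 + a\<^sup>2) / (t - a)" using assms by (simp add: s_def field_simps power2_eq_square)
  then show "s \<noteq> a" using q assms by auto
  have "a * s + 1 = t * (1 + a\<^sup>2) / (t - a)" using assms by (simp add: s_def field_simps power2_eq_square)
  then show "(a * s + 1) / (s - a) = t" using sa q assms by simp
  show "1 + s\<^sup>2 = (1 + a\<^sup>2) * (1 + t\<^sup>2) / (t - a)\<^sup>2"
    using assms by (simp add: s_def power_divide divide_simps) (simp add: power2_eq_square algebra_simps)
qed

lemma pos_denom_sos_rot:
  assumes td: "tdeg_le f (2 * n)" and good: "pos_denom_sos (rot2 a (2 * n) f)"
  shows "pos_denom_sos f"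
proof -
  obtain N gs where gs: "one_plus_sq ^ N * rot2 a (2 * n) f = (\<Sum>g\<leftarrow>gs. g\<^sup>2)"
    using good by (auto simp: pos_denom_sos_def sos_def)
  obtain K0 where K0: "\<And>g. g \<in> set gs \<Longrightarrow> tdeg_le g K0" using tdeg_le_list_ex by blast
  \<comment> \<open>\<open>K0\<close> covers the degrees of the summands in \<open>t\<close>,
    \<open>N\<close> the denominators \<open>(t - a)^2\<close> of \<open>1 + s^2\<close>, and
    \<open>n\<close> that of \<open>(s - a)^(2 n)\<close>. The surplus \<open>(t - a)^(2 K0)\<close>
    is cancelled at the end.\<close>
  define K where "K = K0 + N + n"
  have tg: "tdeg_le g K" if "g \<in> set gs" for g using K0[OF that] by (rule tdeg_le_mono) (simp add: K_def)
  define A where "A = (1 + a\<^sup>2) ^ (N + 2 * n)"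
  have A: "0 < A" by (simp add: A_def add_pos_nonneg)
  have "[:[:A:]:] * ([:[:- a, 1:]:] ^ (2 * K0) * (one_plus_sq ^ N * f)) = (\<Sum>g\<leftarrow>gs. (rot2 a K g)\<^sup>2)"
  proof (rule poly2_eqI_t)
    fix t r assume t: "t \<noteq> a"
    define s where "s = (a * t + 1) / (t - a)"
    note inv = rot_involution[OF t, folded s_def]
    have "poly2 (\<Sum>g\<leftarrow>gs. (rot2 a K g)\<^sup>2) t r = (\<Sum>g\<leftarrow>gs. (t - a) ^ (2 * K) * (poly2 g s r)\<^sup>2)"
      unfolding poly2_sum_list
      by (intro arg_cong[of _ _ sum_list] map_cong refl) (simp add: poly2_rot2[OF tg t] s_def power_mult_distrib power_even_eq)
    also have "\<dots> = (t - a) ^ (2 * K) * (\<Sum>g\<leftarrow>gs. (poly2 g s r)\<^sup>2)" by (rule sum_list_mult_const_real)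
    also have "(\<Sum>g\<leftarrow>gs. (poly2 g s r)\<^sup>2) = poly2 (one_plus_sq ^ N * rot2 a (2 * n) f) s r" by (simp add: gs poly2_sum_list)
    also have "\<dots> = (1 + s\<^sup>2) ^ N * ((s - a) ^ (2 * n) * poly2 f t r)"
      using poly2_rot2[OF td inv(2)] by (simp add: inv(3))
    also have "(t - a) ^ (2 * K) * \<dots> = ((t - a) ^ (2 * K) * ((1 + s\<^sup>2) ^ N * (s - a) ^ (2 * n))) * poly2 f t r" by simp
    also have "(t - a) ^ (2 * K) * ((1 + s\<^sup>2) ^ N * (s - a) ^ (2 * n)) = A * (t - a) ^ (2 * K0) * (1 + t\<^sup>2) ^ N"
    proof -
      have e: "(t - a) ^ (2 * K) = (t - a) ^ (2 * K0) * ((t - a)\<^sup>2) ^ N * (t - a) ^ (2 * n)"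
        by (simp add: K_def power_mult power_add)
      have "((t - a)\<^sup>2) ^ N * (1 + s\<^sup>2) ^ N = ((1 + a\<^sup>2) * (1 + t\<^sup>2)) ^ N"
        unfolding power_mult_distrib[symmetric] inv(4) using t by simp
      moreover have "(t - a) ^ (2 * n) * (s - a) ^ (2 * n) = (1 + a\<^sup>2) ^ (2 * n)"
        unfolding power_mult_distrib[symmetric] inv(1) using t by simp
      moreover have "(t - a) ^ (2 * K) * ((1 + s\<^sup>2) ^ N * (s - a) ^ (2 * n))
          = (t - a) ^ (2 * K0) * (((t - a)\<^sup>2) ^ N * (1 + s\<^sup>2) ^ N) * ((t - a) ^ (2 * n) * (s - a) ^ (2 * n))"
        unfolding e by (simp only: mult_ac)
      ultimately show ?thesis by (simp add: A_def power_mult_distrib power_add)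
    qed
    finally show "poly2 ([:[:A:]:] * ([:[:- a, 1:]:] ^ (2 * K0) * (one_plus_sq ^ N * f))) t r = poly2 (\<Sum>g\<leftarrow>gs. (rot2 a K g)\<^sup>2) t r"
      by simp
  qed
  also have "\<dots> \<in> sos UNIV" by (rule sosI[of "map (rot2 a K) gs"]) (simp_all add: o_def)
  finally have s: "[:[:A:]:] * ([:[:- a, 1:]:] ^ (2 * K0) * (one_plus_sq ^ N * f)) \<in> sos UNIV" .
  have "[:[:1 / A:]:] * ([:[:A:]:] * ([:[:- a, 1:]:] ^ (2 * K0) * (one_plus_sq ^ N * f))) \<in> sos UNIV"
    using A by (intro sos_mult_UNIV[OF nonneg_const_sos s]) simp
  also have "[:[:1 / A:]:] * ([:[:A:]:] * ([:[:- a, 1:]:] ^ (2 * K0) * (one_plus_sq ^ N * f))) = [:[:- a, 1:]:] ^ (2 * K0) * (one_plus_sq ^ N * f)"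
    using A by (intro poly2_eqI) simp
  finally have "one_plus_sq ^ N * f \<in> sos UNIV" by (rule sos_cancel_linear_t)
  then show ?thesis by (auto simp: pos_denom_sos_def)
qed

lemma reflect_shift_eval:
  fixes f :: "real poly poly"
  assumes deg: "degree f = d" and nz: "poly f [:a:] \<noteq> 0" and \<rho>: "\<rho> \<noteq> 0"
  shows "poly2 (reflect_poly (pcompose f [:[:a:], 1:])) t \<rho> = \<rho> ^ d * poly2 f t (a + 1 / \<rho>)"
proof -
  define g where "g = pcompose f [:[:a:], 1:]"
  have dg: "degree g = d" by (simp add: g_def degree_pcompose deg)
  have "poly2 (reflect_poly g) t \<rho> = (\<Sum>k\<le>d. poly (coeff g (d - k)) t * \<rho> ^ k)"
    using degree_reflect_poly_le[of g] dg by (subst poly2_sum_coeffs[of _ d]) (auto simp: coeff_reflect_poly)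
  also have "\<dots> = (\<Sum>k\<le>d. poly (coeff g k) t * \<rho> ^ (d - k))"
    by (rule sum.reindex_bij_witness[of _ "\<lambda>k. d - k" "\<lambda>k. d - k"]) auto
  also have "\<dots> = \<rho> ^ d * poly2 g t (1 / \<rho>)"
    using \<rho> by (simp add: reverse_power_sum poly2_sum_coeffs[OF eq_refl[OF dg]])
  finally show ?thesis by (simp add: g_def)
qed

text \<open>Reflection is multiplicative and, as the shifted \<open>f\<close> has nonzero constant
  coefficient, a second reflection undoes it. A square factor would therefore return to
  \<open>f\<close> with its degree intact.\<close>

lemma square_free_reflect_shift:
  fixes f :: "real poly poly"
  assumes sf: "\<And>s. 0 < degree s \<Longrightarrow> \<not> s\<^sup>2 dvd f" and nz: "poly f [:a:] \<noteq> 0" and s: "0 < degree s"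
  shows "\<not> s\<^sup>2 dvd reflect_poly (pcompose f [:[:a:], 1:])"
proof
  define g where "g = pcompose f [:[:a:], 1:]"
  assume "s\<^sup>2 dvd reflect_poly (pcompose f [:[:a:], 1:])"
  then obtain k where k: "reflect_poly g = s\<^sup>2 * k" unfolding g_def by (elim dvdE)
  have g0: "coeff g 0 \<noteq> 0" using nz by (simp add: g_def flip: poly_0_coeff_0) (simp add: poly_pcompose)
  then have "g \<noteq> 0" by auto
  then have "coeff (reflect_poly g) 0 \<noteq> 0" by simp
  then have s0: "coeff s 0 \<noteq> 0" by (auto simp: k power2_eq_square coeff_mult)
  have "g = (reflect_poly s)\<^sup>2 * reflect_poly k"
    using arg_cong[OF k, of reflect_poly] g0 by (simp add: reflect_poly_mult reflect_poly_power)
  moreover have "f = pcompose g [:[:- a:], 1:]"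
    by (simp add: g_def pcompose_assoc[symmetric] pcompose_pCons)
  ultimately have "f = (pcompose (reflect_poly s) [:[:- a:], 1:])\<^sup>2 * pcompose (reflect_poly k) [:[:- a:], 1:]"
    by (simp add: pcompose_mult pcompose_power)
  moreover have "degree (pcompose (reflect_poly s) [:[:- a:], 1:]) = degree s"
    using s0 by (simp add: degree_pcompose)
  ultimately show False using sf s by (metis dvd_triv_left)
qed

text \<open>Rotating all ingredients with matching degree bounds multiplies every product in the
  identity by the same power of \<open>t - a\<close>. The rotated \<open>D\<close> is nonzero
  because the underlying map is an involution on points.\<close>

lemma bezout_rot:
  assumes td: "tdeg_le f L" and bez: "u * f + v * pderiv f = [:D:]" and D: "D \<noteq> 0"
  shows "\<exists>u' v' D'. D' \<noteq> 0 \<and> u' * rot2 a L f + v' * pderiv (rot2 a L f) = [:D':]"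
proof -
  obtain b1 b2 where b: "tdeg_le u b1" "tdeg_le v b2" using tdeg_le_ex by metis
  define b where "b = b1 + b2 + degree D"
  have tu: "tdeg_le u b" and tv: "tdeg_le v b" and dD: "degree D \<le> b + L"
    using b by (auto simp: b_def intro: tdeg_le_mono)
  have tp: "tdeg_le (pderiv f) L"
    using td by (auto simp: tdeg_le_def coeff_pderiv of_nat_poly intro: order_trans[OF degree_smult_le])
  have "rot2 a b u * rot2 a L f + rot2 a b v * pderiv (rot2 a L f) = [:rot a (b + L) D:]"
    unfolding pderiv_rot2
  proof (rule poly2_eqI_t)
    fix t r assume t: "t \<noteq> a"
    have "poly2 u s r * poly2 f s r + poly2 v s r * poly2 (pderiv f) s r = poly D s" for s
      using arg_cong[OF bez, of "\<lambda>p. poly2 p s r"] by simp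
    note bs = this[of "(a * t + 1) / (t - a)"]
    have "poly2 (rot2 a b u * rot2 a L f + rot2 a b v * rot2 a L (pderiv f)) t r
      = (t - a) ^ (b + L) * poly D ((a * t + 1) / (t - a))"
      unfolding bs[symmetric]
      by (simp only: poly2_simps poly2_rot2[OF tu t] poly2_rot2[OF tv t] poly2_rot2[OF td t] poly2_rot2[OF tp t])
        (simp add: power_add distrib_left mult_ac)
    then show "poly2 (rot2 a b u * rot2 a L f + rot2 a b v * rot2 a L (pderiv f)) t r = poly2 [:rot a (b + L) D:] t r"
      by (simp add: poly_rot[OF dD t])
  qed
  moreover have "rot a (b + L) D \<noteq> 0"
  proof
    assume z: "rot a (b + L) D = 0"
    have "finite ({x. poly D x = 0} \<union> {a})" using poly_roots_finite[OF D] by simp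
    then obtain s where s: "poly D s \<noteq> 0" "s \<noteq> a" using ex_new_if_finite[OF infinite_UNIV_char_0] by blast
    define t where "t = (a * s + 1) / (s - a)"
    note inv = rot_involution[OF s(2), folded t_def]
    have "poly (rot a (b + L) D) t = (t - a) ^ (b + L) * poly D s"
      using poly_rot[OF dD inv(2)] by (simp add: inv(3))
    then show False using z s inv(2) by simp
  qed
  ultimately show ?thesis by blast
qed

text \<open>Only finitely many \<open>t\<close> carry zeros, and each of them only finitely many.
  Hence a line \<open>r = r0\<close> free of zeros exists.\<close>

lemma finite_zero_ordinates:
  assumes psd: "\<And>t r. 0 \<le> poly2 f t r" and bez: "u * f + v * pderiv f = [:D:]" "D \<noteq> 0"
    and nd: "\<And>a. \<not> [:[:- a, 1:]:] dvd f"
  shows "finite {r. \<exists>t. poly2 f t r = 0}"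
proof (rule finite_subset)
  show "{r. \<exists>t. poly2 f t r = 0} \<subseteq> (\<Union>t\<in>{t. poly D t = 0}. {r. poly (map_poly (\<lambda>p. poly p t) f) r = 0})"
    using zero_of_bezout[OF psd bez(1)] by (auto simp flip: poly2_altdef)
  have "map_poly (\<lambda>p. poly p t) f \<noteq> 0" for t
    using nd[of t] unfolding const_linear_dvd_iff poly2_altdef by auto
  then show "finite (\<Union>t\<in>{t. poly D t = 0}. {r. poly (map_poly (\<lambda>p. poly p t) f) r = 0})"
    using poly_roots_finite[OF bez(2)] poly_roots_finite by blast
qed

lemma coeff_poly_const: "coeff (poly f [:c:]) m = poly (map_poly (\<lambda>p. coeff p m) f) c" for f :: "real poly poly"
  by (induction f) (simp_all add: map_poly_pCons)

lemma univariate_psd_degree_slice: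
  assumes psd: "\<And>t r. 0 \<le> poly2 f t r" and f: "f \<noteq> 0"
  shows "even (degree f)"
proof -
  have lc: "lead_coeff f \<noteq> 0" using f by simp
  obtain t where t: "poly (lead_coeff f) t \<noteq> 0"
    using poly_roots_finite[OF lc] ex_new_if_finite[OF infinite_UNIV_char_0] by blast
  define p where "p = map_poly (\<lambda>p. poly p t) f"
  have "degree p = degree f" unfolding p_def using t by (rule map_poly_degree_eq)
  moreover have "p \<noteq> 0" using t by (auto simp: p_def poly_eq_iff rhom.coeff_map[OF poly_eval_rhom])
  moreover have "0 \<le> poly p x" for x using psd by (simp add: p_def flip: poly2_altdef)
  ultimately show ?thesis using univariate_psd_degree(1)[of p] by simp
qed

lemma poly2_psd_closure_t: "(\<And>t. t \<noteq> a \<Longrightarrow> 0 \<le> poly2 f t r) \<Longrightarrow> 0 \<le> poly2 f t r"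
  using poly_nonneg_closure[of a "poly f [:r:]"] by (cases "t = a") (auto simp: poly2_slice_t)

lemma poly2_psd_closure_r: "(\<And>r. r \<noteq> a \<Longrightarrow> 0 \<le> poly2 f t r) \<Longrightarrow> 0 \<le> poly2 f t r"
  using poly_nonneg_closure[of a "map_poly (\<lambda>p. poly p t) f"] by (cases "r = a") (auto simp flip: poly2_altdef)

text \<open>After the inversion the leading coefficient is positive; the rotation then moves a line
  \<open>t = a\<close> without zeros to \<open>t = \<infinity>\<close>.\<close>
lemma square_reduced_psd:
  fixes f :: "real poly poly"
  assumes red: "square_reduced f" and psd: "\<And>t r. 0 \<le> poly2 f t r"
  shows "pos_denom_sos f"
proof -
  have f0: "f \<noteq> 0" and sf: "\<And>s. 0 < degree s \<Longrightarrow> \<not> s\<^sup>2 dvd f" and nd: "\<And>a. \<not> [:[:- a, 1:]:] dvd f"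
    using red unfolding square_reduced_def by blast+
  obtain u v D where bez: "D \<noteq> 0" "u * f + v * pderiv f = [:D:]" using square_free_bezout[OF f0 sf] by blast
  obtain e where deg: "degree f = 2 * e" using univariate_psd_degree_slice[OF psd f0] by (elim evenE)
  define m where "m = Max ((\<lambda>k. degree (coeff f k)) ` {..degree f})"
  have td: "tdeg_le f m" unfolding tdeg_le_def
  proof
    fix k show "degree (coeff f k) \<le> m"
      by (cases "k \<le> degree f") (auto simp: m_def coeff_eq_0 intro!: Max_ge)
  qed
  have "m \<in> (\<lambda>k. degree (coeff f k)) ` {..degree f}" unfolding m_def by (intro Max_in) auto
  then obtain k0 where k0: "degree (coeff f k0) = m" by blast
  define T where "T = map_poly (\<lambda>p. coeff p m) f"
  have "\<exists>k. coeff f k \<noteq> 0 \<and> degree (coeff f k) = m"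
  proof (cases "m = 0")
    case True
    moreover have "degree (lead_coeff f) \<le> m" using td by (simp add: tdeg_le_def)
    ultimately show ?thesis using f0 by (intro exI[of _ "degree f"]) simp
  next
    case False
    then show ?thesis using k0 by (intro exI[of _ k0]) auto
  qed
  then obtain k1 where k1: "coeff f k1 \<noteq> 0" "degree (coeff f k1) = m" by blast
  have "coeff T k1 = lead_coeff (coeff f k1)" using k1 by (simp add: T_def coeff_map_poly)
  then have "coeff T k1 \<noteq> 0" using k1(1) by simp
  then have T0: "T \<noteq> 0" by (metis coeff_0)
  have "finite ({r. \<exists>t. poly2 f t r = 0} \<union> {r. poly T r = 0})"
    using finite_zero_ordinates[OF psd bez(2,1) nd] poly_roots_finite[OF T0] by simp
  \<comment> \<open>There are no zeros on \<open>r = r0\<close>, and the degree in \<open>t\<close>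
    does not drop there because \<open>T\<close> collects the coefficients of \<open>t^m\<close>. So
    \<open>p\<close> is positive of degree exactly \<open>m\<close>, which makes \<open>m\<close>
    even.\<close>
  then obtain r0 where r0: "\<And>t. poly2 f t r0 \<noteq> 0" "poly T r0 \<noteq> 0"
    using ex_new_if_finite[OF infinite_UNIV_char_0] by blast
  define p where "p = poly f [:r0:]"
  have p_pos: "0 < poly p t" for t
    using r0(1)[of t] psd[of t r0] by (simp add: p_def poly2_slice_t)
  have p0: "p \<noteq> 0" using p_pos[of 0] by auto
  have cp: "coeff p m \<noteq> 0" using r0(2) by (simp add: p_def T_def coeff_poly_const)
  \<comment> \<open>The inversion sends \<open>r0\<close> to infinity and makes the positive
    \<open>p\<close> the leading coefficient.\<close>
  define g where "g = reflect_poly (pcompose f [:[:r0:], 1:])"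
  have sh0: "coeff (pcompose f [:[:r0:], 1:]) 0 = p"
    by (simp add: p_def flip: poly_0_coeff_0) (simp add: poly_pcompose)
  have sh_nz: "coeff (pcompose f [:[:r0:], 1:]) 0 \<noteq> 0" unfolding sh0 by (rule p0)
  have dg: "degree g = 2 * e"
    unfolding g_def degree_reflect_poly_eq[OF sh_nz] by (simp add: degree_pcompose deg)
  have "coeff g (2 * e) = coeff (pcompose f [:[:r0:], 1:]) 0"
    by (simp only: g_def coeff_reflect_poly) (simp add: degree_pcompose deg)
  then have lg: "lead_coeff g = p" unfolding dg sh0 .
  have g0: "g \<noteq> 0" using lg p0 by auto
  have g_eval: "poly2 g t \<rho> = \<rho> ^ (2 * e) * poly2 f t (r0 + 1 / \<rho>)" if "\<rho> \<noteq> 0" for t \<rho>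
    unfolding g_def using deg p0 that by (intro reflect_shift_eval) (simp_all add: p_def)
  have g_psd: "0 \<le> poly2 g t \<rho>" for t \<rho>
    by (rule poly2_psd_closure_r[of 0]) (simp add: g_eval psd power_mult)
  have tg: "tdeg_le g m"
    using tdeg_le_pcompose_shift[OF td, of r0] by (auto simp: tdeg_le_def g_def coeff_reflect_poly)
  have "degree p \<le> m" using tg lg by (metis tdeg_le_def)
  then have dp: "degree p = m" using cp le_degree by (metis antisym)
  then obtain n where n: "m = 2 * n"
    using univariate_psd_degree(1)[OF less_imp_le[OF p_pos] p0] by (auto elim: evenE)
  have lp: "0 < coeff p (2 * n)" using univariate_psd_degree(2)[OF less_imp_le[OF p_pos] p0] by (simp add: dp n)
  have sfg: "\<not> s\<^sup>2 dvd g" if "0 < degree s" for s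
    unfolding g_def by (rule square_free_reflect_shift[OF sf p0[unfolded p_def] that])
  obtain u1 v1 D1 where bez1: "D1 \<noteq> 0" "u1 * g + v1 * pderiv g = [:D1:]"
    using square_free_bezout[OF g0 sfg] by blast
  \<comment> \<open>The line \<open>t = a\<close> carries no zeros since \<open>a\<close> is not a
    root of \<open>D1\<close>; after the rotation this slice is the top coefficient in
    \<open>t\<close>.\<close>
  obtain a where a: "poly D1 a \<noteq> 0"
    using poly_roots_finite[OF bez1(1)] ex_new_if_finite[OF infinite_UNIV_char_0] by blast
  have ga: "0 < poly2 g a r" for r
    using zero_of_bezout[OF g_psd bez1(2), of a r] a g_psd[of a r] by linarith
  define h where "h = rot2 a (2 * n) g"
  have tgn: "tdeg_le g (2 * n)" using tg n by simp
  obtain u2 v2 D2 where bez2: "D2 \<noteq> 0" "u2 * h + v2 * pderiv h = [:D2:]"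
    using bezout_rot[OF tgn bez1(2,1)] unfolding h_def by blast
  have h_psd: "0 \<le> poly2 h t r" for t r
    by (rule poly2_psd_closure_t[of a]) (simp add: h_def poly2_rot2[OF tgn] g_psd power_mult)
  have ch: "coeff h (2 * e) = rot a (2 * n) p" using lg dg by (simp add: h_def)
  have rp: "0 < poly (rot a (2 * n) p) t" for t
  proof (cases "t = a")
    case True
    then show ?thesis using lp by (simp add: poly_rot_pole add_pos_nonneg)
  next
    case False
    then show ?thesis using p_pos dp n by (simp add: poly_rot power_mult zero_less_mult_iff)
  qed
  have dh: "degree h = 2 * e"
  proof (rule antisym)
    show "degree h \<le> 2 * e" unfolding h_def rot2_def dg[symmetric] by (rule map_poly_degree_leq)
    show "2 * e \<le> degree h" by (rule le_degree) (use ch rp[of 0] in auto)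
  qed
  have lh: "0 < poly (lead_coeff h) t" for t using rp by (simp add: dh ch)
  have top: "map_poly (\<lambda>p. coeff p (2 * n)) h = map_poly (\<lambda>p. poly p a) g"
    using tgn by (simp add: poly_eq_iff coeff_map_poly h_def coeff_rot_top tdeg_le_def)
  have dtop: "degree (map_poly (\<lambda>p. poly p a) g) = 2 * e"
    unfolding dg[symmetric] using p_pos[of a] lg by (intro map_poly_degree_eq) simp
  obtain c0 where c0: "0 < c0" "\<And>r. c0 * (1 + r\<^sup>2) ^ e \<le> poly (map_poly (\<lambda>p. poly p a) g) r"
    using univariate_pos_bound[OF _ dtop] ga by (auto simp flip: poly2_altdef)
  have "pos_denom_sos h" unfolding pos_denom_sos_def
  proof (rule normalised_psd_sos[where n = n, OF h_psd dh _ lh c0(1) _ bez2(2,1)])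
    show "tdeg_le h (2 * n)" unfolding h_def by (rule tdeg_le_rot2)
    show "c0 * (1 + r\<^sup>2) ^ e \<le> poly (map_poly (\<lambda>p. coeff p (2 * n)) h) r" for r
      unfolding top by (rule c0(2))
  qed
  then have "pos_denom_sos g" unfolding h_def by (rule pos_denom_sos_rot[OF tgn])
  then show ?thesis using g_eval by (intro pos_denom_sos_inversion[of g e f r0])
qed

theorem psd_pos_denom_sos:
  assumes psd: "\<And>t r. 0 \<le> poly2 f t r"
  shows "\<exists>N. one_plus_sq ^ N * f \<in> sos UNIV"
proof (cases "f = 0")
  case True
  then show ?thesis by (simp add: sos_zero)
next
  case False
  obtain s g where sg: "f = s\<^sup>2 * g" "square_reduced g" "\<And>t r. 0 \<le> poly2 g t r"
    using square_reduction[OF False psd] by blast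
  from square_reduced_psd[OF sg(2,3)] obtain N where N: "one_plus_sq ^ N * g \<in> sos UNIV"
    by (auto simp: pos_denom_sos_def)
  have "s\<^sup>2 * (one_plus_sq ^ N * g) \<in> sos UNIV" by (intro sos_mult_UNIV sos_square N) simp
  then show ?thesis by (intro exI[of _ N]) (simp add: sg mult_ac)
qed


section \<open>The algebra generated by the inverse of the squared radius\<close>

text \<open>A chart of the blow-up of the origin: \<open>x = t r\<close>,
  \<open>y = r\<close>.\<close>

lemma polar_chart_ex: "\<exists>F. \<forall>t r. poly2 F t r = poly2 p (t * r) r"
proof (induction p)
  case 0
  then show ?case by (intro exI[of _ 0]) simp
next
  case (pCons c p)
  then obtain F where F: "\<And>t r. poly2 F t r = poly2 p (t * r) r" by blast
  have "\<exists>C. \<forall>t r. poly2 C t r = poly c (t * r)"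
  proof (induction c)
    case 0
    then show ?case by (intro exI[of _ 0]) simp
  next
    case (pCons a c)
    then obtain C where "\<And>t r. poly2 C t r = poly c (t * r)" by blast
    then show ?case by (intro exI[of _ "[:[:a:]:] + varX * varY * C"]) (simp add: algebra_simps)
  qed
  then obtain C where C: "\<And>t r. poly2 C t r = poly c (t * r)" by blast
  have "poly2 (C + varY * F) t r = poly2 (pCons c p) (t * r) r" for t r
    using F[of t r] by (simp add: C) (simp add: poly2_def)
  then show ?case by blast
qed

lemma clear_denominators_ex:
  assumes "tdeg_le g K"
  shows "\<exists>g'. \<forall>a b. b \<noteq> 0 \<longrightarrow> poly2 g' a b = b ^ K * poly2 g (a / b) b"
proof -
  define g' where "g' = (\<Sum>k\<le>degree g. \<Sum>i\<le>K. [:[:coeff (coeff g k) i:]:] * varX ^ i * varY ^ (K - i + k))"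
  have "poly2 g' a b = b ^ K * poly2 g (a / b) b" if b: "b \<noteq> 0" for a b
  proof -
    have "b ^ K * poly2 g (a / b) b = (\<Sum>k\<le>degree g. \<Sum>i\<le>K. b ^ K * (coeff (coeff g k) i * (a / b) ^ i * b ^ k))"
    proof -
      have "poly (coeff g k) x = (\<Sum>i\<le>K. coeff (coeff g k) i * x ^ i)" for k x
        using assms by (intro poly_sum_le) (simp add: tdeg_le_def)
      then show ?thesis by (simp add: poly2_sum_coeffs[OF order_refl] sum_distrib_left sum_distrib_right)
    qed
    also have "\<dots> = (\<Sum>k\<le>degree g. \<Sum>i\<le>K. coeff (coeff g k) i * a ^ i * b ^ (K - i + k))"
    proof (intro sum.cong refl)
      fix k i assume "i \<in> {..K}"
      then have "b ^ K = b ^ (K - i) * b ^ i" by (simp flip: power_add)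
      then show "b ^ K * (coeff (coeff g k) i * (a / b) ^ i * b ^ k) = coeff (coeff g k) i * a ^ i * b ^ (K - i + k)"
        using b by (simp add: power_divide power_add)
    qed
    also have "\<dots> = poly2 g' a b" by (simp add: g'_def del: mult_pCons_left)
    finally show ?thesis by simp
  qed
  then show ?thesis by blast
qed

text \<open>Substituting \<open>t = x / y\<close> back turns \<open>1 + t^2\<close> into
  \<open>(x^2 + y^2) / y^2\<close>. Clearing denominators leaves an even power of \<open>y\<close>,
  which a sum of squares can cancel.\<close>

lemma psd_radius_denom_sos:
  assumes psd: "\<And>a b. 0 \<le> poly2 p a b"
  shows "\<exists>N. (varX\<^sup>2 + varY\<^sup>2) ^ N * p \<in> sos UNIV"
proof -
  obtain F where F: "\<And>t r. poly2 F t r = poly2 p (t * r) r" using polar_chart_ex by blast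
  obtain N gs where gs: "one_plus_sq ^ N * F = (\<Sum>g\<leftarrow>gs. g\<^sup>2)"
    using psd_pos_denom_sos[of F] psd by (auto simp: F sos_def)
  obtain K0 where K0: "\<And>g. g \<in> set gs \<Longrightarrow> tdeg_le g K0" using tdeg_le_list_ex by blast
  \<comment> \<open>\<open>K0\<close> clears the summands, \<open>N\<close> the denominator
    \<open>y^(2 N)\<close> of \<open>(1 + t^2)^N\<close>.\<close>
  define K where "K = K0 + N"
  have "\<forall>g\<in>set gs. \<exists>g'. \<forall>a b. b \<noteq> 0 \<longrightarrow> poly2 g' a b = b ^ K * poly2 g (a / b) b"
    using clear_denominators_ex tdeg_le_mono[OF K0] by (simp add: K_def)
  then obtain k where k: "\<And>g a b. g \<in> set gs \<Longrightarrow> b \<noteq> 0 \<Longrightarrow> poly2 (k g) a b = b ^ K * poly2 g (a / b) b"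
    by metis
  have "[:- [:0:], 1:] ^ (2 * K0) * ((varX\<^sup>2 + varY\<^sup>2) ^ N * p) = (\<Sum>g\<leftarrow>gs. (k g)\<^sup>2)"
  proof (rule poly2_eqI_r)
    fix a b :: real assume b: "b \<noteq> 0"
    have "poly2 (\<Sum>g\<leftarrow>gs. (k g)\<^sup>2) a b = (\<Sum>g\<leftarrow>gs. b ^ (2 * K) * (poly2 g (a / b) b)\<^sup>2)"
      unfolding poly2_sum_list
      by (intro arg_cong[of _ _ sum_list] map_cong refl) (simp add: k[OF _ b] power_mult_distrib power_even_eq)
    also have "\<dots> = b ^ (2 * K) * (\<Sum>g\<leftarrow>gs. (poly2 g (a / b) b)\<^sup>2)" by (rule sum_list_mult_const_real)
    also have "(\<Sum>g\<leftarrow>gs. (poly2 g (a / b) b)\<^sup>2) = poly2 (one_plus_sq ^ N * F) (a / b) b" by (simp add: gs poly2_sum_list)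
    also have "\<dots> = (1 + (a / b)\<^sup>2) ^ N * poly2 p a b" using b by (simp add: F)
    also have "b ^ (2 * K) * \<dots> = b ^ (2 * K0) * ((b\<^sup>2) ^ N * (1 + (a / b)\<^sup>2) ^ N) * poly2 p a b"
      by (simp add: K_def power_add power_mult)
    also have "(b\<^sup>2) ^ N * (1 + (a / b)\<^sup>2) ^ N = (a\<^sup>2 + b\<^sup>2) ^ N"
    proof -
      have "b\<^sup>2 * (1 + (a / b)\<^sup>2) = a\<^sup>2 + b\<^sup>2" using b by (simp add: power_divide distrib_left)
      then have "(b\<^sup>2 * (1 + (a / b)\<^sup>2)) ^ N = (a\<^sup>2 + b\<^sup>2) ^ N" by (rule arg_cong)
      then show ?thesis by (subst (asm) power_mult_distrib)
    qed
    finally have "poly2 (\<Sum>g\<leftarrow>gs. (k g)\<^sup>2) a b = b ^ (2 * K0) * (a\<^sup>2 + b\<^sup>2) ^ N * poly2 p a b" .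
    moreover have "poly2 [:- [:0:], 1:] a b = b" by (simp add: poly2_def)
    ultimately show "poly2 ([:- [:0:], 1:] ^ (2 * K0) * ((varX\<^sup>2 + varY\<^sup>2) ^ N * p)) a b = poly2 (\<Sum>g\<leftarrow>gs. (k g)\<^sup>2) a b"
      by (simp only: poly2_simps mult.assoc)
  qed
  also have "\<dots> \<in> sos UNIV" by (rule sosI[of "map k gs"]) (simp_all add: o_def)
  finally have "(varX\<^sup>2 + varY\<^sup>2) ^ N * p \<in> sos UNIV" by (rule sos_cancel_linear_r)
  then show ?thesis by blast
qed

lemma radius_nonzero: "varX\<^sup>2 + varY\<^sup>2 \<noteq> 0"
proof
  assume "varX\<^sup>2 + varY\<^sup>2 = 0"
  then have "poly2 (varX\<^sup>2 + varY\<^sup>2) 1 0 = 0" by (simp only: poly2_simps)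
  then show False by simp
qed

lemma algA_normal_form:
  assumes "f \<in> algA"
  shows "\<exists>p n. f = Fract p ((varX\<^sup>2 + varY\<^sup>2) ^ n)"
proof -
  define w where "w = varX\<^sup>2 + varY\<^sup>2"
  have "w \<noteq> 0" unfolding w_def by (rule radius_nonzero)
  then have w: "w ^ n \<noteq> 0" for n by simp
  define S where "S = {f. \<exists>p n. f = Fract p (w ^ n)}"
  have I: "Fract p (w ^ n) \<in> S" for p n by (auto simp: S_def)
  have "is_subring S" unfolding is_subring_def
  proof (intro conjI ballI)
    show "1 \<in> S" using I[of 1 0] by (simp add: One_fract_def)
    fix f g assume "f \<in> S" "g \<in> S"
    then obtain p n q m where fg: "f = Fract p (w ^ n)" "g = Fract q (w ^ m)" by (auto simp: S_def)
    show "f + g \<in> S" "f * g \<in> S" "- f \<in> S" using w by (simp_all add: fg I flip: power_add)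
  qed
  moreover have "to_fract p \<in> S" for p using I[of p 0] by (simp add: to_fract_def)
  moreover have "inverse (to_fract w) \<in> S" using I[of 1 1] by (simp add: to_fract_def)
  ultimately have "algA \<subseteq> S" unfolding algA_def w_def[symmetric] by (intro hull_minimal) auto
  then show ?thesis using assms by (auto simp: S_def w_def)
qed

text \<open>Turns nonnegativity under all characters into nonnegativity at all points off the
  origin.\<close>

lemma evaluation_is_character:
  assumes P: "(a, b) \<noteq> (0, 0)"
  shows "is_character const algA (\<lambda>f. ev f (a, b))"
proof -
  have rep: "\<exists>p q. poly2 q a b \<noteq> 0 \<and> q \<noteq> 0 \<and> f = Fract p q" if "f \<in> algA" for f
    using algA_regular[OF that P] by (metis poly2_simps(1))
  show ?thesis unfolding is_character_def
  proof (intro conjI ballI allI)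
    show "ev 1 (a, b) = 1" using ev_Fract[of 1 a b 1] by (simp add: One_fract_def)
    fix f assume "f \<in> algA"
    then obtain p q where f: "poly2 q a b \<noteq> 0" "q \<noteq> 0" "f = Fract p q" using rep by blast
    show "ev (const c * f) (a, b) = c * ev f (a, b)" for c
      using f by (simp add: const_def to_fract_def ev_Fract del: mult_pCons_left)
    fix g assume "g \<in> algA"
    then obtain p' q' where g: "poly2 q' a b \<noteq> 0" "q' \<noteq> 0" "g = Fract p' q'" using rep by blast
    show "ev (f + g) (a, b) = ev f (a, b) + ev g (a, b)" "ev (f * g) (a, b) = ev f (a, b) * ev g (a, b)"
      using f g by (simp_all add: ev_Fract add_frac_eq)
  qed
qed

lemma algA_psd_sos:
  assumes f: "f \<in> algA" and psd: "\<And>P. P \<noteq> (0, 0) \<Longrightarrow> 0 \<le> ev f P"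
  shows "f \<in> sos algA"
proof -
  define w where "w = varX\<^sup>2 + varY\<^sup>2"
  obtain p n where fp: "f = Fract p (w ^ n)" using algA_normal_form[OF f] unfolding w_def by blast
  have "w \<noteq> 0" unfolding w_def by (rule radius_nonzero)
  then have w: "w ^ k \<noteq> 0" for k by simp
  have pos: "0 \<le> poly2 p a b" if "(a, b) \<noteq> (0, 0)" for a b
  proof -
    have "0 < (a\<^sup>2 + b\<^sup>2) ^ n" using that by (intro zero_less_power) (simp add: sum_power2_gt_zero_iff)
    moreover have "poly2 (w ^ n) a b = (a\<^sup>2 + b\<^sup>2) ^ n" by (simp add: w_def)
    ultimately have W: "0 < poly2 (w ^ n) a b" by simp
    then have "ev f (a, b) = poly2 p a b / poly2 (w ^ n) a b" unfolding fp by (intro ev_Fract less_imp_neq[symmetric])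
    then show ?thesis using psd[OF that] W by (simp only: zero_le_divide_iff) linarith
  qed
  \<comment> \<open>Continuity in the first variable supplies the origin.\<close>
  have "0 \<le> poly2 p a b" for a b
    by (rule poly2_psd_closure_t[of 0]) (use pos in auto)
  then obtain N where N: "w ^ N * p \<in> sos UNIV" using psd_radius_denom_sos unfolding w_def by blast
  have ws: "w \<in> sos UNIV" unfolding w_def by (intro sos_add sos_square) auto
  \<comment> \<open>Chosen so that \<open>p / w^n = w^M p / (w^(N + n))^2\<close>, a sum of squares
    times a square in the algebra.\<close>
  define M where "M = N + (N + n)"
  have "w ^ (N + n) * (w ^ N * p) \<in> sos UNIV" by (intro sos_mult_UNIV[OF sos_power[OF ws] N])
  then have M: "w ^ M * p \<in> sos UNIV" by (simp add: M_def power_add mult_ac)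
  have hom: "rhom to_fract" by unfold_locales simp_all
  have sub: "range to_fract \<subseteq> algA" "inverse (to_fract w) \<in> algA"
    unfolding algA_def w_def using hull_subset[of "range to_fract \<union> {inverse (to_fract (varX\<^sup>2 + varY\<^sup>2))}" is_subring] by auto
  have mult: "x * y \<in> algA" if "x \<in> algA" "y \<in> algA" for x y
    using is_subring_algA that by (auto simp: is_subring_def)
  have one: "1 \<in> algA" using is_subring_algA by (simp add: is_subring_def)
  have s1: "to_fract (w ^ M * p) \<in> sos algA"
    using sos_mono[OF sub(1) sos_map[OF hom M]] .
  have "inverse (to_fract w) ^ k \<in> algA" for k
    by (induction k) (simp_all add: one mult sub)
  then have s2: "(inverse (to_fract w) ^ (N + n))\<^sup>2 \<in> sos algA" by (rule sos_square)
  have "to_fract (w ^ M * p) * (inverse (to_fract w) ^ (N + n))\<^sup>2 \<in> sos algA"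
    by (rule sos_mult[OF mult s1 s2])
  also have "to_fract (w ^ M * p) * (inverse (to_fract w) ^ (N + n))\<^sup>2 = f"
  proof -
    define W where "W = to_fract w"
    have W: "W \<noteq> 0" using w[of 1] by (simp add: W_def)
    have tp: "to_fract (q ^ k) = to_fract q ^ k" for q :: "real poly poly" and k
      by (rule rhom.power[OF hom])
    have fW: "f = to_fract p / W ^ n" using w[of n] by (simp add: fp W_def Fract_conv_to_fract tp)
    have "W ^ M * to_fract p * (inverse W ^ (N + n))\<^sup>2 = to_fract p / W ^ n"
    proof -
      have "(W ^ (N + n))\<^sup>2 = W ^ M * W ^ n" by (simp add: M_def power2_eq_square power_add mult_ac)
      then show ?thesis using W by (simp add: power_inverse field_simps)
    qed
    then show ?thesis by (simp add: fW tp W_def)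
  qed
  finally show ?thesis .
qed

theorem theorem14:
  shows "psd_eq_sos const algA
    \<and> (\<forall>f\<in>algA. (\<forall>P. P \<noteq> (0, 0) \<longrightarrow> 0 \<le> ev f P) \<longrightarrow> f \<in> sos algA)"
proof (intro conjI ballI impI)
  show "psd_eq_sos const algA" unfolding psd_eq_sos_def
  proof (intro ballI impI)
    fix f assume f: "f \<in> algA" and char: "\<forall>\<phi>. is_character const algA \<phi> \<longrightarrow> 0 \<le> \<phi> f"
    show "f \<in> sos algA"
    proof (rule algA_psd_sos[OF f])
      fix P :: "real \<times> real" assume "P \<noteq> (0, 0)"
      then show "0 \<le> ev f P" using char evaluation_is_character[of "fst P" "snd P"] by (cases P) auto
    qed
  qed
qed (use algA_psd_sos in blast)

end
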